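(* Let $X$ be a locally compact, metric ANR with the Disjoint Arcs Property (DAP). Then $X$ has the Disjoint Path Concordances Property (DCP) if and only if $X\times\mathbb{R}$ has the Disjoint Disks Property (DDP).
   Context: All maps are continuous. $D$ and $I$ both denote the unit interval $[0,1]$. ANR means absolute neighborhood retract (for metric spaces). $\rho$ denotes the metric on $X$; for maps into $X$, $\rho(f,g)$ denotes the uniform distance, and $\operatorname{proj}_X\colon X\times I\to X$ is the projection. DAP: a metric space $X$ has the Disjoint Arcs Property if every pair of maps $f_1,f_2\colon D\to X$ can be approximated, arbitrarily closely, by maps $g_1,g_2\colon D\to X$ with $g_1(D)\cap g_2(D)=\emptyset$. DDP: a metric space $Y$ has the Disjoint Disks Property if every pair of maps $f_1,f_2\colon I^2\to Y$ can be approximated, arbitrarily closely, by maps $g_1,g_2\colon I^2\to Y$ with $g_1(I^2)\cap g_2(I^2)=\emptyset$. DCP: a path homotopy in $X$ is any map $D\times I\to X$. A path concordance in $X$ is a map $F\colon D\times I\to X\times I$ such that $F(D\times\{e\})\subset X\times\{e\}$ for $e\in\{0,1\}$. $(X,\rho)$ has the Disjoint Path Concordances Property if for any two path homotopies $f_1,f_2\colon D\times I\to X$ and any $\epsilon>0$ there exist path concordances $F_1,F_2\colon D\times I\to X\times I$ such that $F_1(D\times I)\cap F_2(D\times I)=\emptyset$ and $\rho(f_i,\operatorname{proj}_X F_i)<\epsilon$ for $i=1,2$. *)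

theory Defs
  imports "HOL-Analysis.Analysis"
begin

text \<open>
  A metric space is a set \<open>X\<close> in a type of class \<^class>\<open>metric_space\<close>, with the induced metric.
  A map \<open>A \<rightarrow> X\<close> is a HOL function, continuous on \<open>A\<close>
  and sending \<open>A\<close> into \<open>X\<close>; its values outside \<open>A\<close> are irrelevant.
\<close>

definition map_into :: "'a::topological_space set \<Rightarrow> 'b::topological_space set \<Rightarrow> ('a \<Rightarrow> 'b) \<Rightarrow> bool"
  where "map_into A X f \<longleftrightarrow> continuous_on A f \<and> f \<in> A \<rightarrow> X"

text \<open>
  The supremum below is only used for nonempty compact \<open>A\<close> and \<open>f\<close>, \<open>g\<close> continuous on \<open>A\<close>, so that
  it is taken over a nonempty bounded set.
\<close>

definition unif_dist :: "'a set \<Rightarrow> ('a \<Rightarrow> 'b::metric_space) \<Rightarrow> ('a \<Rightarrow> 'b) \<Rightarrow> real"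
  where "unif_dist A f g = (SUP x\<in>A. dist (f x) (g x))"

text \<open>
  Absolute neighbourhood retracts for the class of metric spaces: whenever \<open>X\<close> is embedded by \<open>h\<close> as
  a closed subset of a metric space \<open>Z\<close>, the image is a retract of an open neighbourhood of it in \<open>Z\<close>.
  The library constant \<^const>\<open>ANR\<close> is not used because it only tests subsets of \<open>'a \<times> real\<close>, which
  suffices when \<open>'a\<close> is a Euclidean space but not in general.

  HOL cannot quantify over the type of the points of \<open>Z\<close>, so \<open>Z\<close> ranges over all metric spaces, with
  arbitrary metric, whose points are of type \<open>'a \<Rightarrow> real\<close>. This loses nothing. For nonempty \<open>X\<close>, by
  Kuratowski and Wojdyslawski \<open>X\<close> embeds as a closed subset of a convex set \<open>C\<close> of the normed space of
  bounded functions \<open>X \<rightarrow> real\<close>, so \<open>C\<close> is among these \<open>Z\<close> and \<open>X\<close> is a retract of an open subset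
  of \<open>C\<close>. If \<open>X\<close> is closed in any metric space \<open>Z\<close> whatsoever, Dugundji's theorem extends the embedding
  \<open>X \<rightarrow> C\<close> to \<open>Z \<rightarrow> C\<close>, and composing with that retraction shows that \<open>X\<close> is a neighbourhood retract
  of \<open>Z\<close>.
\<close>

definition metric_ANR :: "'a::metric_space set \<Rightarrow> bool"
  where "metric_ANR X \<longleftrightarrow>
    (\<forall>(Z :: ('a \<Rightarrow> real) metric) h.
       embedding_map (top_of_set X) (mtopology_of Z) h \<and> closedin (mtopology_of Z) (h ` X) \<longrightarrow>
       (\<exists>U. openin (mtopology_of Z) U \<and> h ` X retract_of_space subtopology (mtopology_of Z) U))"

abbreviation unit_interval :: "real set"
  where "unit_interval \<equiv> {0..1}"

abbreviation unit_square :: "(real \<times> real) set"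
  where "unit_square \<equiv> unit_interval \<times> unit_interval"

definition disjoint_arcs_property :: "'a::metric_space set \<Rightarrow> bool"
  where "disjoint_arcs_property X \<longleftrightarrow>
    (\<forall>f1 f2. map_into unit_interval X f1 \<and> map_into unit_interval X f2 \<longrightarrow>
      (\<forall>\<epsilon>>0. \<exists>g1 g2. map_into unit_interval X g1 \<and> map_into unit_interval X g2 \<and>
         unif_dist unit_interval f1 g1 < \<epsilon> \<and> unif_dist unit_interval f2 g2 < \<epsilon> \<and>
         g1 ` unit_interval \<inter> g2 ` unit_interval = {}))"

definition disjoint_disks_property :: "'a::metric_space set \<Rightarrow> bool"
  where "disjoint_disks_property Y \<longleftrightarrow>
    (\<forall>f1 f2. map_into unit_square Y f1 \<and> map_into unit_square Y f2 \<longrightarrow>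
      (\<forall>\<epsilon>>0. \<exists>g1 g2. map_into unit_square Y g1 \<and> map_into unit_square Y g2 \<and>
         unif_dist unit_square f1 g1 < \<epsilon> \<and> unif_dist unit_square f2 g2 < \<epsilon> \<and>
         g1 ` unit_square \<inter> g2 ` unit_square = {}))"

definition path_homotopy_in :: "'a::metric_space set \<Rightarrow> (real \<times> real \<Rightarrow> 'a) \<Rightarrow> bool"
  where "path_homotopy_in X f \<longleftrightarrow> map_into unit_square X f"

definition path_concordance_in :: "'a::metric_space set \<Rightarrow> (real \<times> real \<Rightarrow> 'a \<times> real) \<Rightarrow> bool"
  where "path_concordance_in X F \<longleftrightarrow>
    map_into unit_square (X \<times> unit_interval) F \<and>
    (\<forall>e\<in>{0, 1}. F ` (unit_interval \<times> {e}) \<subseteq> X \<times> {e})"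

definition disjoint_path_concordances_property :: "'a::metric_space set \<Rightarrow> bool"
  where "disjoint_path_concordances_property X \<longleftrightarrow>
    (\<forall>f1 f2. path_homotopy_in X f1 \<and> path_homotopy_in X f2 \<longrightarrow>
      (\<forall>\<epsilon>>0. \<exists>F1 F2. path_concordance_in X F1 \<and> path_concordance_in X F2 \<and>
         F1 ` unit_square \<inter> F2 ` unit_square = {} \<and>
         unif_dist unit_square f1 (fst \<circ> F1) < \<epsilon> \<and>
         unif_dist unit_square f2 (fst \<circ> F2) < \<epsilon>))"

end

theory Submission
  imports Defs
begin

text \<open>
  An absolute neighbourhood retract carries a local blending: nearby points \<open>x\<close> and \<open>y\<close> are joined
  by a short path that depends continuously on \<open>x\<close> and \<open>y\<close>. It
  comes from the Kuratowski-Wojdyslawski embedding into a convex set, where one follows the straight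
  segment and retracts it to \<open>X\<close>. Blending extends small perturbations from a segment to the whole
  domain, so that the Disjoint Arcs Property makes two maps disjoint on finitely many segments each
  (\<open>disjoint_on_segments\<close>). It also corrects a map near a prescribed set while leaving
  it alone elsewhere.

  Suppose \<open>X \<times> \<real>\<close> has disjoint disks and let two path homotopies be given. First make their
  initial arcs disjoint, likewise their final arcs, and let the homotopies rest for a short time at both
  ends. The disjoint disks close to the two graphs \<open>(f (x, t), t)\<close> miss the levels \<open>0\<close> and \<open>1\<close>
  slightly. It suffices to move heights near the two ends of the time interval, where the
  coordinates in \<open>X\<close> already keep the disks apart.

  Conversely, suppose that \<open>X\<close> has disjoint path concordances, and let two maps
  \<open>(a i, b i)\<close> of the square to \<open>X \<times> \<real>\<close> be given. Cut the square into small cells. Each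
  cell of each map gets a height of its own near the values of \<open>b i\<close> there; its inner part is mapped by
  \<open>a i\<close> at that height, and its outer part to the vertical cylinder over the \<open>a i\<close>-image of
  its boundary. By general position the grid images are disjoint, hence so are the cylinders. Two inner parts are
  disjoint because their heights differ. What remains is one inner part against the cylinder over the grid of
  the other map, inside a thin slab of heights. This is a path homotopy against a constant one, and
  disjoint path concordances separate them (\<open>separate_square_from_path\<close>).

  The concordances supplied for the various edges of the grid need not fit together at the vertices, so the
  cylinder has to be left alone there, which requires that the vertices avoid the inner part to begin
  with. A fixed position of a vertex cannot be expected to avoid all inner parts of the other map.
  But each cell has a small image, so of two points whose distance exceeds its diameter it misses at least
  one. Each vertex is therefore given a whisker, an arc in \<open>X\<close> that is long compared with
  the cells and short compared with \<open>\<epsilon>\<close>, and between two slabs the vertex slides along its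
  whisker to an end that the next inner part avoids. This motion takes place in a \<open>1\<close>-dimensional set, so
  that by general position it does not meet the cylinder of the other map.
\<close>

section \<open>Uniform distance and compact sets\<close>

lemma unif_dist_lessI:
  assumes "A \<noteq> {}" "\<And>x. x \<in> A \<Longrightarrow> dist (f x) (g x) \<le> d" "d < \<epsilon>"
  shows "unif_dist A f g < \<epsilon>"
  unfolding unif_dist_def using cSUP_least[OF assms(1,2)] assms(3) by (rule le_less_trans)

lemma unif_dist_lessD:
  assumes "unif_dist A f g < \<epsilon>" "compact A" "continuous_on A f" "continuous_on A g" "x \<in> A"
  shows "dist (f x) (g x) < \<epsilon>"
proof -
  have "compact ((\<lambda>x. dist (f x) (g x)) ` A)"
    by (intro compact_continuous_image continuous_intros assms)
  then have "bdd_above ((\<lambda>x. dist (f x) (g x)) ` A)"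
    by (intro bounded_imp_bdd_above compact_imp_bounded)
  then have "dist (f x) (g x) \<le> unif_dist A f g"
    unfolding unif_dist_def using assms(5) by (rule cSUP_upper2) simp
  with assms(1) show ?thesis by simp
qed

lemma compact_disjoint_gap:
  fixes S T :: "'a::metric_space set"
  assumes "compact S" "compact T" "S \<inter> T = {}"
  obtains d where "d > 0" "\<And>x y. x \<in> S \<Longrightarrow> y \<in> T \<Longrightarrow> d \<le> dist x y"
proof (cases "S = {} \<or> T = {}")
  case True
  then show ?thesis by (intro that[of 1]) auto
next
  case False
  have "continuous_on (S \<times> T) (\<lambda>p. dist (fst p) (snd p))"
    by (intro continuous_intros)
  from continuous_attains_inf[OF compact_Times[OF assms(1,2)] _ this] False
  obtain p where p: "p \<in> S \<times> T" "\<And>q. q \<in> S \<times> T \<Longrightarrow> dist (fst p) (snd p) \<le> dist (fst q) (snd q)"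
    by blast
  then have "fst p \<noteq> snd p" using assms(3) by auto
  then show ?thesis using p by (intro that[of "dist (fst p) (snd p)"]) force+
qed

lemma map_intoD:
  assumes "map_into A X f"
  shows "continuous_on A f" "x \<in> A \<Longrightarrow> f x \<in> X" "f ` A \<subseteq> X"
  using assms unfolding map_into_def by auto

lemma map_into_compact_image:
  "map_into A X f \<Longrightarrow> compact A \<Longrightarrow> compact (f ` A)"
  by (intro compact_continuous_image map_intoD(1))

lemma dist_fst_less: "dist p q < e \<Longrightarrow> dist (fst p) (fst q) < e"
  using dist_fst_le[of p q] by simp

lemma dist_snd_less: "dist p q < e \<Longrightarrow> dist (snd p) (snd q) < e"
  using dist_snd_le[of p q] by simp

lemma dist_Pair_le: "dist (a, b) (c, d) \<le> dist a c + dist b d"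
  unfolding dist_prod_def by (simp add: sqrt_sum_squares_le_sum)

lemma infdist_geI: "A \<noteq> {} \<Longrightarrow> (\<And>y. y \<in> A \<Longrightarrow> m \<le> dist x y) \<Longrightarrow> m \<le> infdist x A"
  by (simp add: infdist_notempty cINF_greatest)

section \<open>Local blending in absolute neighbourhood retracts\<close>

text \<open>
  The Kuratowski embedding; subtracting the distance to the base point \<open>c\<close> makes the functions
  bounded also when the space is not.
\<close>

definition kuratowski :: "'a::metric_space \<Rightarrow> 'a \<Rightarrow> 'a \<Rightarrow>\<^sub>C real"
  where "kuratowski c x = Bcontfun (\<lambda>y. dist x y - dist c y)"

lemma apply_kuratowski: "apply_bcontfun (kuratowski c x) y = dist x y - dist c y"
proof -
  have "\<bar>dist x y - dist c y\<bar> \<le> dist x c" for y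
    by (metis abs_dist_diff_le dist_commute)
  then have "bounded (range (\<lambda>y. dist x y - dist c y))"
    unfolding bounded_iff by auto
  then have "(\<lambda>y. dist x y - dist c y) \<in> bcontfun"
    unfolding bcontfun_def by (auto intro!: continuous_intros)
  then show ?thesis
    unfolding kuratowski_def by (simp add: Bcontfun_inverse)
qed

lemma dist_kuratowski: "dist (kuratowski c x) (kuratowski c y) = dist x y"
proof (rule antisym)
  show "dist (kuratowski c x) (kuratowski c y) \<le> dist x y"
  proof (rule dist_bound)
    fix z
    have "\<bar>dist x z - dist y z\<bar> \<le> dist x y" by (metis abs_dist_diff_le dist_commute)
    then show "dist (kuratowski c x z) (kuratowski c y z) \<le> dist x y"
      by (simp add: apply_kuratowski dist_real_def)
  qed
  have "dist (kuratowski c x x) (kuratowski c y x) \<le> dist (kuratowski c x) (kuratowski c y)"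
    by (rule dist_bounded)
  then show "dist x y \<le> dist (kuratowski c x) (kuratowski c y)"
    by (simp add: apply_kuratowski dist_real_def dist_commute)
qed

lemma continuous_on_kuratowski: "continuous_on S (kuratowski c)"
  unfolding continuous_on_iff by (auto simp: dist_kuratowski)

text \<open>
  Wojdyslawski's observation: if points \<open>x\<^sub>n\<close> of \<open>X\<close> have images converging to a convex combination
  \<open>\<Sum>i. u i * kuratowski c (a i)\<close>, then evaluating at \<open>x\<^sub>n\<close> itself shows \<open>\<Sum>i. u i * dist (a i) x\<^sub>n \<rightarrow> 0\<close>, so
  \<open>x\<^sub>n\<close> converges to some \<open>a i\<close> in \<open>X\<close>.
\<close>

lemma closedin_kuratowski_hull:
  "closedin (top_of_set (convex hull (kuratowski c ` X))) (kuratowski c ` X)"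
proof -
  let ?k = "kuratowski c"
  have "w \<in> ?k ` X" if w: "w \<in> convex hull (?k ` X)" "w \<in> closure (?k ` X)" for w
  proof -
    obtain F u where F: "finite F" "F \<subseteq> ?k ` X" "\<forall>x\<in>F. 0 \<le> u x" "sum u F = 1"
      "(\<Sum>v\<in>F. u v *\<^sub>R v) = w"
      using w(1) unfolding convex_hull_explicit by auto
    obtain v where v: "v \<in> F" "u v > 0"
      using F(3,4) by (metis less_eq_real_def sum.neutral zero_neq_one)
    obtain a where a: "a \<in> X" "v = ?k a" using v F(2) by auto
    have key: "u v * dist a x \<le> dist (?k x) w" if "x \<in> X" for x
    proof -
      have pt: "apply_bcontfun w x + dist c x = (\<Sum>z\<in>F. u z * (apply_bcontfun z x + dist c x))"
      proof -
        have app: "apply_bcontfun (\<Sum>v\<in>G. u v *\<^sub>R v) x = (\<Sum>z\<in>G. u z * apply_bcontfun z x)"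
          if "finite G" for G
          using that by induction (auto simp: plus_bcontfun.rep_eq scaleR_bcontfun.rep_eq zero_bcontfun.rep_eq)
        have "apply_bcontfun w x = (\<Sum>z\<in>F. u z * apply_bcontfun z x)"
          using app[OF F(1)] F(5) by simp
        then show ?thesis
          by (simp add: distrib_left sum.distrib sum_distrib_right[symmetric] F(4))
      qed
      have nn: "0 \<le> apply_bcontfun z x + dist c x" if "z \<in> F" for z
        using that F(2) by (auto simp: apply_kuratowski)
      have "u v * dist a x = u v * (apply_bcontfun v x + dist c x)"
        by (simp add: a apply_kuratowski)
      also have "\<dots> \<le> (\<Sum>z\<in>F. u z * (apply_bcontfun z x + dist c x))"
        using v F(1,3) nn by (intro member_le_sum) auto
      also have "\<dots> = dist (apply_bcontfun (?k x) x) (apply_bcontfun w x)"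
        using pt sum_nonneg[of F "\<lambda>z. u z * (apply_bcontfun z x + dist c x)"] F(3) nn
        by (auto simp: apply_kuratowski dist_real_def)
      also have "\<dots> \<le> dist (?k x) w" by (rule dist_bounded)
      finally show ?thesis .
    qed
    have "dist (?k a) w \<le> 0 + e" if "e > 0" for e
    proof -
      define r where "r = min (e / 2) (u v * (e / 2))"
      have "r > 0" using that v by (simp add: r_def)
      then obtain x where x: "x \<in> X" "dist (?k x) w < r"
        using w(2) unfolding closure_approachable by auto
      have "u v * dist a x < u v * (e / 2)"
        using key[OF x(1)] x(2) by (simp add: r_def)
      then have "dist a x < e / 2" using v by simp
      then have "dist (?k a) (?k x) < e / 2" by (simp add: dist_kuratowski)
      then show ?thesis using x(2) dist_triangle[of "?k a" w "?k x"] by (simp add: r_def)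
    qed
    then have "dist (?k a) w \<le> 0" by (rule field_le_epsilon)
    then show ?thesis using a by auto
  qed
  then have "?k ` X = convex hull (?k ` X) \<inter> closure (?k ` X)"
    using closure_subset hull_subset by fast
  then show ?thesis by (metis closed_closure closedin_closed_Int)
qed

text \<open>
  The test space is the convex hull of the image of \<open>X\<close>, its points read as plain functions and its
  metric transported along this reading. The image of \<open>X\<close> is closed there, so it is a retract of a
  neighbourhood; \<open>R\<close> is this retraction followed by the inverse of the embedding.
\<close>

lemma metric_ANR_retraction:
  fixes X :: "'a::metric_space set"
  assumes "metric_ANR X"
  obtains U R where
    "openin (top_of_set (convex hull (kuratowski c ` X))) U"
    "continuous_on U R" "R ` U \<subseteq> X" "\<And>x. x \<in> X \<Longrightarrow> kuratowski c x \<in> U \<and> R (kuratowski c x) = x"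
proof -
  define C where "C = convex hull (kuratowski c ` X)"
  define d :: "('a \<Rightarrow> real) \<Rightarrow> ('a \<Rightarrow> real) \<Rightarrow> real" where "d f g = dist (Bcontfun f) (Bcontfun g)" for f g
  let ?i = "apply_bcontfun :: ('a \<Rightarrow>\<^sub>C real) \<Rightarrow> 'a \<Rightarrow> real"
  define M where "M = ?i ` C"
  interpret M: Metric_space M d
  proof
    show "0 \<le> d f g" "d f g = d g f" for f g by (simp_all add: d_def dist_commute)
    show "(d f g = 0) = (f = g)" if "f \<in> M" "g \<in> M" for f g
      using that by (auto simp: d_def M_def apply_bcontfun_inverse)
    show "d f h \<le> d f g + d g h" for f g h by (simp add: d_def dist_triangle)
  qed
  define Z where "Z = metric (M, d)"
  have Z: "mtopology_of Z = M.mtopology" by (simp add: Z_def)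
  have MI: "?i w \<in> M" if "w \<in> C" for w using that by (simp add: M_def)
  have ME: "\<exists>w\<in>C. f = ?i w" if "f \<in> M" for f using that by (auto simp: M_def)
  have Bi: "Bcontfun (?i w) = w" for w :: "'a \<Rightarrow>\<^sub>C real" by (rule apply_bcontfun_inverse)
  have hom: "homeomorphic_maps (top_of_set C) M.mtopology ?i Bcontfun"
    unfolding homeomorphic_maps_def
  proof (intro conjI ballI)
    show "continuous_map (top_of_set C) M.mtopology ?i"
      unfolding continuous_map_def
    proof (intro conjI allI impI)
      show "?i \<in> topspace (top_of_set C) \<rightarrow> topspace M.mtopology" using MI by auto
      fix U assume U: "openin M.mtopology U"
      show "openin (top_of_set C) {x \<in> topspace (top_of_set C). ?i x \<in> U}"
        unfolding openin_euclidean_subtopology_iff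
      proof (intro conjI ballI)
        fix x assume "x \<in> {x \<in> topspace (top_of_set C). ?i x \<in> U}"
        then obtain r where r: "r > 0" "M.mball (?i x) r \<subseteq> U" "x \<in> C"
          using U unfolding M.openin_mtopology by auto
        have "?i x' \<in> U" if "x' \<in> C" "dist x' x < r" for x'
          using r that MI by (auto simp: subset_iff d_def Bi dist_commute)
        then show "\<exists>e>0. \<forall>x'\<in>C. dist x' x < e \<longrightarrow> x' \<in> {x \<in> topspace (top_of_set C). ?i x \<in> U}"
          using r(1) by (intro exI[of _ r]) simp
      qed auto
    qed
    show "continuous_map M.mtopology (top_of_set C) Bcontfun"
      unfolding continuous_map_def
    proof (intro conjI allI impI)
      show "Bcontfun \<in> topspace M.mtopology \<rightarrow> topspace (top_of_set C)"
        using ME Bi by force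
      fix U assume U: "openin (top_of_set C) U"
      show "openin M.mtopology {x \<in> topspace M.mtopology. Bcontfun x \<in> U}"
        unfolding M.openin_mtopology
      proof (intro conjI allI impI)
        fix x assume x: "x \<in> {x \<in> topspace M.mtopology. Bcontfun x \<in> U}"
        then obtain y where y: "y \<in> C" "x = ?i y" "y \<in> U" using ME Bi by force
        then obtain r where r: "r > 0" "\<forall>x'\<in>C. dist x' y < r \<longrightarrow> x' \<in> U"
          using U unfolding openin_euclidean_subtopology_iff by blast
        have "Bcontfun f \<in> U" if "f \<in> M" "d x f < r" for f
          using ME[OF that(1)] that(2) r y by (auto simp: d_def Bi dist_commute)
        then show "\<exists>r>0. M.mball x r \<subseteq> {x \<in> topspace M.mtopology. Bcontfun x \<in> U}"
          using r(1) by (intro exI[of _ r]) auto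
      qed auto
    qed
    show "Bcontfun (?i x) = x" for x by (rule Bi)
    show "?i (Bcontfun y) = y" if "y \<in> topspace M.mtopology" for y
      using ME[of y] that Bi by auto
  qed
  let ?h = "?i \<circ> kuratowski c"
  have inC: "kuratowski c x \<in> C" if "x \<in> X" for x
    unfolding C_def using that by (intro hull_inc) auto
  have kemb: "embedding_map (top_of_set X) (top_of_set C) (kuratowski c)"
    unfolding embedding_map_def homeomorphic_map_maps homeomorphic_maps_def
  proof (intro exI conjI)
    have inj: "inj (kuratowski c)"
      by (rule injI) (metis dist_eq_0_iff dist_kuratowski)
    have sub: "subtopology (top_of_set C) (kuratowski c ` topspace (top_of_set X)) = top_of_set (kuratowski c ` X)"
      using inC by (simp add: subtopology_subtopology Int_absorb1 image_subset_iff)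
    show "continuous_map (top_of_set X) (subtopology (top_of_set C) (kuratowski c ` topspace (top_of_set X))) (kuratowski c)"
      unfolding sub by (auto simp: continuous_on_kuratowski)
    show "continuous_map (subtopology (top_of_set C) (kuratowski c ` topspace (top_of_set X))) (top_of_set X) (inv (kuratowski c))"
      unfolding sub
      by (auto simp: inj continuous_on_iff dist_kuratowski)
    show "\<forall>x\<in>topspace (top_of_set X). inv (kuratowski c) (kuratowski c x) = x"
      using inj by simp
    show "\<forall>y\<in>topspace (subtopology (top_of_set C) (kuratowski c ` topspace (top_of_set X))). kuratowski c (inv (kuratowski c) y) = y"
      unfolding sub using inj by auto
  qed
  have hmap: "homeomorphic_map (top_of_set C) M.mtopology ?i"
    using hom homeomorphic_map_maps by blast
  have emb: "embedding_map (top_of_set X) (mtopology_of Z) ?h"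
    unfolding Z using kemb surjective_embedding_map[THEN iffD2, OF hmap, THEN conjunct1]
    by (rule embedding_map_compose)
  have "closedin M.mtopology (?i ` (kuratowski c ` X))"
    using homeomorphic_map_closedness_eq[OF hmap] closedin_kuratowski_hull[of c X] by (metis C_def)
  then have "closedin (mtopology_of Z) (?h ` X)"
    by (simp add: Z image_comp)
  with emb assms obtain U where U: "openin M.mtopology U" "?h ` X retract_of_space subtopology M.mtopology U"
    unfolding metric_ANR_def Z[symmetric] by blast
  have sub: "?h ` X \<subseteq> topspace (subtopology M.mtopology U)"
    using U(2) by (rule retract_of_space_imp_subset)
  obtain r where r': "continuous_map (subtopology M.mtopology U) (subtopology (subtopology M.mtopology U) (?h ` X)) r"
    and r2: "\<And>y. y \<in> ?h ` X \<Longrightarrow> r y = y"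
    using U(2) unfolding retract_of_space_def by blast
  have r: "continuous_map (subtopology M.mtopology U) (subtopology M.mtopology (?h ` X)) r"
    using r' unfolding continuous_map_in_subtopology by blast
  define V where "V = {w \<in> C. ?i w \<in> U}"
  define R where "R = inv (kuratowski c) \<circ> Bcontfun \<circ> r \<circ> ?i"
  have inj: "inj (kuratowski c)"
    by (rule injI) (metis dist_eq_0_iff dist_kuratowski)
  have "continuous_map (top_of_set V) (subtopology M.mtopology U) ?i"
  proof -
    have "continuous_map (top_of_set C) M.mtopology ?i"
      using hom homeomorphic_maps_def by blast
    then have "continuous_map (subtopology (top_of_set C) V) M.mtopology ?i"
      by (rule continuous_map_from_subtopology)
    moreover have "subtopology (top_of_set C) V = top_of_set V"
      by (simp add: subtopology_subtopology Int_absorb1 V_def)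
    ultimately show ?thesis
      unfolding continuous_map_in_subtopology by (auto simp: V_def)
  qed
  moreover have "continuous_map (subtopology M.mtopology (?h ` X)) (top_of_set (kuratowski c ` X)) Bcontfun"
  proof -
    have "continuous_map M.mtopology (top_of_set C) Bcontfun"
      using hom homeomorphic_maps_def by blast
    then have "continuous_map (subtopology M.mtopology (?h ` X)) euclidean Bcontfun"
      using continuous_map_from_subtopology continuous_map_in_subtopology by blast
    then show ?thesis
      unfolding continuous_map_in_subtopology by (auto simp: Bi)
  qed
  moreover have "continuous_map (top_of_set (kuratowski c ` X)) (top_of_set X) (inv (kuratowski c))"
    by (auto simp: inj continuous_on_iff dist_kuratowski)
  ultimately have "continuous_map (top_of_set V) (top_of_set X) R"
    unfolding R_def by (intro continuous_map_compose[OF _ continuous_map_compose[OF r continuous_map_compose], unfolded o_assoc])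
  then have "continuous_on V R" "R ` V \<subseteq> X"
    by auto
  moreover have "openin (top_of_set C) V"
    using hom U(1) unfolding homeomorphic_maps_def continuous_map_def V_def by auto
  moreover have "kuratowski c x \<in> V \<and> R (kuratowski c x) = x" if "x \<in> X" for x
    using that r2 sub inC inj by (auto simp: V_def R_def apply_bcontfun_inverse)
  ultimately show ?thesis
    using that unfolding C_def by blast
qed

text \<open>
  The paths \<open>lam x y\<close> replace straight segments in \<open>X\<close>. They start in the set \<open>P\<close>, which will be
  compact, so that one \<open>\<delta>\<close> serves all of its points.
\<close>

definition blends_within ::
  "'a::metric_space set \<Rightarrow> ('a \<Rightarrow> 'a \<Rightarrow> real \<Rightarrow> 'a) \<Rightarrow> 'a set \<Rightarrow> real \<Rightarrow> real \<Rightarrow> bool"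
  where "blends_within X lam P \<epsilon> \<delta> \<longleftrightarrow>
    (\<forall>x\<in>P. \<forall>y\<in>X. dist x y < \<delta> \<longrightarrow> lam x y 0 = x \<and> lam x y 1 = y \<and>
       (\<forall>t\<in>unit_interval. lam x y t \<in> X \<and> dist (lam x y t) x < \<epsilon>)) \<and>
    continuous_on {(x, y, t). x \<in> P \<and> y \<in> X \<and> dist x y < \<delta> \<and> t \<in> unit_interval}
      (\<lambda>(x, y, t). lam x y t)"

definition locally_blending :: "'a::metric_space set \<Rightarrow> ('a \<Rightarrow> 'a \<Rightarrow> real \<Rightarrow> 'a) \<Rightarrow> bool"
  where "locally_blending X lam \<longleftrightarrow>
    (\<forall>P \<epsilon>. compact P \<and> P \<subseteq> X \<and> \<epsilon> > 0 \<longrightarrow> (\<exists>\<delta>>0. \<delta> \<le> \<epsilon> \<and> blends_within X lam P \<epsilon> \<delta>))"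

lemma blends_withinD:
  assumes "blends_within X lam P \<epsilon> \<delta>" "x \<in> P" "y \<in> X" "dist x y < \<delta>"
  shows "lam x y 0 = x" "lam x y 1 = y"
    "0 \<le> t \<Longrightarrow> t \<le> 1 \<Longrightarrow> lam x y t \<in> X" "0 \<le> t \<Longrightarrow> t \<le> 1 \<Longrightarrow> dist (lam x y t) x < \<epsilon>"
  using assms unfolding blends_within_def by auto

lemma blends_within_continuous:
  assumes "blends_within X lam P \<epsilon> \<delta>" "continuous_on S p" "continuous_on S q" "continuous_on S w"
    "\<And>z. z \<in> S \<Longrightarrow> p z \<in> P \<and> q z \<in> X \<and> dist (p z) (q z) < \<delta> \<and> 0 \<le> w z \<and> w z \<le> 1"
  shows "continuous_on S (\<lambda>z. lam (p z) (q z) (w z))"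
proof -
  have 1: "continuous_on {(x, y, t). x \<in> P \<and> y \<in> X \<and> dist x y < \<delta> \<and> t \<in> unit_interval}
      (\<lambda>(x, y, t). lam x y t)"
    using assms(1) unfolding blends_within_def by blast
  have "continuous_on S (\<lambda>z. (\<lambda>(x, y, t). lam x y t) (p z, q z, w z))"
    by (rule continuous_on_compose2[OF 1]) (auto intro!: continuous_intros assms(2-4) simp: assms(5))
  then show ?thesis by simp
qed

text \<open>
  The blending is the image under the retraction of the segment between the embedded points. Near the compact
  set \<open>P\<close> it is defined and short by continuity of the retraction, with a uniform
  \<open>\<delta>\<close> provided by a Lebesgue number.
\<close>

lemma metric_ANR_locally_blending:
  fixes X :: "'a::metric_space set"
  assumes "metric_ANR X"
  obtains lam where "locally_blending X lam"
proof -
  fix c :: 'a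
  let ?k = "kuratowski c"
  let ?C = "convex hull (?k ` X)"
  obtain U R where U: "openin (top_of_set ?C) U" and R: "continuous_on U R" "R ` U \<subseteq> X"
    "\<And>x. x \<in> X \<Longrightarrow> ?k x \<in> U \<and> R (?k x) = x"
    using metric_ANR_retraction[OF assms] by metis
  define seg where "seg x y t = (1 - t) *\<^sub>R ?k x + t *\<^sub>R ?k y" for x y t
  define lam where "lam x y t = R (seg x y t)" for x y t
  have "\<exists>\<delta>>0. \<delta> \<le> \<epsilon> \<and> blends_within X lam P \<epsilon> \<delta>" if P: "compact P" "P \<subseteq> X" "\<epsilon> > 0" for P \<epsilon>
  proof -
    have "\<exists>r>0. \<forall>w\<in>?C. dist (?k x) w < r \<longrightarrow> w \<in> U \<and> dist (R w) x < \<epsilon> / 2" if "x \<in> P" for x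
    proof -
      have x: "?k x \<in> U" "R (?k x) = x" using R(3) that P(2) by auto
      obtain r1 where r1: "r1 > 0" "\<forall>w\<in>?C. dist w (?k x) < r1 \<longrightarrow> w \<in> U"
        using U x unfolding openin_euclidean_subtopology_iff by blast
      obtain r2 where r2: "r2 > 0" "\<forall>w\<in>U. dist w (?k x) < r2 \<longrightarrow> dist (R w) (R (?k x)) < \<epsilon> / 2"
        using R(1) x P(3) unfolding continuous_on_iff by (metis half_gt_zero)
      show ?thesis
        using r1 r2 x by (intro exI[of _ "min r1 r2"]) (auto simp: dist_commute)
    qed
    then obtain r where r: "\<And>x. x \<in> P \<Longrightarrow> r x > 0"
      "\<And>x w. x \<in> P \<Longrightarrow> w \<in> ?C \<Longrightarrow> dist (?k x) w < r x \<Longrightarrow> w \<in> U \<and> dist (R w) x < \<epsilon> / 2"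
      by metis
    have "compact (?k ` P)"
      using P(1) continuous_on_kuratowski by (rule compact_continuous_image[rotated])
    have cov: "?k ` P \<subseteq> \<Union>((\<lambda>x. ball (?k x) (r x)) ` P)"
      using r(1) by fastforce
    have op: "open G" if "G \<in> (\<lambda>x. ball (?k x) (r x)) ` P" for G using that by auto
    obtain e where e: "e > 0" "\<And>w. w \<in> ?k ` P \<Longrightarrow> \<exists>G \<in> (\<lambda>x. ball (?k x) (r x)) ` P. ball w e \<subseteq> G"
      using Heine_Borel_lemma[OF \<open>compact (?k ` P)\<close> cov op] by blast
    have inC: "?k x \<in> ?C" if "x \<in> X" for x
      using that by (intro hull_inc) auto
    have main: "seg x y t \<in> U \<and> dist (R (seg x y t)) x < \<epsilon>"
      if xyt: "x \<in> P" "y \<in> X" "dist x y < e" "0 \<le> t" "t \<le> 1" for x y t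
    proof -
      obtain x' where x': "x' \<in> P" "ball (?k x) e \<subseteq> ball (?k x') (r x')"
        using e(2)[OF imageI[OF xyt(1), of ?k]] by blast
      have "?k x \<in> ?C" "?k y \<in> ?C" using inC that P(2) by blast+
      then have inseg: "seg x y t \<in> ?C"
        unfolding seg_def using that(4,5) convexD[OF convex_convex_hull, of "?k x" "?k ` X" "?k y" "1 - t" t] by simp
      have "?k x - seg x y t = t *\<^sub>R (?k x - ?k y)"
        by (simp add: seg_def algebra_simps)
      then have "dist (?k x) (seg x y t) = t * dist x y"
        using that(4) dist_kuratowski[of c x y] by (simp add: dist_norm)
      also have "\<dots> \<le> 1 * dist x y" using that by (intro mult_right_mono) auto
      finally have "dist (?k x) (seg x y t) < e" using that by simp
      then have "dist (?k x') (seg x y t) < r x'" using x' by (auto simp: subset_iff)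
      then have 1: "seg x y t \<in> U" "dist (R (seg x y t)) x' < \<epsilon> / 2"
        using r(2)[OF x'(1) inseg] by auto
      have "dist (?k x') (?k x) < r x'" using x' e(1) by (auto simp: subset_iff)
      then have "dist (R (?k x)) x' < \<epsilon> / 2"
        using r(2)[OF x'(1) inC] that P(2) by blast
      then have "dist x x' < \<epsilon> / 2" using R(3) that P(2) by auto
      with 1 show ?thesis using dist_triangle2[of "R (seg x y t)" x x'] by auto
    qed
    have "blends_within X lam P \<epsilon> (min e \<epsilon>)"
      unfolding blends_within_def
    proof (intro conjI ballI impI)
      fix x y assume *: "x \<in> P" "y \<in> X" "dist x y < min e \<epsilon>"
      show "lam x y 0 = x" "lam x y 1 = y"
        using R(3) * P(2) by (auto simp: lam_def seg_def)
      fix t :: real assume "t \<in> unit_interval"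
      then show "lam x y t \<in> X" "dist (lam x y t) x < \<epsilon>"
        using main[of x y t] * R(2) by (auto simp: lam_def)
    next
      let ?S = "{(x, y, t). x \<in> P \<and> y \<in> X \<and> dist x y < min e \<epsilon> \<and> t \<in> unit_interval}"
      have k: "continuous_on S (\<lambda>z. ?k (f z))" if "continuous_on S f" for S and f :: "'a \<times> 'a \<times> real \<Rightarrow> 'a"
        using continuous_on_compose2[OF continuous_on_kuratowski that] by blast
      have "continuous_on ?S (\<lambda>z. seg (fst z) (fst (snd z)) (snd (snd z)))"
        unfolding seg_def by (intro continuous_intros k)
      then have "continuous_on ?S (\<lambda>z. R (seg (fst z) (fst (snd z)) (snd (snd z))))"
        by (rule continuous_on_compose2[OF R(1)]) (use main in auto)
      then show "continuous_on ?S (\<lambda>(x, y, t). lam x y t)"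
        by (simp add: lam_def case_prod_unfold)
    qed
    then show ?thesis using e(1) P(3) by (intro exI[of _ "min e \<epsilon>"]) auto
  qed
  then have "locally_blending X lam" unfolding locally_blending_def by blast
  then show ?thesis by (rule that)
qed

lemma locally_blendingE:
  assumes "locally_blending X lam" "compact P" "P \<subseteq> X" "\<epsilon> > 0"
  obtains \<delta> where "\<delta> > 0" "\<delta> \<le> \<epsilon>" "blends_within X lam P \<epsilon> \<delta>"
  using assms unfolding locally_blending_def by blast

section \<open>General position along segments\<close>

text \<open>
  A homotopy extension property with control on distances. The proof pushes \<open>a\<close> towards \<open>g\<close>
  along the local blending, with a weight that decays from \<open>1\<close> on the segment to \<open>0\<close> at a small distance; \<open>\<rho>\<close> is the parameter of the nearest point.
\<close>

lemma extend_from_segment: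
  fixes a :: "'e::real_inner \<Rightarrow> 'a::metric_space"
  assumes lb: "locally_blending X lam" and K: "compact K" "closed_segment p q \<subseteq> K" "p \<noteq> q"
    and a: "map_into K X a" and "\<epsilon> > 0"
  obtains \<delta> where "\<delta> > 0"
    "\<And>g. map_into unit_interval X g \<Longrightarrow> (\<And>t. t \<in> unit_interval \<Longrightarrow> dist (a (linepath p q t)) (g t) < \<delta>) \<Longrightarrow>
       \<exists>a'. map_into K X a' \<and> (\<forall>x\<in>K. dist (a x) (a' x) < \<epsilon>) \<and> (\<forall>t\<in>unit_interval. a' (linepath p q t) = g t)"
proof -
  let ?P = "a ` K"
  have P: "compact ?P" "?P \<subseteq> X" using a K(1) by (auto intro: map_into_compact_image map_intoD)
  obtain d where d: "d > 0" "d \<le> \<epsilon>" "blends_within X lam ?P \<epsilon> d"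
    using locally_blendingE[OF lb P \<open>\<epsilon> > 0\<close>] .
  have "uniformly_continuous_on K a"
    using compact_uniformly_continuous map_intoD(1)[OF a] K(1) by blast
  then obtain r where r: "r > 0" "\<And>x y. x \<in> K \<Longrightarrow> y \<in> K \<Longrightarrow> dist x y < r \<Longrightarrow> dist (a x) (a y) < d / 2"
    unfolding uniformly_continuous_on_def using d(1) by (metis half_gt_zero dist_commute)
  define \<rho> where "\<rho> x = max 0 (min 1 (((x - p) \<bullet> (q - p)) / ((q - p) \<bullet> (q - p))))" for x
  define D where "D x = dist x (linepath p q (\<rho> x))" for x
  have \<rho>01: "\<rho> x \<in> unit_interval" for x by (auto simp: \<rho>_def)
  have \<rho>l: "\<rho> (linepath p q t) = t" if "t \<in> unit_interval" for t
  proof -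
    have "linepath p q t - p = t *\<^sub>R (q - p)" by (simp add: linepath_def algebra_simps)
    then show ?thesis using that K(3) by (auto simp: \<rho>_def)
  qed
  have \<rho>c: "continuous_on S \<rho>" for S unfolding \<rho>_def by (intro continuous_intros) (use K(3) in auto)
  have Dc: "continuous_on S D" for S
    unfolding D_def linepath_def by (intro continuous_intros \<rho>c)
  have lK: "linepath p q t \<in> K" if "t \<in> unit_interval" for t
    using that K(2) linepath_in_path[of t p q] by auto
  show thesis
  proof (rule that[of "d / 2"])
    fix g assume g: "map_into unit_interval X g"
      "\<And>t. t \<in> unit_interval \<Longrightarrow> dist (a (linepath p q t)) (g t) < d / 2"
    define \<theta> where "\<theta> x = max 0 (1 - 2 * D x / r)" for x
    define a' where "a' x = (if D x \<le> r / 2 then lam (a x) (g (\<rho> x)) (\<theta> x) else a x)" for x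
    have near: "a x \<in> ?P" "g (\<rho> x) \<in> X" "dist (a x) (g (\<rho> x)) < d" "0 \<le> \<theta> x" "\<theta> x \<le> 1"
      if x: "x \<in> K" "D x \<le> r / 2" for x
    proof -
      show "a x \<in> ?P" "g (\<rho> x) \<in> X" using x \<rho>01 map_intoD(2)[OF g(1)] by auto
      have "dist (a x) (a (linepath p q (\<rho> x))) < d / 2"
        using x r lK[OF \<rho>01] by (intro r(2)) (auto simp: D_def)
      then show "dist (a x) (g (\<rho> x)) < d"
        using g(2)[OF \<rho>01, of x] dist_triangle[of "a x" "g (\<rho> x)" "a (linepath p q (\<rho> x))"] by linarith
      show "0 \<le> \<theta> x" "\<theta> x \<le> 1" using r(1) by (auto simp: \<theta>_def D_def)
    qed
    note B = blends_withinD[OF d(3)]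
    have "continuous_on K a'"
      unfolding a'_def
    proof (rule continuous_on_cases_le)
      show "continuous_on {t \<in> K. D t \<le> r / 2} (\<lambda>x. lam (a x) (g (\<rho> x)) (\<theta> x))"
      proof (rule blends_within_continuous[OF d(3)])
        show "continuous_on {t \<in> K. D t \<le> r / 2} a"
          using map_intoD(1)[OF a] continuous_on_subset by fastforce
        show "continuous_on {t \<in> K. D t \<le> r / 2} (\<lambda>x. g (\<rho> x))"
          by (rule continuous_on_compose2[OF map_intoD(1)[OF g(1)] \<rho>c]) (use \<rho>01 in auto)
        show "continuous_on {t \<in> K. D t \<le> r / 2} \<theta>"
          unfolding \<theta>_def using r(1) by (intro continuous_intros Dc) auto
      qed (use near in blast)
      show "continuous_on {t \<in> K. r / 2 \<le> D t} a"
        using map_intoD(1)[OF a] continuous_on_subset by fastforce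
      show "continuous_on K D" by (rule Dc)
      fix x assume x: "x \<in> K" "D x = r / 2"
      then have "\<theta> x = 0" using r(1) by (simp add: \<theta>_def)
      then show "lam (a x) (g (\<rho> x)) (\<theta> x) = a x" using B(1)[OF near(1-3)[of x]] x by simp
    qed
    moreover have "a' x \<in> X" "dist (a x) (a' x) < \<epsilon>" if "x \<in> K" for x
      using B(3,4)[OF near(1-3) near(4,5), of x] that P(2) \<open>\<epsilon> > 0\<close> by (auto simp: a'_def dist_commute)
    moreover have "a' (linepath p q t) = g t" if t: "t \<in> unit_interval" for t
    proof -
      have "D (linepath p q t) = 0" using \<rho>l[OF t] by (simp add: D_def)
      then show ?thesis
        using B(2)[OF near(1-3)[of "linepath p q t"]] r(1) lK[OF t] \<rho>l[OF t] by (simp add: a'_def \<theta>_def)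
    qed
    ultimately show "\<exists>a'. map_into K X a' \<and> (\<forall>x\<in>K. dist (a x) (a' x) < \<epsilon>) \<and> (\<forall>t\<in>unit_interval. a' (linepath p q t) = g t)"
      unfolding map_into_def by blast
  qed (use d(1) in simp)
qed

lemma image_closed_segment: "f ` closed_segment p q = (\<lambda>t. f (linepath p q t)) ` unit_interval"
  by (auto simp: image_image simp flip: linepath_image_01)

abbreviation segment_of :: "'e::real_vector \<times> 'e \<Rightarrow> 'e set"
  where "segment_of s \<equiv> closed_segment (fst s) (snd s)"

text \<open>
  The pairs of segments are treated one after the other: the Disjoint Arcs Property separates the two
  restrictions, and the new values are extended to all of \<open>K\<close>. The margin \<open>m\<close> keeps the induction
  going, since pairs that are already at distance \<open>m\<close> survive any perturbation by less than \<open>m / 4\<close>.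
\<close>

lemma disjoint_on_segments:
  fixes a b :: "'e::real_inner \<Rightarrow> 'a::metric_space"
  assumes dap: "disjoint_arcs_property X" and lb: "locally_blending X lam" and K: "compact K"
    and S: "finite S" "\<And>s t. (s, t) \<in> S \<Longrightarrow>
      fst s \<noteq> snd s \<and> fst t \<noteq> snd t \<and> segment_of s \<subseteq> K \<and> segment_of t \<subseteq> K"
    and ab: "map_into K X a" "map_into K X b" and e: "\<epsilon> > 0"
  obtains a' b' m where "map_into K X a'" "map_into K X b'" "m > 0"
    "\<And>x. x \<in> K \<Longrightarrow> dist (a x) (a' x) < \<epsilon>" "\<And>x. x \<in> K \<Longrightarrow> dist (b x) (b' x) < \<epsilon>"
    "\<And>s t x y. (s, t) \<in> S \<Longrightarrow> x \<in> segment_of s \<Longrightarrow> y \<in> segment_of t \<Longrightarrow> m \<le> dist (a' x) (b' y)"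
proof -
  have "\<exists>a' b' m. map_into K X a' \<and> map_into K X b' \<and> m > 0 \<and>
    (\<forall>x\<in>K. dist (a x) (a' x) < \<epsilon> \<and> dist (b x) (b' x) < \<epsilon>) \<and>
    (\<forall>s t x y. (s, t) \<in> S \<longrightarrow> x \<in> segment_of s \<longrightarrow> y \<in> segment_of t \<longrightarrow> m \<le> dist (a' x) (b' y))"
    using S e
  proof (induction S arbitrary: \<epsilon> rule: finite_induct)
    case empty
    then show ?case using ab by (intro exI[of _ a] exI[of _ b] exI[of _ "1::real"]) auto
  next
    case (insert s S)
    obtain s1 s2 where s: "s = (s1, s2)" by (metis prod.exhaust)
    define p q p' q' where pq: "p = fst s1" "q = snd s1" "p' = fst s2" "q' = snd s2"
    have seg: "closed_segment p q \<subseteq> K" "p \<noteq> q" "closed_segment p' q' \<subseteq> K" "p' \<noteq> q'"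
      using insert.prems(1)[of s1 s2] s by (auto simp: pq)
    have "\<epsilon> / 2 > 0" using insert.prems(2) by simp
    moreover have "\<And>s t. (s, t) \<in> S \<Longrightarrow> fst s \<noteq> snd s \<and> fst t \<noteq> snd t \<and> segment_of s \<subseteq> K \<and> segment_of t \<subseteq> K"
      using insert.prems(1) by (meson insertI2)
    ultimately obtain a1 b1 m where 1: "map_into K X a1" "map_into K X b1" "m > 0"
      "\<And>x. x \<in> K \<Longrightarrow> dist (a x) (a1 x) < \<epsilon> / 2" "\<And>x. x \<in> K \<Longrightarrow> dist (b x) (b1 x) < \<epsilon> / 2"
      and gap: "\<And>s t x y. (s, t) \<in> S \<Longrightarrow> x \<in> segment_of s \<Longrightarrow> y \<in> segment_of t \<Longrightarrow> m \<le> dist (a1 x) (b1 y)"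
      using insert.IH by (smt (verit, best))
    define \<eta> where "\<eta> = min (\<epsilon> / 2) (m / 4)"
    have "\<eta> > 0" using 1(3) insert.prems(2) by (simp add: \<eta>_def)
    obtain d1 where d1: "d1 > 0" "\<And>g. map_into unit_interval X g \<Longrightarrow>
       (\<And>t. t \<in> unit_interval \<Longrightarrow> dist (a1 (linepath p q t)) (g t) < d1) \<Longrightarrow>
       \<exists>a'. map_into K X a' \<and> (\<forall>x\<in>K. dist (a1 x) (a' x) < \<eta>) \<and> (\<forall>t\<in>unit_interval. a' (linepath p q t) = g t)"
      using extend_from_segment[OF lb K seg(1,2) 1(1) \<open>\<eta> > 0\<close>] by blast
    obtain d2 where d2: "d2 > 0" "\<And>g. map_into unit_interval X g \<Longrightarrow>
       (\<And>t. t \<in> unit_interval \<Longrightarrow> dist (b1 (linepath p' q' t)) (g t) < d2) \<Longrightarrow>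
       \<exists>a'. map_into K X a' \<and> (\<forall>x\<in>K. dist (b1 x) (a' x) < \<eta>) \<and> (\<forall>t\<in>unit_interval. a' (linepath p' q' t) = g t)"
      using extend_from_segment[OF lb K seg(3,4) 1(2) \<open>\<eta> > 0\<close>] by blast
    have lin: "map_into unit_interval X (\<lambda>t. c (linepath u v t))"
      if "map_into K X c" "closed_segment u v \<subseteq> K" for c :: "'e \<Rightarrow> 'a" and u v
      unfolding map_into_def
    proof
      have i: "linepath u v ` unit_interval \<subseteq> K" using that(2) by (simp add: linepath_image_01)
      then show "continuous_on unit_interval (\<lambda>t. c (linepath u v t))"
        by (intro continuous_on_compose2[OF map_intoD(1)[OF that(1)]] continuous_on_linepath)
      show "(\<lambda>t. c (linepath u v t)) \<in> unit_interval \<rightarrow> X"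
        using map_intoD(2)[OF that(1)] i by blast
    qed
    let ?f1 = "\<lambda>t. a1 (linepath p q t)" and ?f2 = "\<lambda>t. b1 (linepath p' q' t)"
    have l1: "map_into unit_interval X ?f1" and l2: "map_into unit_interval X ?f2"
      using lin 1(1,2) seg by blast+
    have "min d1 d2 > 0" using d1(1) d2(1) by simp
    then obtain g1 g2 where g: "map_into unit_interval X g1" "map_into unit_interval X g2"
      "unif_dist unit_interval ?f1 g1 < min d1 d2" "unif_dist unit_interval ?f2 g2 < min d1 d2"
      "g1 ` unit_interval \<inter> g2 ` unit_interval = {}"
      using dap l1 l2 unfolding disjoint_arcs_property_def by meson
    have "dist (?f1 t) (g1 t) < d1" "dist (?f2 t) (g2 t) < d2" if "t \<in> unit_interval" for t
      using unif_dist_lessD[OF g(3) compact_Icc map_intoD(1)[OF l1] map_intoD(1)[OF g(1)] that]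
        unif_dist_lessD[OF g(4) compact_Icc map_intoD(1)[OF l2] map_intoD(1)[OF g(2)] that] by simp_all
    then obtain a2 b2 where
      a2: "map_into K X a2" "\<And>x. x \<in> K \<Longrightarrow> dist (a1 x) (a2 x) < \<eta>" "\<And>t. t \<in> unit_interval \<Longrightarrow> a2 (linepath p q t) = g1 t" and
      b2: "map_into K X b2" "\<And>x. x \<in> K \<Longrightarrow> dist (b1 x) (b2 x) < \<eta>" "\<And>t. t \<in> unit_interval \<Longrightarrow> b2 (linepath p' q' t) = g2 t"
      using d1(2)[OF g(1)] d2(2)[OF g(2)] by metis
    have "a2 ` closed_segment p q \<inter> b2 ` closed_segment p' q' = {}"
      using g(5) a2(3) b2(3) by (simp add: image_closed_segment cong: image_cong_simp)
    moreover have "compact (a2 ` closed_segment p q)" "compact (b2 ` closed_segment p' q')"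
      using map_intoD(1)[OF a2(1)] map_intoD(1)[OF b2(1)] seg
      by (auto intro!: compact_continuous_image compact_segment intro: continuous_on_subset)
    ultimately obtain m' where m': "m' > 0"
      "\<And>x y. x \<in> a2 ` closed_segment p q \<Longrightarrow> y \<in> b2 ` closed_segment p' q' \<Longrightarrow> m' \<le> dist x y"
      using compact_disjoint_gap by metis
    have old: "m / 2 \<le> dist (a2 x) (b2 y)"
      if *: "(u, v) \<in> S" "x \<in> segment_of u" "y \<in> segment_of v" for u v x y
    proof -
      have xy: "x \<in> K" "y \<in> K" using * insert.prems(1)[of u v] by auto
      have "dist (a1 x) (b1 y) \<le> dist (a1 x) (a2 x) + dist (a2 x) (b2 y) + dist (b1 y) (b2 y)"
        using dist_triangle[of "a1 x" "b1 y" "a2 x"] dist_triangle[of "a2 x" "b1 y" "b2 y"]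
        by (simp add: dist_commute)
      then show ?thesis using gap[OF *] a2(2)[OF xy(1)] b2(2)[OF xy(2)] by (simp add: \<eta>_def)
    qed
    have "min m' (m / 2) \<le> dist (a2 x) (b2 y)"
      if *: "(u, v) \<in> insert s S" "x \<in> segment_of u" "y \<in> segment_of v" for u v x y
    proof (cases "(u, v) \<in> S")
      case True
      then show ?thesis using old[of u v x y] *(2,3) by simp
    next
      case False
      then have "u = s1" "v = s2" using *(1) s by auto
      then show ?thesis using m'(2)[of "a2 x" "b2 y"] *(2,3) by (simp add: pq)
    qed
    moreover have "dist (a x) (a2 x) < \<epsilon>" "dist (b x) (b2 x) < \<epsilon>" if "x \<in> K" for x
      using 1(4)[OF that] 1(5)[OF that] a2(2)[OF that] b2(2)[OF that]
        dist_triangle[of "a x" "a2 x" "a1 x"] dist_triangle[of "b x" "b2 x" "b1 x"]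
      by (simp_all add: \<eta>_def)
    moreover have "min m' (m / 2) > 0" using m'(1) 1(3) by simp
    ultimately show ?case
      using a2(1) b2(1) by blast
  qed
  then show thesis using that by blast
qed

section \<open>From disjoint disks to disjoint path concordances\<close>

text \<open>
  The graphs of the homotopies are disks in \<open>X \<times> \<real>\<close>. Disjoint disks near them are
  concordances up to small errors in height, and these errors are repaired without touching the coordinate in
  \<open>X\<close>. In the collars where heights change, the homotopies are stationary with disjoint arcs as values,
  so the coordinates in \<open>X\<close> alone keep the two disks apart.
\<close>

lemma disjoint_disks_imp_disjoint_path_concordances:
  fixes X :: "'a::metric_space set"
  assumes lb: "locally_blending X lam" and dap: "disjoint_arcs_property X"
    and ddp: "disjoint_disks_property (X \<times> (UNIV :: real set))"
  shows "disjoint_path_concordances_property X"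
  unfolding disjoint_path_concordances_property_def path_homotopy_in_def
proof (intro allI impI, elim conjE)
  fix f1 f2 :: "real \<times> real \<Rightarrow> 'a" and \<epsilon> :: real
  assume f: "map_into unit_square X f1" "map_into unit_square X f2" and "\<epsilon> > 0"
  have sq: "compact unit_square" by (intro compact_Times compact_Icc)
  let ?bot = "((0, 0), (1, 0)) :: (real \<times> real) \<times> real \<times> real"
  let ?top = "((0, 1), (1, 1)) :: (real \<times> real) \<times> real \<times> real"
  have seg: "closed_segment (0, e) (1, e) = unit_interval \<times> {e}" for e :: real
    by (auto simp: closed_segment_def scaleR_prod_def algebra_simps)
  have "\<epsilon> / 4 > 0" using \<open>\<epsilon> > 0\<close> by simp
  have S: "finite {(?bot, ?bot), (?top, ?top)}" by simp
  have S': "fst s \<noteq> snd s \<and> fst t \<noteq> snd t \<and> segment_of s \<subseteq> unit_square \<and> segment_of t \<subseteq> unit_square"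
    if "(s, t) \<in> {(?bot, ?bot), (?top, ?top)}" for s t
    using that seg[of 0] seg[of 1] by auto
  obtain h1 h2 m where h: "map_into unit_square X h1" "map_into unit_square X h2" and m: "m > 0"
    and near: "\<And>z. z \<in> unit_square \<Longrightarrow> dist (f1 z) (h1 z) < \<epsilon> / 4" "\<And>z. z \<in> unit_square \<Longrightarrow> dist (f2 z) (h2 z) < \<epsilon> / 4"
    and gap: "\<And>s t x y. (s, t) \<in> {(?bot, ?bot), (?top, ?top)} \<Longrightarrow> x \<in> segment_of s \<Longrightarrow> y \<in> segment_of t \<Longrightarrow>
       m \<le> dist (h1 x) (h2 y)"
    by (rule disjoint_on_segments[OF dap lb sq S S' f \<open>\<epsilon> / 4 > 0\<close>]) blast+
  have gap': "m \<le> dist (h1 (x, e)) (h2 (y, e))" if "e = 0 \<or> e = 1" "x \<in> unit_interval" "y \<in> unit_interval" for x y e :: real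
    using that gap[of "((0, e), (1, e))" "((0, e), (1, e))" "(x, e)" "(y, e)"] by (auto simp: seg)
  have unif: "\<exists>r>0. \<forall>z\<in>unit_square. \<forall>z'\<in>unit_square. dist z' z < r \<longrightarrow> dist (h z') (h z) < \<epsilon> / 4"
    if "map_into unit_square X h" for h
    using compact_uniformly_continuous[OF map_intoD(1)[OF that] sq] \<open>\<epsilon> / 4 > 0\<close>
    unfolding uniformly_continuous_on_def by blast
  obtain r1 where r1: "r1 > 0" "\<forall>z\<in>unit_square. \<forall>z'\<in>unit_square. dist z' z < r1 \<longrightarrow> dist (h1 z') (h1 z) < \<epsilon> / 4"
    using unif[OF h(1)] by blast
  obtain r2 where r2: "r2 > 0" "\<forall>z\<in>unit_square. \<forall>z'\<in>unit_square. dist z' z < r2 \<longrightarrow> dist (h2 z') (h2 z) < \<epsilon> / 4"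
    using unif[OF h(2)] by blast
  \<comment> \<open>\<open>\<kappa>\<close> moves points by at most \<open>c\<close> and is constant on the intervals of length \<open>c / 2\<close> at both ends of \<open>I\<close>.\<close>
  define c where "c = min (1 / 2) (min (r1 / 2) (r2 / 2))"
  have c: "c > 0" "c \<le> 1 / 2" "c < r1" "c < r2" using r1 r2 by (auto simp: c_def)
  define \<kappa> where "\<kappa> t = max 0 (min 1 ((1 + 2 * c) * t - c))" for t :: real
  have \<kappa>c: "continuous_on S (\<lambda>z. \<kappa> (g z))" if "continuous_on S g" for S and g :: "real \<times> real \<Rightarrow> real"
    unfolding \<kappa>_def by (intro continuous_intros that)
  have \<kappa>01: "\<kappa> t \<in> unit_interval" for t by (auto simp: \<kappa>_def)
  have \<kappa>near: "\<bar>\<kappa> t - t\<bar> \<le> c" if "t \<in> unit_interval" for t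
  proof -
    have "0 \<le> c * t" "c * t \<le> c * 1" using that c(1) by (auto intro: mult_left_mono)
    then have "\<bar>(1 + 2 * c) * t - c - t\<bar> \<le> c" by (simp add: algebra_simps abs_le_iff)
    then show ?thesis using that by (auto simp: \<kappa>_def)
  qed
  have \<kappa>0: "\<kappa> t = 0" if "t \<le> c / 2" for t
  proof -
    have "(1 + 2 * c) * t \<le> (1 + 2 * c) * (c / 2)" using that c(1) by (intro mult_left_mono) auto
    also have "\<dots> = c / 2 + c * c" by (simp add: algebra_simps)
    also have "\<dots> \<le> c / 2 + c * (1 / 2)" using c by (intro add_left_mono mult_left_mono) auto
    finally show ?thesis by (simp add: \<kappa>_def)
  qed
  have \<kappa>1: "\<kappa> t = 1" if "t \<ge> 1 - c / 2" for t
  proof -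
    have "(1 + 2 * c) * (1 - t) \<le> (1 + 2 * c) * (c / 2)" using that c(1) by (intro mult_left_mono) auto
    also have "\<dots> = c / 2 + c * c" by (simp add: algebra_simps)
    also have "\<dots> \<le> c / 2 + c * (1 / 2)" using c by (intro add_left_mono mult_left_mono) auto
    finally show ?thesis by (simp add: \<kappa>_def algebra_simps)
  qed
  define \<delta> where "\<delta> = c / 8"
  define \<eta> where "\<eta> = min \<delta> (min (m / 2) (\<epsilon> / 4))"
  have \<eta>: "\<eta> > 0" "\<eta> \<le> \<delta>" "\<eta> \<le> m / 2" "\<eta> \<le> \<epsilon> / 4" and \<delta>: "\<delta> > 0"
    using c m \<open>\<epsilon> > 0\<close> by (auto simp: \<eta>_def \<delta>_def)
  define F where "F h z = (h (fst z, \<kappa> (snd z)), snd z)" for h :: "real \<times> real \<Rightarrow> 'a" and z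
  have F: "map_into unit_square (X \<times> UNIV) (F h)" if "map_into unit_square X h" for h
    unfolding map_into_def F_def
    by (intro conjI continuous_intros continuous_on_compose2[OF map_intoD(1)[OF that]] \<kappa>c)
      (use \<kappa>01 map_intoD(2)[OF that] in auto)
  obtain G1 G2 where G: "map_into unit_square (X \<times> UNIV) G1" "map_into unit_square (X \<times> UNIV) G2"
    "unif_dist unit_square (F h1) G1 < \<eta>" "unif_dist unit_square (F h2) G2 < \<eta>"
    "G1 ` unit_square \<inter> G2 ` unit_square = {}"
    using ddp F[OF h(1)] F[OF h(2)] \<eta>(1) unfolding disjoint_disks_property_def by metis
  have Gn: "dist (F h1 z) (G1 z) < \<eta>" "dist (F h2 z) (G2 z) < \<eta>" if "z \<in> unit_square" for z
    using unif_dist_lessD[OF G(3) sq map_intoD(1)[OF F[OF h(1)]] map_intoD(1)[OF G(1)] that]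
      unif_dist_lessD[OF G(4) sq map_intoD(1)[OF F[OF h(2)]] map_intoD(1)[OF G(2)] that] by simp_all
  \<comment> \<open>Only the heights are corrected: \<open>\<theta>\<close> vanishes at the two ends and is \<open>1\<close> outside the \<open>\<delta>\<close>-collars.\<close>
  define \<theta> where "\<theta> t = max 0 (min 1 (min t (1 - t) / \<delta>))" for t :: real
  define H where "H G z = (fst (G z), \<theta> (snd z) * max 0 (min 1 (snd (G z))) + (1 - \<theta> (snd z)) * snd z)"
    for G :: "real \<times> real \<Rightarrow> 'a \<times> real" and z
  have \<theta>01: "0 \<le> \<theta> t" "\<theta> t \<le> 1" for t by (auto simp: \<theta>_def)
  have conc: "path_concordance_in X (H G)" if mG: "map_into unit_square (X \<times> UNIV) G" for G
    unfolding path_concordance_in_def map_into_def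
  proof (intro conjI ballI)
    show "continuous_on unit_square (H G)"
      unfolding H_def \<theta>_def by (intro continuous_intros map_intoD(1)[OF mG]) (use \<delta> in auto)
    have "H G z \<in> X \<times> unit_interval" if z: "z \<in> unit_square" for z
    proof -
      have "(1 - \<theta> (snd z)) *\<^sub>R snd z + \<theta> (snd z) *\<^sub>R max 0 (min 1 (snd (G z))) \<in> unit_interval"
        using z \<theta>01 by (intro convexD[OF convex_real_interval(5)]) auto
      then show ?thesis using map_intoD(2)[OF mG z] by (auto simp: H_def mem_Times_iff add.commute)
    qed
    then show "H G \<in> unit_square \<rightarrow> X \<times> unit_interval" by blast
    show "H G ` (unit_interval \<times> {e}) \<subseteq> X \<times> {e}" if e: "e \<in> {0, 1}" for e
    proof -
      have "\<theta> e = 0" using e \<delta> by (auto simp: \<theta>_def)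
      moreover have "fst (G (x, e)) \<in> X" if "x \<in> unit_interval" for x
        using map_intoD(2)[OF mG, of "(x, e)"] that e by (auto simp: mem_Times_iff)
      ultimately show ?thesis by (auto simp: H_def)
    qed
  qed
  have close: "unif_dist unit_square f (fst \<circ> H G) < \<epsilon>"
    if n1: "\<And>z. z \<in> unit_square \<Longrightarrow> dist (f z) (h z) < \<epsilon> / 4"
      and r: "\<forall>z\<in>unit_square. \<forall>z'\<in>unit_square. dist z' z < r \<longrightarrow> dist (h z') (h z) < \<epsilon> / 4" "c < r"
      and n2: "\<And>z. z \<in> unit_square \<Longrightarrow> dist (F h z) (G z) < \<eta>" for f h G r
  proof (rule unif_dist_lessI)
    show "dist (f z) ((fst \<circ> H G) z) \<le> 3 * \<epsilon> / 4" if z: "z \<in> unit_square" for z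
    proof -
      have "dist (fst z, \<kappa> (snd z)) z = \<bar>\<kappa> (snd z) - snd z\<bar>"
        by (simp add: dist_prod_def dist_real_def)
      then have "dist (fst z, \<kappa> (snd z)) z < r" using \<kappa>near[of "snd z"] z r(2) by auto
      then have "dist (h (fst z, \<kappa> (snd z))) (h z) < \<epsilon> / 4"
        using r(1) z \<kappa>01[of "snd z"] by auto
      moreover have "dist (h (fst z, \<kappa> (snd z))) (fst (G z)) < \<epsilon> / 4"
        using dist_fst_less[OF n2[OF z]] \<eta>(4) by (simp add: F_def)
      moreover have "dist (f z) (h z) < \<epsilon> / 4" using n1 z .
      moreover have "dist (f z) (fst (G z)) \<le> dist (f z) (h z) + dist (h (fst z, \<kappa> (snd z))) (h z) + dist (h (fst z, \<kappa> (snd z))) (fst (G z))"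
        using dist_triangle[of "f z" "fst (G z)" "h z"]
          dist_triangle[of "h z" "fst (G z)" "h (fst z, \<kappa> (snd z))"]
        by (simp add: dist_commute)
      ultimately show ?thesis by (simp add: H_def)
    qed
    show "unit_square \<noteq> {}" by auto
  qed (use \<open>\<epsilon> > 0\<close> in simp)
  have False if z: "z \<in> unit_square" "z' \<in> unit_square" and eq: "H G1 z = H G2 z'" for z z'
  proof -
    have height: "\<bar>snd (H G w) - snd w\<bar> < \<delta>" "\<bar>snd (G w) - snd w\<bar> < \<delta>"
      if w: "w \<in> unit_square" and "dist (F h w) (G w) < \<eta>" for h G w
    proof -
      show *: "\<bar>snd (G w) - snd w\<bar> < \<delta>"
        using dist_snd_less[OF that(2)] \<eta>(2) by (simp add: F_def dist_real_def abs_minus_commute)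
      let ?k = "max 0 (min 1 (snd (G w)))"
      have "\<bar>?k - snd w\<bar> < \<delta>" using * w by (auto simp: abs_if split: if_splits)
      moreover have "snd (H G w) - snd w = \<theta> (snd w) * (?k - snd w)"
        by (simp add: H_def algebra_simps)
      then have "\<bar>snd (H G w) - snd w\<bar> \<le> 1 * \<bar>?k - snd w\<bar>"
        using \<theta>01[of "snd w"] by (simp only: abs_mult) (intro mult_right_mono, auto)
      ultimately show "\<bar>snd (H G w) - snd w\<bar> < \<delta>" by simp
    qed
    have hz: "\<bar>snd z - snd z'\<bar> < 2 * \<delta>"
      using height(1)[where h = h1 and G = G1, OF z(1) Gn(1)[OF z(1)]] height(1)[where h = h2 and G = G2, OF z(2) Gn(2)[OF z(2)]] eq by simp
    have same: False if "e = 0 \<or> e = 1" "\<kappa> (snd z) = e" "\<kappa> (snd z') = e" for e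
    proof -
      have "dist (h1 (fst z, e)) (fst (G1 z)) < m / 2" "dist (h2 (fst z', e)) (fst (G2 z')) < m / 2"
        using dist_fst_less[OF Gn(1)[OF z(1)]] dist_fst_less[OF Gn(2)[OF z(2)]] that \<eta>(3) by (auto simp: F_def)
      moreover have "fst (G1 z) = fst (G2 z')" using eq by (simp add: H_def)
      moreover have "m \<le> dist (h1 (fst z, e)) (h2 (fst z', e))"
        using gap' that z by auto
      ultimately show False
        using dist_triangle2[of "h1 (fst z, e)" "h2 (fst z', e)" "fst (G1 z)"] by simp
    qed
    consider "snd z \<le> 2 * \<delta> \<or> snd z' \<le> 2 * \<delta>" | "snd z \<ge> 1 - 2 * \<delta> \<or> snd z' \<ge> 1 - 2 * \<delta>"
      | "2 * \<delta> < snd z" "snd z < 1 - 2 * \<delta>" "2 * \<delta> < snd z'" "snd z' < 1 - 2 * \<delta>"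
      by linarith
    then show False
    proof cases
      case 1
      then have "snd z \<le> c / 2" "snd z' \<le> c / 2" using hz unfolding \<delta>_def abs_less_iff by linarith+
      then show False using same \<kappa>0 by blast
    next
      case 2
      then have "snd z \<ge> 1 - c / 2" "snd z' \<ge> 1 - c / 2" using hz unfolding \<delta>_def abs_less_iff by linarith+
      then show False using same \<kappa>1 by blast
    next
      case 3
      have HG: "H G w = G w" if "2 * \<delta> < snd w" "snd w < 1 - 2 * \<delta>" "\<bar>snd (G w) - snd w\<bar> < \<delta>" for G w
      proof -
        have "1 \<le> min (snd w) (1 - snd w) / \<delta>" using that \<delta> by (simp add: pos_le_divide_eq)
        then have "\<theta> (snd w) = 1" by (simp add: \<theta>_def)
        moreover have "max 0 (min 1 (snd (G w))) = snd (G w)" using that by auto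
        ultimately show ?thesis by (simp add: H_def)
      qed
      have "G1 z = G2 z'"
        using HG[where G = G1, OF 3(1,2) height(2)[where h = h1 and G = G1, OF z(1) Gn(1)[OF z(1)]]] HG[where G = G2, OF 3(3,4) height(2)[where h = h2 and G = G2, OF z(2) Gn(2)[OF z(2)]]] eq by simp
      then show False using G(5) z by blast
    qed
  qed
  then have "H G1 ` unit_square \<inter> H G2 ` unit_square = {}" by blast
  then show "\<exists>F1 F2. path_concordance_in X F1 \<and> path_concordance_in X F2 \<and>
         F1 ` unit_square \<inter> F2 ` unit_square = {} \<and>
         unif_dist unit_square f1 (fst \<circ> F1) < \<epsilon> \<and> unif_dist unit_square f2 (fst \<circ> F2) < \<epsilon>"
    using conc[OF G(1)] conc[OF G(2)] close[OF near(1) r1(2) c(3) Gn(1)] close[OF near(2) r2(2) c(4) Gn(2)] by blast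
qed

section \<open>Separating a square from a path\<close>

definition square_boundary :: "(real \<times> real) set"
  where "square_boundary = {z \<in> unit_square. fst z \<in> {0, 1} \<or> snd z \<in> {0, 1}}"

text \<open>
  The two concordances come from the homotopy \<open>g\<close> and the constant homotopy of \<open>u\<close>, and they are
  disjoint already. They have to be bent back to \<open>g\<close> on the boundary of the square, to \<open>u\<close> on \<open>W\<close>,
  and to \<open>u\<close> at the two ends of a longer interval of heights. The weight \<open>\<psi>\<close> differs
  from \<open>1\<close> only where \<open>g\<close> stays away from \<open>u ` D\<close>, and \<open>\<theta>\<close> only where \<open>u\<close>
  stays away from the image of \<open>g\<close>, so bending creates no intersections there; the passage from \<open>F2\<close> to \<open>u\<close>
  in the height direction uses heights outside \<open>{0..1}\<close>, which \<open>G\<close> does not reach.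
\<close>

lemma separate_square_from_path:
  fixes g :: "real \<times> real \<Rightarrow> 'a::metric_space" and u :: "real \<Rightarrow> 'a"
  assumes lb: "locally_blending X lam" and dcp: "disjoint_path_concordances_property X"
    and g: "map_into unit_square X g" and u: "map_into unit_interval X u"
    and D: "compact D" "D \<subseteq> unit_interval" "D \<noteq> {}" "u ` D \<inter> g ` square_boundary = {}"
    and W: "compact W" "W \<subseteq> D" "u ` W \<inter> g ` unit_square = {}" and e: "\<epsilon> > 0"
  obtains G U :: "real \<times> real \<Rightarrow> 'a \<times> real" where "map_into unit_square (X \<times> {-1..2}) G" "map_into (D \<times> {-1..2}) (X \<times> {-1..2}) U"
    "\<And>z. z \<in> square_boundary \<Longrightarrow> G z = (g z, 1 / 2)"
    "\<And>x s. x \<in> D \<Longrightarrow> s \<in> {-1..2} \<Longrightarrow> s = -1 \<or> s = 2 \<or> x \<in> W \<Longrightarrow> U (x, s) = (u x, s)"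
    "\<And>z. z \<in> unit_square \<Longrightarrow> dist (g z) (fst (G z)) < \<epsilon>"
    "\<And>x s. x \<in> D \<Longrightarrow> s \<in> {-1..2} \<Longrightarrow> dist (u x) (fst (U (x, s))) < \<epsilon>"
    "G ` unit_square \<inter> U ` (D \<times> {-1..2}) = {}"
proof -
  have sq: "compact unit_square" by (intro compact_Times compact_Icc)
  have bd_eq: "square_boundary = unit_square \<inter> ({0, 1} \<times> UNIV \<union> UNIV \<times> {0, 1})"
    unfolding square_boundary_def by auto
  have bd_cl: "closed ({0, 1 :: real} \<times> (UNIV :: real set) \<union> (UNIV :: real set) \<times> {0, 1 :: real})"
    by (intro closed_Un closed_Times) auto
  have bd: "compact square_boundary"
    unfolding bd_eq by (rule compact_Int_closed[OF sq bd_cl])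
  have bd': "square_boundary \<subseteq> unit_square" by (auto simp: square_boundary_def)
  have cg: "compact (g ` S)" if "compact S" "S \<subseteq> unit_square" for S
    using that map_intoD(1)[OF g] by (intro compact_continuous_image) (auto intro: continuous_on_subset)
  have cu: "compact (u ` S)" if "compact S" "S \<subseteq> unit_interval" for S
    using that map_intoD(1)[OF u] by (intro compact_continuous_image) (auto intro: continuous_on_subset)
  obtain m1 where m1: "m1 > 0" "\<And>x y. x \<in> u ` D \<Longrightarrow> y \<in> g ` square_boundary \<Longrightarrow> m1 \<le> dist x y"
    using compact_disjoint_gap[OF cu[OF D(1,2)] cg[OF bd bd'] D(4)] by blast
  have "W \<subseteq> unit_interval" using W(2) D(2) by blast
  then obtain m2 where m2: "m2 > 0" "\<And>x y. x \<in> u ` W \<Longrightarrow> y \<in> g ` unit_square \<Longrightarrow> m2 \<le> dist x y"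
    using compact_disjoint_gap[OF cu[OF W(1)] cg[OF sq order_refl] W(3)] by blast
  let ?P = "g ` unit_square \<union> u ` unit_interval"
  have P: "compact ?P" "?P \<subseteq> X"
    using cg[OF sq order_refl] cu[OF compact_Icc order_refl] map_intoD(3)[OF g] map_intoD(3)[OF u] by auto
  \<comment> \<open>Points of \<open>G\<close> and \<open>U\<close> that coincide lie over points of \<open>g\<close> and \<open>u\<close> at distance at most
    \<open>2 * e1\<close>, hence at most half of either gap, where both weights are \<open>1\<close>.\<close>
  define e1 where "e1 = min \<epsilon> (min m1 m2 / 4)"
  have e1: "e1 > 0" "e1 \<le> \<epsilon>" "e1 \<le> m1 / 4" "e1 \<le> m2 / 4" using e m1(1) m2(1) by (auto simp: e1_def)
  obtain \<delta> where \<delta>: "\<delta> > 0" "\<delta> \<le> e1" "blends_within X lam ?P e1 \<delta>"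
    using locally_blendingE[OF lb P e1(1)] .
  note B = blends_withinD[OF \<delta>(3)]
  have uf: "map_into unit_square X (u \<circ> fst)"
    unfolding map_into_def o_def
    by (intro conjI continuous_on_compose2[OF map_intoD(1)[OF u]] continuous_intros) (use map_intoD(2)[OF u] in auto)
  obtain F1 F2 where F: "path_concordance_in X F1" "path_concordance_in X F2"
      "F1 ` unit_square \<inter> F2 ` unit_square = {}"
      "unif_dist unit_square g (fst \<circ> F1) < \<delta>" "unif_dist unit_square (u \<circ> fst) (fst \<circ> F2) < \<delta>"
    using dcp g uf \<delta>(1) unfolding disjoint_path_concordances_property_def path_homotopy_in_def by meson
  have F': "map_into unit_square (X \<times> unit_interval) F1" "map_into unit_square (X \<times> unit_interval) F2"
    using F(1,2) by (simp_all add: path_concordance_in_def)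
  have F2end: "snd (F2 (x, e)) = e" if "x \<in> unit_interval" "e \<in> {0, 1}" for x e
    using F(2) that unfolding path_concordance_in_def by fastforce
  have Fn: "dist (g z) (fst (F1 z)) < \<delta>" "dist (u (fst z)) (fst (F2 z)) < \<delta>" if "z \<in> unit_square" for z
  proof -
    have "continuous_on unit_square (fst \<circ> F1)" "continuous_on unit_square (fst \<circ> F2)"
      unfolding o_def by (intro continuous_intros map_intoD(1)[OF F'(1)] map_intoD(1)[OF F'(2)])+
    then show "dist (g z) (fst (F1 z)) < \<delta>" "dist (u (fst z)) (fst (F2 z)) < \<delta>"
      using unif_dist_lessD[OF F(4) sq map_intoD(1)[OF g] _ that] unif_dist_lessD[OF F(5) sq map_intoD(1)[OF uf] _ that]
      by auto
  qed
  define \<theta> where "\<theta> x = max 0 (min 1 (2 - 2 * infdist (u x) (g ` unit_square) / m2))" for x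
  define \<psi> where "\<psi> z = max 0 (min 1 (2 - 2 * infdist (g z) (u ` D) / m1))" for z
  define cl where "cl s = max 0 (min 1 s)" for s :: real
  define w where "w x s = \<theta> x * cl (min (1 + s) (2 - s))" for x s
  define G where "G z = (lam (g z) (fst (F1 z)) (\<psi> z), \<psi> z * snd (F1 z) + (1 - \<psi> z) / 2)" for z
  \<comment> \<open>For heights outside \<open>{0..1}\<close> the concordance \<open>F2\<close> is frozen at its end \<open>cl s\<close>, and the
    term \<open>s - cl s\<close> restores the height.\<close>
  define U where "U p = (lam (u (fst p)) (fst (F2 (fst p, cl (snd p)))) (w (fst p) (snd p)),
      (1 - \<theta> (fst p)) * snd p + \<theta> (fst p) * (snd (F2 (fst p, cl (snd p))) + (snd p - cl (snd p))))" for p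
  have \<theta>01: "0 \<le> \<theta> x" "\<theta> x \<le> 1" and \<psi>01: "0 \<le> \<psi> z" "\<psi> z \<le> 1" and cl01: "0 \<le> cl s" "cl s \<le> 1" for x z s
    by (auto simp: \<theta>_def \<psi>_def cl_def)
  have w01: "0 \<le> w x s" "w x s \<le> 1" for x s
    using \<theta>01 cl01 by (auto simp: w_def mult_le_one)
  have Gpt: "g z \<in> ?P" "fst (F1 z) \<in> X" "dist (g z) (fst (F1 z)) < \<delta>" "snd (F1 z) \<in> unit_interval" if "z \<in> unit_square" for z
    using that Fn(1) map_intoD(2)[OF F'(1) that] by (auto simp: mem_Times_iff)
  have Upt: "u x \<in> ?P" "fst (F2 (x, cl s)) \<in> X" "dist (u x) (fst (F2 (x, cl s))) < \<delta>"
     "snd (F2 (x, cl s)) \<in> unit_interval" if "x \<in> D" for x s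
  proof -
    have z: "(x, cl s) \<in> unit_square" using that D(2) cl01 by auto
    show "u x \<in> ?P" "fst (F2 (x, cl s)) \<in> X" "dist (u x) (fst (F2 (x, cl s))) < \<delta>"
     "snd (F2 (x, cl s)) \<in> unit_interval"
      using z Fn(2)[OF z] map_intoD(2)[OF F'(2) z] by (auto simp: mem_Times_iff)
  qed
  have \<psi>c: "continuous_on unit_square \<psi>"
    unfolding \<psi>_def using m1(1) by (intro continuous_intros map_intoD(1)[OF g]) auto
  have \<theta>c: "continuous_on (D \<times> {-1..2}) (\<lambda>p. \<theta> (fst p))"
    unfolding \<theta>_def
    by (intro continuous_intros continuous_on_compose2[OF map_intoD(1)[OF u]]) (use m2(1) D(2) in auto)
  have clc: "continuous_on S (\<lambda>p. cl (f p))" if "continuous_on S f" for S and f :: "real \<times> real \<Rightarrow> real"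
    unfolding cl_def by (intro continuous_intros that)
  have F2c: "continuous_on (D \<times> {-1..2}) (\<lambda>p. F2 (fst p, cl (snd p)))"
    by (intro continuous_on_compose2[OF map_intoD(1)[OF F'(2)]] continuous_intros clc) (use cl01 D(2) in auto)
  show thesis
  proof (rule that[of G U])
    show "map_into unit_square (X \<times> {-1..2}) G"
      unfolding map_into_def
    proof (intro conjI Pi_I)
      show "continuous_on unit_square G"
        unfolding G_def
        by (intro continuous_intros blends_within_continuous[OF \<delta>(3)] map_intoD(1)[OF g] map_intoD(1)[OF F'(1)] \<psi>c)
          (use Gpt \<psi>01 in auto)
      fix z assume z: "z \<in> unit_square"
      have "\<psi> z *\<^sub>R snd (F1 z) + (1 - \<psi> z) *\<^sub>R (1 / 2) \<in> unit_interval"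
        using Gpt(4)[OF z] \<psi>01 by (intro convexD[OF convex_real_interval(5)]) auto
      then show "G z \<in> X \<times> {-1..2}"
        using B(3)[OF Gpt(1-3)[OF z] \<psi>01] by (auto simp: G_def)
    qed
    have Ulev: "snd (U (x, s)) \<in> {-1..2} \<and> (s < 0 \<or> s > 1 \<longrightarrow> snd (U (x, s)) = s)" if x: "x \<in> D" "s \<in> {-1..2}" for x s
    proof -
      consider "s < 0" | "s > 1" | "0 \<le> s" "s \<le> 1" by linarith
      then show ?thesis
      proof cases
        case 1
        then show ?thesis using F2end[of x 0] x D(2) by (auto simp: U_def cl_def algebra_simps)
      next
        case 2
        then show ?thesis using F2end[of x 1] x D(2) by (auto simp: U_def cl_def algebra_simps)
      next
        case 3
        then have [simp]: "cl s = s" by (simp add: cl_def)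
        have "(1 - \<theta> x) *\<^sub>R s + \<theta> x *\<^sub>R snd (F2 (x, s)) \<in> unit_interval"
          using Upt(4)[OF x(1), of s] 3 \<theta>01 by (intro convexD[OF convex_real_interval(5)]) auto
        then show ?thesis using 3 by (auto simp: U_def)
      qed
    qed
    show "map_into (D \<times> {-1..2}) (X \<times> {-1..2}) U"
      unfolding map_into_def
    proof (intro conjI Pi_I)
      have "continuous_on (D \<times> {-1..2}) (\<lambda>p. lam (u (fst p)) (fst (F2 (fst p, cl (snd p)))) (w (fst p) (snd p)))"
        unfolding w_def
      proof (intro continuous_intros blends_within_continuous[OF \<delta>(3)] continuous_on_compose2[OF map_intoD(1)[OF u]] F2c \<theta>c clc)
        fix z :: "real \<times> real" assume "z \<in> D \<times> {-1..2}"
        then show "u (fst z) \<in> ?P \<and> fst (F2 (fst z, cl (snd z))) \<in> X \<and> dist (u (fst z)) (fst (F2 (fst z, cl (snd z)))) < \<delta> \<and>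
         0 \<le> \<theta> (fst z) * cl (min (1 + snd z) (2 - snd z)) \<and> \<theta> (fst z) * cl (min (1 + snd z) (2 - snd z)) \<le> 1"
          using Upt(1)[of "fst z"] Upt(2,3)[of "fst z" "snd z"] w01[of "fst z" "snd z"] by (auto simp: w_def)
      qed (use D(2) in auto)
      then show "continuous_on (D \<times> {-1..2}) U"
        unfolding U_def by (intro continuous_intros F2c \<theta>c clc)
      fix p :: "real \<times> real" assume p: "p \<in> D \<times> {-1..2}"
      then have "fst p \<in> D" by auto
      then have "fst (U p) \<in> X"
        using B(3)[OF Upt(1)[of "fst p"] Upt(2,3)[of "fst p" "snd p"] w01[of "fst p" "snd p"]] by (auto simp: U_def)
      then show "U p \<in> X \<times> {-1..2}"
        using Ulev[of "fst p" "snd p"] p by (auto simp: mem_Times_iff)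
    qed
    show "G z = (g z, 1 / 2)" if z: "z \<in> square_boundary" for z
    proof -
      have "z \<in> unit_square" using bd' z by blast
      have "m1 \<le> infdist (g z) (u ` D)"
        using m1(2) z D(3) by (intro infdist_geI) (auto simp: dist_commute)
      then have "\<psi> z = 0" using m1(1) by (simp add: \<psi>_def field_simps)
      then show ?thesis using B(1)[OF Gpt(1-3)[OF \<open>z \<in> unit_square\<close>]] by (simp add: G_def)
    qed
    show "U (x, s) = (u x, s)" if x: "x \<in> D" "s \<in> {-1..2}" "s = -1 \<or> s = 2 \<or> x \<in> W" for x s
    proof -
      have "s = -1 \<or> s = 2 \<or> \<theta> x = 0"
      proof (cases "x \<in> W")
        case True
        then have "m2 \<le> infdist (u x) (g ` unit_square)"
          using m2(2) by (intro infdist_geI) auto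
        then show ?thesis using m2(1) by (simp add: \<theta>_def field_simps)
      qed (use x in auto)
      then have "w x s = 0" "snd (U (x, s)) = s"
        using Ulev[OF x(1,2)] by (auto simp: w_def cl_def U_def)
      then show ?thesis using B(1)[OF Upt(1-3)[OF x(1)]] by (simp add: U_def prod_eq_iff)
    qed
    have Gnear: "dist (g z) (fst (G z)) < e1" if "z \<in> unit_square" for z
      using B(4)[OF Gpt(1-3)[OF that] \<psi>01] by (simp add: G_def dist_commute)
    then show "dist (g z) (fst (G z)) < \<epsilon>" if "z \<in> unit_square" for z
      using that e1(2) by (meson order_less_le_trans)
    have Unear: "dist (u x) (fst (U (x, s))) < e1" if "x \<in> D" for x s
      using B(4)[OF Upt(1-3)[OF that] w01] by (simp add: U_def dist_commute)
    then show "dist (u x) (fst (U (x, s))) < \<epsilon>" if "x \<in> D" for x s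
      using that e1(2) by (meson order_less_le_trans)
    have False if z: "z \<in> unit_square" and x: "x \<in> D" "s \<in> {-1..2}" and eq: "G z = U (x, s)" for z x s
    proof -
      have d: "dist (u x) (g z) \<le> 2 * e1"
        using Gnear[OF z] Unear[OF x(1), of s] eq dist_triangle2[of "u x" "g z" "fst (G z)"] by simp
      have "infdist (u x) (g ` unit_square) \<le> m2 / 2"
        using infdist_le[of "g z" "g ` unit_square" "u x"] z d e1(4) by auto
      then have \<theta>1: "\<theta> x = 1" using m2(1) by (simp add: \<theta>_def field_simps)
      have "infdist (g z) (u ` D) \<le> m1 / 2"
        using infdist_le[of "u x" "u ` D" "g z"] x d e1(3) by (auto simp: dist_commute)
      then have \<psi>1: "\<psi> z = 1" using m1(1) by (simp add: \<psi>_def field_simps)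
      have G1: "G z = F1 z"
        using \<psi>1 B(2)[OF Gpt(1-3)[OF z]] by (simp add: G_def prod_eq_iff)
      have "0 \<le> s" "s \<le> 1" using Ulev[OF x] eq G1 Gpt(4)[OF z] by force+
      then have cls: "cl s = s" "cl (min (1 + s) (2 - s)) = 1" by (auto simp: cl_def)
      then have "U (x, s) = F2 (x, s)"
        using \<theta>1 B(2)[OF Upt(1-3)[OF x(1)], of s] by (simp add: U_def w_def prod_eq_iff)
      then have "F1 z = F2 (x, s)" using eq G1 by simp
      moreover have "(x, s) \<in> unit_square" using x D(2) \<open>0 \<le> s\<close> \<open>s \<le> 1\<close> by auto
      ultimately have "F1 z \<in> F1 ` unit_square \<inter> F2 ` unit_square" using z by (metis IntI imageI)
      then show False using F(3) by simp
    qed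
    then show "G ` unit_square \<inter> U ` (D \<times> {-1..2}) = {}" by fastforce
  qed
qed

section \<open>Grids on the unit square\<close>

text \<open>
  The concordance property speaks of one arc at a time. A single path running through all segments lets one
  application of it handle all of them simultaneously; \<open>j s\<close> finds the segment \<open>s\<close> on that path.
\<close>

lemma join_segments:
  fixes ps :: "('e::real_normed_vector \<times> 'e) list"
  assumes S: "convex S" "S \<noteq> {}" and ps: "\<And>s. s \<in> set ps \<Longrightarrow> segment_of s \<subseteq> S"
  obtains w j where "path w" "path_image w \<subseteq> S"
    "\<And>s. s \<in> set ps \<Longrightarrow> continuous_on unit_interval (j s)"
    "\<And>s t. s \<in> set ps \<Longrightarrow> t \<in> unit_interval \<Longrightarrow> j s t \<in> unit_interval \<and> w (j s t) = linepath (fst s) (snd s) t"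
proof -
  have "\<exists>w. path w \<and> path_image w \<subseteq> S \<and>
    (\<forall>s\<in>set ps. \<exists>j. continuous_on unit_interval j \<and> (\<forall>t\<in>unit_interval. j t \<in> unit_interval \<and> w (j t) = linepath (fst s) (snd s) t))"
    using ps
  proof (induction ps)
    case Nil
    obtain c where "c \<in> S" using S(2) by blast
    then show ?case by (intro exI[of _ "\<lambda>_. c"]) (auto simp: path_def path_image_def)
  next
    case (Cons s ps)
    have "\<exists>w. path w \<and> path_image w \<subseteq> S \<and>
      (\<forall>s\<in>set ps. \<exists>j. continuous_on unit_interval j \<and> (\<forall>t\<in>unit_interval. j t \<in> unit_interval \<and> w (j t) = linepath (fst s) (snd s) t))"
      by (rule Cons.IH) (use Cons.prems in simp)
    then obtain w where w': "path w \<and> path_image w \<subseteq> S \<and>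
      (\<forall>s\<in>set ps. \<exists>j. continuous_on unit_interval j \<and> (\<forall>t\<in>unit_interval. j t \<in> unit_interval \<and> w (j t) = linepath (fst s) (snd s) t))"
      by (elim exE)
    then have w: "path w" "path_image w \<subseteq> S"
      "\<And>s. s \<in> set ps \<Longrightarrow> \<exists>j. continuous_on unit_interval j \<and> (\<forall>t\<in>unit_interval. j t \<in> unit_interval \<and> w (j t) = linepath (fst s) (snd s) t)"
      by simp_all
    define w' where "w' = linepath (fst s) (snd s) +++ (linepath (snd s) (pathstart w) +++ w)"
    have s: "segment_of s \<subseteq> S" using Cons.prems by simp
    then have "snd s \<in> S" "pathstart w \<in> S" using w(2) by auto
    then have mid: "closed_segment (snd s) (pathstart w) \<subseteq> S" using S(1) by (simp add: closed_segment_subset)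
    have "path w'" unfolding w'_def using w(1) by (intro path_join_imp) auto
    moreover have "path_image w' \<subseteq> S"
      unfolding w'_def using s mid w(2) by (intro subset_path_image_join) auto
    moreover have "\<exists>j. continuous_on unit_interval j \<and> (\<forall>t\<in>unit_interval. j t \<in> unit_interval \<and> w' (j t) = linepath (fst s') (snd s') t)"
      if s': "s' \<in> set (s # ps)" for s'
    proof (cases "s' = s")
      case True
      then show ?thesis
        by (intro exI[of _ "\<lambda>t. t / 2"]) (auto simp: w'_def joinpaths_def intro!: continuous_intros)
    next
      case False
      then have "s' \<in> set ps" using s' by simp
      from w(3)[OF this] obtain j where j: "continuous_on unit_interval j"
        "\<forall>t\<in>unit_interval. j t \<in> unit_interval \<and> w (j t) = linepath (fst s') (snd s') t"
        by (elim exE conjE)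
      have "w' (3 / 4 + x / 4) = w x" if "x \<in> unit_interval" for x
      proof -
        have "2 * (3 / 4 + x / 4) - 1 = 1 / 2 + x / 2" "2 * (1 / 2 + x / 2) - 1 = x" by (simp_all add: field_simps)
        moreover have "\<not> 3 / 4 + x / 4 \<le> 1 / 2" using that by simp
        ultimately show ?thesis
          using that by (cases "x = 0") (auto simp: w'_def joinpaths_def linepath_def pathstart_def)
      qed
      then show ?thesis
        using j by (intro exI[of _ "\<lambda>t. 3 / 4 + j t / 4"]) (auto intro!: continuous_intros)
    qed
    ultimately show ?case by blast
  qed
  then obtain w where w: "path w" "path_image w \<subseteq> S"
    "\<forall>s\<in>set ps. \<exists>j. continuous_on unit_interval j \<and> (\<forall>t\<in>unit_interval. j t \<in> unit_interval \<and> w (j t) = linepath (fst s) (snd s) t)"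
    by blast
  from bchoice[OF w(3)] obtain j where
    "\<forall>s\<in>set ps. continuous_on unit_interval (j s) \<and> (\<forall>t\<in>unit_interval. j s t \<in> unit_interval \<and> w (j s t) = linepath (fst s) (snd s) t)"
    by blast
  then show thesis using that[OF w(1,2), of j] by blast
qed

definition cell_map :: "nat \<Rightarrow> nat \<times> nat \<Rightarrow> real \<times> real \<Rightarrow> real \<times> real"
  where "cell_map N q z = ((real (fst q) + fst z) / real N, (real (snd q) + snd z) / real N)"

definition cells :: "nat \<Rightarrow> (nat \<times> nat) set"
  where "cells N = {..<N} \<times> {..<N}"

definition grid_vertices :: "nat \<Rightarrow> (real \<times> real) set"
  where "grid_vertices N = (\<lambda>(k, l). (real k / real N, real l / real N)) ` ({..N} \<times> {..N})"

definition grid_lines :: "nat \<Rightarrow> (real \<times> real) set"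
  where "grid_lines N = {z \<in> unit_square. \<exists>k\<le>N. fst z = real k / real N \<or> snd z = real k / real N}"

definition grid_segments :: "nat \<Rightarrow> ((real \<times> real) \<times> real \<times> real) set"
  where "grid_segments N = (\<lambda>k. ((real k / real N, 0), (real k / real N, 1))) ` {..N} \<union>
    (\<lambda>k. ((0, real k / real N), (1, real k / real N))) ` {..N}"

lemma segment_vertical: "closed_segment (x, 0) (x, 1) = {x} \<times> unit_interval"
  and segment_horizontal: "closed_segment (0, y) (1, y) = unit_interval \<times> {y}" for x y :: real
  by (auto simp: closed_segment_def scaleR_prod_def algebra_simps)

lemma finite_cells: "finite (cells N)" by (simp add: cells_def)

lemma finite_grid_vertices: "finite (grid_vertices N)" by (simp add: grid_vertices_def)

lemma finite_grid_segments: "finite (grid_segments N)" by (simp add: grid_segments_def)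

lemma frac01: "k \<le> N \<Longrightarrow> 0 \<le> real k / real N" "k \<le> N \<Longrightarrow> real k / real N \<le> 1"
  by (auto simp: divide_le_eq)

lemma grid_segmentsE:
  assumes "s \<in> grid_segments N"
  obtains k where "k \<le> N" "s = ((real k / real N, 0), (real k / real N, 1))" "segment_of s = {real k / real N} \<times> unit_interval"
  | k where "k \<le> N" "s = ((0, real k / real N), (1, real k / real N))" "segment_of s = unit_interval \<times> {real k / real N}"
  using assms unfolding grid_segments_def by (auto simp: segment_vertical segment_horizontal)

lemma grid_lines_eq: "grid_lines N = (\<Union>s\<in>grid_segments N. segment_of s)"
proof
  show "grid_lines N \<subseteq> (\<Union>s\<in>grid_segments N. segment_of s)"
    unfolding grid_lines_def grid_segments_def
    by (auto simp: segment_vertical segment_horizontal)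
  show "(\<Union>s\<in>grid_segments N. segment_of s) \<subseteq> grid_lines N"
  proof
    fix z assume "z \<in> (\<Union>s\<in>grid_segments N. segment_of s)"
    then obtain s where s: "s \<in> grid_segments N" "z \<in> segment_of s" by blast
    from s(1) show "z \<in> grid_lines N"
    proof (cases rule: grid_segmentsE)
      case (1 k)
      have "fst z = real k / real N" "snd z \<in> unit_interval"
        using s(2) unfolding 1(3) mem_Times_iff by simp_all
      moreover from this have "z \<in> unit_square" using frac01[OF 1(1)] unfolding mem_Times_iff by simp
      ultimately show ?thesis using 1(1) unfolding grid_lines_def by blast
    next
      case (2 k)
      have "snd z = real k / real N" "fst z \<in> unit_interval"
        using s(2) unfolding 2(3) mem_Times_iff by simp_all
      moreover from this have "z \<in> unit_square" using frac01[OF 2(1)] unfolding mem_Times_iff by simp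
      ultimately show ?thesis using 2(1) unfolding grid_lines_def by blast
    qed
  qed
qed

lemma grid_segments_subset: "s \<in> grid_segments N \<Longrightarrow> segment_of s \<subseteq> grid_lines N"
  unfolding grid_lines_eq by blast

lemma grid_segments_nondegenerate: "s \<in> grid_segments N \<Longrightarrow> fst s \<noteq> snd s"
  by (erule grid_segmentsE) auto

lemma grid_lines_subset: "grid_lines N \<subseteq> unit_square"
  by (auto simp: grid_lines_def)

lemma grid_vertices_subset: "grid_vertices N \<subseteq> grid_lines N"
proof
  fix z assume "z \<in> grid_vertices N"
  then obtain k l where kl: "k \<le> N" "l \<le> N" "z = (real k / real N, real l / real N)"
    unfolding grid_vertices_def by auto
  then show "z \<in> grid_lines N"
    using frac01[OF kl(1)] frac01[OF kl(2)] unfolding grid_lines_def by auto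
qed

lemma grid_segments_meet:
  assumes "s \<in> grid_segments N" "t \<in> grid_segments N" "s \<noteq> t" "z \<in> segment_of s" "z \<in> segment_of t"
  shows "z \<in> grid_vertices N"
  using assms(1)
proof (cases rule: grid_segmentsE)
  case (1 k)
  from assms(2) show ?thesis
    by (cases rule: grid_segmentsE) (use 1 assms(3-5) in \<open>auto simp: grid_vertices_def image_iff\<close>)
next
  case (2 k)
  from assms(2) show ?thesis
    by (cases rule: grid_segmentsE) (use 2 assms(3-5) in \<open>auto simp: grid_vertices_def image_iff\<close>)
qed

lemma compact_grid_lines: "compact (grid_lines N)"
  unfolding grid_lines_eq by (intro compact_UN finite_grid_segments compact_segment)

lemma continuous_on_cell_map [continuous_intros]:
  "continuous_on S f \<Longrightarrow> continuous_on S (\<lambda>z. cell_map N q (f z))"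
  unfolding cell_map_def divide_inverse by (intro continuous_intros)

lemma cell_map_in_square:
  assumes "q \<in> cells N" "z \<in> unit_square"
  shows "cell_map N q z \<in> unit_square"
proof -
  have "(real (fst q) + fst z) / real N \<le> 1" "(real (snd q) + snd z) / real N \<le> 1"
    using assms by (auto simp: cells_def divide_le_eq)
  then show ?thesis using assms(2) by (auto simp: cell_map_def)
qed

lemma cell_map_boundary:
  assumes "q \<in> cells N" "z \<in> square_boundary"
  shows "cell_map N q z \<in> grid_lines N"
proof -
  have z: "z \<in> unit_square" "fst z \<in> {0, 1} \<or> snd z \<in> {0, 1}"
    using assms(2) unfolding square_boundary_def by blast+
  have q: "fst q < N" "snd q < N" using assms(1) by (auto simp: cells_def)
  have *: "\<exists>k\<le>N. (real m + x) / real N = real k / real N" if "m < N" "x \<in> {0, 1}" for m and x :: real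
  proof (cases "x = 0")
    case True
    then show ?thesis using that(1) by (intro exI[of _ m]) simp
  next
    case False
    then show ?thesis using that by (intro exI[of _ "Suc m"]) simp
  qed
  have "\<exists>k\<le>N. fst (cell_map N q z) = real k / real N \<or> snd (cell_map N q z) = real k / real N"
    using z(2)
  proof
    assume "fst z \<in> {0, 1}"
    from *[OF q(1) this] show ?thesis unfolding cell_map_def fst_conv by blast
  next
    assume "snd z \<in> {0, 1}"
    from *[OF q(2) this] show ?thesis unfolding cell_map_def snd_conv by blast
  qed
  then show ?thesis
    using cell_map_in_square[OF assms(1) z(1)] unfolding grid_lines_def by blast
qed

lemma cell_exists:
  assumes "0 \<le> x" "x \<le> 1" "N > 0"
  obtains k where "k < N" "real k / real N \<le> x" "x \<le> (real k + 1) / real N"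
proof (cases "x = 1")
  case True
  then show thesis using that[of "N - 1"] assms(3) by (simp add: of_nat_diff divide_le_eq)
next
  case False
  define k where "k = nat \<lfloor>real N * x\<rfloor>"
  have "0 \<le> real N * x" "real N * x < real N * 1" using assms False by auto
  then have "real k \<le> real N * x" "real N * x < real k + 1" "k < N"
    unfolding k_def by (auto simp: nat_less_iff floor_less_iff)
  then show thesis using that[of k] assms(3) by (simp add: divide_le_eq le_divide_eq mult.commute)
qed

lemma dist_cell_map:
  assumes "z \<in> unit_square" "z' \<in> unit_square" "N > 0"
  shows "dist (cell_map N q z) (cell_map N q z') \<le> 2 / real N"
proof -
  have *: "dist ((m + x) / real N) ((m + y) / real N) \<le> 1 / real N" if "0 \<le> x" "x \<le> 1" "0 \<le> y" "y \<le> 1" for m x y :: real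
  proof -
    have "(m + x) / real N - (m + y) / real N = (x - y) / real N" by (simp add: diff_divide_distrib add_divide_distrib)
    then show ?thesis using that assms(3) by (simp add: dist_real_def divide_right_mono)
  qed
  have "dist (cell_map N q z) (cell_map N q z') \<le> 1 / real N + 1 / real N"
    unfolding cell_map_def using assms(1,2) by (intro order_trans[OF dist_Pair_le] add_mono *) auto
  then show ?thesis by simp
qed

text \<open>
  A monotone map of the unit interval close to the identity: it fixes the grid coordinates \<open>k / N\<close>, preserves
  the intervals between them, and is constant within distance \<open>1 / (4 * N)\<close> of each of them. Maps composed
  with it are constant near the grid vertices, which makes room for the whiskers.
\<close>

definition collapse :: "nat \<Rightarrow> real \<Rightarrow> real"
  where "collapse N x = (\<Sum>k<N. max 0 (min 1 (2 * (real N * x - real k) - 1 / 2))) / real N"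

lemma continuous_on_collapse [continuous_intros]:
  "continuous_on S f \<Longrightarrow> continuous_on S (\<lambda>z. collapse N (f z))"
  unfolding collapse_def divide_inverse by (intro continuous_intros)

lemma collapse_cell:
  assumes k: "k < N" "real k / real N \<le> x" "x \<le> (real k + 1) / real N"
  shows "collapse N x = (real k + max 0 (min 1 (2 * (real N * x - real k) - 1 / 2))) / real N"
proof -
  define c where "c i = max 0 (min 1 (2 * (real N * x - real i) - 1 / 2))" for i
  have x: "real k \<le> real N * x" "real N * x \<le> real k + 1"
    using k by (auto simp: divide_le_eq le_divide_eq mult.commute)
  have "(\<Sum>i<N. c i) = (\<Sum>i<N. (if i < k then 1 else 0) + (if i = k then c k else 0))"
  proof (rule sum.cong)
    fix i
    consider "i < k" | "i = k" | "i > k" by linarith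
    then show "c i = (if i < k then 1 else 0) + (if i = k then c k else 0)"
    proof cases
      case 1
      then have "real i + 1 \<le> real k" by linarith
      then show ?thesis using 1 x by (simp add: c_def)
    next
      case 3
      then have "real k + 1 \<le> real i" by linarith
      then show ?thesis using 3 x by (simp add: c_def)
    qed simp
  qed simp
  also have "\<dots> = (\<Sum>i<N. if i < k then 1 else 0) + c k"
    using k(1) by (simp add: sum.distrib sum.delta)
  also have "(\<Sum>i<N. if i < k then 1 else 0 :: real) = real k"
  proof -
    have "{..<N} \<inter> {i. i < k} = {..<k}" using k(1) by auto
    then show ?thesis by (simp add: sum.If_cases)
  qed
  finally show ?thesis by (simp add: collapse_def c_def)
qed

lemma collapse_near:
  assumes "0 \<le> x" "x \<le> 1" "k \<le> N" "N > 0" "\<bar>x - real k / real N\<bar> < 1 / (4 * real N)"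
  shows "collapse N x = real k / real N"
proof -
  have "real N * \<bar>x - real k / real N\<bar> < real N * (1 / (4 * real N))"
    using assms(4,5) by (intro mult_strict_left_mono) auto
  moreover have "real N * \<bar>x - real k / real N\<bar> = \<bar>real N * (x - real k / real N)\<bar>"
    by (simp add: abs_mult)
  moreover have "real N * (x - real k / real N) = real N * x - real k"
    using assms(4) by (simp add: right_diff_distrib)
  ultimately have "\<bar>real N * x - real k\<bar> < 1 / 4"
    using assms(4) by simp
  then have near: "real N * x - real k < 1 / 4" "real k - real N * x < 1 / 4"
    by linarith+
  show ?thesis
  proof (cases "k < N \<and> real k \<le> real N * x")
    case True
    then have "collapse N x = (real k + max 0 (min 1 (2 * (real N * x - real k) - 1 / 2))) / real N"
      using near assms(4) by (intro collapse_cell) (auto simp: divide_le_eq le_divide_eq mult.commute)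
    then show ?thesis using near by simp
  next
    case False
    have "real N * x \<le> real k"
    proof (cases "k < N")
      case False
      then have "k = N" using assms(3) by simp
      then show ?thesis using assms(2,4) by simp
    qed (use False in auto)
    moreover have "k > 0"
    proof (rule ccontr)
      assume "\<not> k > 0"
      then show False using False assms(1,4) by auto
    qed
    ultimately have "collapse N x = (real (k - 1) + max 0 (min 1 (2 * (real N * x - real (k - 1)) - 1 / 2))) / real N"
      using near assms(3,4) by (intro collapse_cell) (auto simp: divide_le_eq le_divide_eq mult.commute of_nat_diff)
    then show ?thesis using near \<open>k > 0\<close> by (simp add: of_nat_diff)
  qed
qed

definition collapse2 :: "nat \<Rightarrow> real \<times> real \<Rightarrow> real \<times> real"
  where "collapse2 N z = (collapse N (fst z), collapse N (snd z))"

lemma continuous_on_collapse2 [continuous_intros]: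
  "continuous_on S f \<Longrightarrow> continuous_on S (\<lambda>z. collapse2 N (f z))"
  unfolding collapse2_def by (intro continuous_intros)

lemma collapse2_cell:
  assumes "q \<in> cells N" "z \<in> unit_square"
  obtains z' where "z' \<in> unit_square" "collapse2 N (cell_map N q z) = cell_map N q z'"
proof -
  have *: "\<exists>y. 0 \<le> y \<and> y \<le> 1 \<and> collapse N ((real k + x) / real N) = (real k + y) / real N"
    if "k < N" "0 \<le> x" "x \<le> 1" for k x
  proof -
    have "collapse N ((real k + x) / real N) =
       (real k + max 0 (min 1 (2 * (real N * ((real k + x) / real N) - real k) - 1 / 2))) / real N"
      using that by (intro collapse_cell divide_right_mono) auto
    then show ?thesis
      by (intro exI[of _ "max 0 (min 1 (2 * (real N * ((real k + x) / real N) - real k) - 1 / 2))"]) auto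
  qed
  have q: "fst q < N" "snd q < N" and z: "0 \<le> fst z" "fst z \<le> 1" "0 \<le> snd z" "snd z \<le> 1"
    using assms by (auto simp: cells_def)
  obtain y1 where y1: "0 \<le> y1" "y1 \<le> 1" "collapse N ((real (fst q) + fst z) / real N) = (real (fst q) + y1) / real N"
    using *[OF q(1) z(1,2)] by (elim exE conjE)
  obtain y2 where y2: "0 \<le> y2" "y2 \<le> 1" "collapse N ((real (snd q) + snd z) / real N) = (real (snd q) + y2) / real N"
    using *[OF q(2) z(3,4)] by (elim exE conjE)
  show thesis
    using that[of "(y1, y2)"] y1 y2 by (simp add: collapse2_def cell_map_def)
qed

lemma cell_cover:
  assumes "z \<in> unit_square" "N > 0"
  obtains q z' where "q \<in> cells N" "z' \<in> unit_square" "z = cell_map N q z'"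
proof -
  obtain k where k: "k < N" "real k / real N \<le> fst z" "fst z \<le> (real k + 1) / real N"
    by (rule cell_exists[of "fst z" N]) (use assms in auto)
  obtain l where l: "l < N" "real l / real N \<le> snd z" "snd z \<le> (real l + 1) / real N"
    by (rule cell_exists[of "snd z" N]) (use assms in auto)
  show thesis
    using that[of "(k, l)" "(real N * fst z - real k, real N * snd z - real l)"] k l assms(2)
    by (auto simp: cells_def cell_map_def field_simps prod_eq_iff)
qed

lemma collapse2_in_square:
  assumes "z \<in> unit_square" "N > 0"
  shows "collapse2 N z \<in> unit_square"
proof -
  obtain q z' where q: "q \<in> cells N" "z' \<in> unit_square" "z = cell_map N q z'"
    by (rule cell_cover[OF assms])
  obtain z'' where "z'' \<in> unit_square" "collapse2 N (cell_map N q z') = cell_map N q z''"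
    by (rule collapse2_cell[OF q(1,2)])
  then show ?thesis using cell_map_in_square[OF q(1)] q(3) by simp
qed

lemma collapse2_grid_lines:
  assumes "z \<in> grid_lines N" "N > 0"
  shows "collapse2 N z \<in> grid_lines N"
proof -
  have z: "z \<in> unit_square" using assms(1) grid_lines_subset by blast
  obtain k where k: "k \<le> N" "fst z = real k / real N \<or> snd z = real k / real N"
    using assms(1) unfolding grid_lines_def by blast
  then have "collapse N (fst z) = real k / real N \<or> collapse N (snd z) = real k / real N"
    using collapse_near[of _ k N] assms(2) frac01[OF k(1)] by auto
  then show ?thesis
    using collapse2_in_square[OF z assms(2)] k(1) unfolding grid_lines_def by (auto simp: collapse2_def)
qed

lemma collapse2_near_vertex:
  assumes "v \<in> grid_vertices N" "z \<in> unit_square" "N > 0"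
    "\<bar>fst z - fst v\<bar> < 1 / (4 * real N)" "\<bar>snd z - snd v\<bar> < 1 / (4 * real N)"
  shows "collapse2 N z = v"
  using assms collapse_near[of "fst z" _ N] collapse_near[of "snd z" _ N]
  by (auto simp: grid_vertices_def collapse2_def)

definition radius :: "real \<times> real \<Rightarrow> real"
  where "radius z = max \<bar>fst z - 1 / 2\<bar> \<bar>snd z - 1 / 2\<bar>"

lemma unit_square_iff_radius: "z \<in> unit_square \<longleftrightarrow> radius z \<le> 1 / 2"
  unfolding radius_def max.bounded_iff abs_le_iff by (cases z) auto

lemma square_boundary_iff_radius: "z \<in> square_boundary \<longleftrightarrow> radius z = 1 / 2"
proof -
  obtain x y where z: "z = (x, y)" by (cases z)
  have *: "t \<in> {0, 1} \<longleftrightarrow> \<bar>t - 1 / 2\<bar> = 1 / 2" for t :: real by (auto simp: abs_if)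
  have "z \<in> square_boundary \<longleftrightarrow> radius z \<le> 1 / 2 \<and> (\<bar>x - 1 / 2\<bar> = 1 / 2 \<or> \<bar>y - 1 / 2\<bar> = 1 / 2)"
    unfolding square_boundary_def mem_Collect_eq unit_square_iff_radius * by (simp add: z)
  also have "\<dots> \<longleftrightarrow> radius z = 1 / 2"
  proof -
    have "a \<le> c \<and> b \<le> c \<and> (a = c \<or> b = c) \<longleftrightarrow> max a b = c" for a b c :: real by (auto simp: max_def)
    then show ?thesis unfolding z radius_def max.bounded_iff fst_conv snd_conv by blast
  qed
  finally show ?thesis .
qed

lemma square_boundary_subset: "square_boundary \<subseteq> unit_square"
  by (auto simp: square_boundary_def)

lemma continuous_on_radius: "continuous_on S radius"
  unfolding radius_def by (intro continuous_intros)

text \<open>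
  The middle square of radius \<open>1 / 4\<close> is filled by \<open>G\<close>; along each ray from there to the boundary
  of the cell the cylinder map \<open>P\<close> is used, with the height moving from \<open>l\<close> to \<open>\<beta>\<close>.
\<close>

lemma fill_square:
  fixes G :: "real \<times> real \<Rightarrow> 'y::topological_space" and P :: "(real \<times> real) \<times> real \<Rightarrow> 'y"
  assumes G: "continuous_on unit_square G" and P: "continuous_on (square_boundary \<times> UNIV) P"
    and \<beta>: "continuous_on square_boundary \<beta>"
    and eq: "\<And>z. z \<in> square_boundary \<Longrightarrow> G z = P (z, l)"
  obtains \<phi> where "continuous_on unit_square \<phi>" "\<And>z. z \<in> square_boundary \<Longrightarrow> \<phi> z = P (z, \<beta> z)"
    "\<And>z. z \<in> unit_square \<Longrightarrow> (\<exists>z'\<in>unit_square. \<phi> z = G z') \<or>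
       (\<exists>z'\<in>square_boundary. \<exists>s\<in>closed_segment l (\<beta> z'). \<phi> z = P (z', s))"
proof -
  define inn where "inn z = (2 * fst z - 1 / 2, 2 * snd z - 1 / 2)" for z :: "real \<times> real"
  define out where "out z = (1 / 2 + (fst z - 1 / 2) / (2 * radius z), 1 / 2 + (snd z - 1 / 2) / (2 * radius z))" for z
  define h where "h z = (2 - 4 * radius z) * l + (4 * radius z - 1) * \<beta> (out z)" for z
  define \<phi> where "\<phi> z = (if radius z \<le> 1 / 4 then G (inn z) else P (out z, h z))" for z
  have rinn: "radius (inn z) = 2 * radius z" for z
  proof -
    have "\<bar>2 * t - 1 / 2 - 1 / 2\<bar> = 2 * \<bar>t - 1 / 2\<bar>" for t :: real by (simp add: abs_if)
    then show ?thesis by (simp add: radius_def inn_def max_mult_distrib_left)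
  qed
  have inn_sq: "inn z \<in> unit_square" if "radius z \<le> 1 / 4" for z
    using rinn[of z] that unfolding unit_square_iff_radius by simp
  have rout: "radius (out z) = 1 / 2" if "radius z > 0" for z
  proof -
    have "radius (out z) = max (\<bar>fst z - 1 / 2\<bar> / (2 * radius z)) (\<bar>snd z - 1 / 2\<bar> / (2 * radius z))"
      unfolding radius_def[of "out z"] using that by (simp add: out_def abs_divide)
    also have "\<dots> = radius z / (2 * radius z)"
      unfolding radius_def[of z] by (auto simp: max_def divide_right_mono intro!: antisym)
    finally show ?thesis using that by simp
  qed
  have out_bd: "out z \<in> square_boundary" if "radius z \<ge> 1 / 4" for z
    using rout[of z] that unfolding square_boundary_iff_radius by simp
  have oc: "continuous_on {z \<in> unit_square. 1 / 4 \<le> radius z} out"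
    unfolding out_def by (intro continuous_intros continuous_on_radius) auto
  have hc: "continuous_on {z \<in> unit_square. 1 / 4 \<le> radius z} h"
    unfolding h_def by (intro continuous_intros continuous_on_radius continuous_on_compose2[OF \<beta> oc]) (use out_bd in blast)
  show thesis
  proof (rule that[of \<phi>])
    show "continuous_on unit_square \<phi>"
      unfolding \<phi>_def
    proof (rule continuous_on_cases_le)
      have "continuous_on {z \<in> unit_square. radius z \<le> 1 / 4} inn"
        unfolding inn_def by (intro continuous_intros)
      then show "continuous_on {z \<in> unit_square. radius z \<le> 1 / 4} (\<lambda>z. G (inn z))"
        by (rule continuous_on_compose2[OF G]) (use inn_sq in blast)
      show "continuous_on {z \<in> unit_square. 1 / 4 \<le> radius z} (\<lambda>z. P (out z, h z))"
        by (intro continuous_on_compose2[OF P] continuous_on_Pair oc hc) (use out_bd in auto)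
      show "continuous_on unit_square radius" by (rule continuous_on_radius)
      fix z assume z: "z \<in> unit_square" "radius z = 1 / 4"
      have "out z = inn z" unfolding out_def inn_def z(2) by (simp add: field_simps)
      moreover have "h z = l" unfolding h_def z(2) by simp
      moreover have "inn z \<in> square_boundary" using rinn[of z] z(2) by (simp add: square_boundary_iff_radius)
      ultimately show "G (inn z) = P (out z, h z)" using eq by simp
    qed
    show "\<phi> z = P (z, \<beta> z)" if "z \<in> square_boundary" for z
    proof -
      have r: "radius z = 1 / 2" using that by (simp add: square_boundary_iff_radius)
      then have "out z = z" unfolding out_def r by (simp add: field_simps prod_eq_iff)
      then show ?thesis unfolding \<phi>_def h_def r by simp
    qed
    show "(\<exists>z'\<in>unit_square. \<phi> z = G z') \<or>
       (\<exists>z'\<in>square_boundary. \<exists>s\<in>closed_segment l (\<beta> z'). \<phi> z = P (z', s))" if z: "z \<in> unit_square" for z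
    proof (cases "radius z \<le> 1 / 4")
      case True
      then have "inn z \<in> unit_square" by (rule inn_sq)
      moreover have "\<phi> z = G (inn z)" using True by (simp add: \<phi>_def)
      ultimately show ?thesis by (intro disjI1 bexI[of _ "inn z"])
    next
      case False
      have r: "radius z \<le> 1 / 2" using z unfolding unit_square_iff_radius .
      have "h z = (1 - (4 * radius z - 1)) *\<^sub>R l + (4 * radius z - 1) *\<^sub>R \<beta> (out z)" by (simp add: h_def)
      then have "h z \<in> closed_segment l (\<beta> (out z))"
        unfolding closed_segment_def using False r by (intro CollectI exI[of _ "4 * radius z - 1"]) auto
      moreover have "\<phi> z = P (out z, h z)" using False by (simp add: \<phi>_def)
      moreover have "out z \<in> square_boundary" using out_bd False by simp
      ultimately show ?thesis by (intro disjI2 bexI[of _ "out z"] bexI[of _ "h z"])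
    qed
  qed
qed

text \<open>
  Points of two cells that are mapped to the same place have coordinates differing by integers.
\<close>

lemma cell_map_overlap:
  assumes "q \<in> cells N" "q' \<in> cells N" "z \<in> unit_square" "z' \<in> unit_square"
    "cell_map N q z = cell_map N q' z'" and z: "z \<in> square_boundary \<or> q \<noteq> q'"
  shows "z' \<in> square_boundary"
proof -
  have N: "N > 0" using assms(1) by (auto simp: cells_def)
  have c: "real (fst q) + fst z = real (fst q') + fst z'" "real (snd q) + snd z = real (snd q') + snd z'"
    using assms(5) N by (simp_all add: cell_map_def)
  have int: "y \<in> {0, 1}" if "real m + x = real m' + y" "0 \<le> x" "x \<le> 1" "0 \<le> y" "y \<le> 1" "x \<in> {0, 1} \<or> m \<noteq> m'"
    for m m' and x y :: real
  proof (cases "m = m'")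
    case False
    then have "real m + 1 \<le> real m' \<or> real m' + 1 \<le> real m" by linarith
    then show ?thesis using that by auto
  qed (use that in auto)
  have "fst z' \<in> {0, 1} \<or> snd z' \<in> {0, 1}"
  proof (cases "fst z \<in> {0, 1} \<or> fst q \<noteq> fst q'")
    case True
    then show ?thesis using int[OF c(1)] assms(3,4) by auto
  next
    case False
    then have "snd z \<in> {0, 1} \<or> snd q \<noteq> snd q'"
      using z by (auto simp: square_boundary_def prod_eq_iff)
    then show ?thesis using int[OF c(2)] assms(3,4) by auto
  qed
  then show ?thesis using assms(4) unfolding square_boundary_def by blast
qed

lemma cell_map_inj: "N > 0 \<Longrightarrow> cell_map N q z = cell_map N q z' \<Longrightarrow> z = z'"
  by (simp add: cell_map_def prod_eq_iff)

text \<open>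
  Different cells meet only in boundary points of both, and there all the pieces are given by the one
  function \<open>\<psi>\<close>, so they fit together.
\<close>

lemma paste_cells:
  fixes \<phi> :: "nat \<times> nat \<Rightarrow> real \<times> real \<Rightarrow> 'y::topological_space"
  assumes N: "N > 0" and c: "\<And>q. q \<in> cells N \<Longrightarrow> continuous_on unit_square (\<phi> q)"
    and bd: "\<And>q z. q \<in> cells N \<Longrightarrow> z \<in> square_boundary \<Longrightarrow> \<phi> q z = \<psi> (cell_map N q z)"
  obtains f where "continuous_on unit_square f"
    "\<And>q z. q \<in> cells N \<Longrightarrow> z \<in> unit_square \<Longrightarrow> f (cell_map N q z) = \<phi> q z"
proof -
  define pick where "pick y = (SOME qz. fst qz \<in> cells N \<and> snd qz \<in> unit_square \<and> y = cell_map N (fst qz) (snd qz))" for y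
  define f where "f y = \<phi> (fst (pick y)) (snd (pick y))" for y
  have f: "f (cell_map N q z) = \<phi> q z" if qz: "q \<in> cells N" "z \<in> unit_square" for q z
  proof -
    let ?y = "cell_map N q z"
    define q' z' where "q' = fst (pick ?y)" and "z' = snd (pick ?y)"
    have "fst (pick ?y) \<in> cells N \<and> snd (pick ?y) \<in> unit_square \<and> ?y = cell_map N (fst (pick ?y)) (snd (pick ?y))"
      unfolding pick_def by (rule someI[of _ "(q, z)"]) (use qz in simp)
    then have qz': "q' \<in> cells N" "z' \<in> unit_square" "cell_map N q z = cell_map N q' z'"
      by (simp_all only: q'_def z'_def)
    have "\<phi> q' z' = \<phi> q z"
    proof (cases "q = q'")
      case True
      then show ?thesis using cell_map_inj[OF N, of q z z'] qz'(3) by simp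
    next
      case False
      have "z' \<in> square_boundary"
        by (rule cell_map_overlap[OF qz(1) qz'(1) qz(2) qz'(2,3)]) (use False in simp)
      moreover have "z \<in> square_boundary"
        by (rule cell_map_overlap[OF qz'(1) qz(1) qz'(2) qz(2) qz'(3)[symmetric]]) (use False in simp)
      ultimately show ?thesis using bd[OF qz(1)] bd[OF qz'(1)] qz'(3) by simp
    qed
    then show ?thesis by (simp add: f_def q'_def z'_def)
  qed
  have "continuous_on (\<Union>q\<in>cells N. cell_map N q ` unit_square) f"
  proof (rule continuous_on_closed_Union[OF finite_cells])
    fix q assume q: "q \<in> cells N"
    have "compact (cell_map N q ` unit_square)"
      by (intro compact_continuous_image continuous_intros compact_Times compact_Icc)
    then show "closed (cell_map N q ` unit_square)" by (rule compact_imp_closed)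
    define inv where "inv y = (real N * fst y - real (fst q), real N * snd y - real (snd q))" for y :: "real \<times> real"
    have inv: "inv (cell_map N q z) = z" for z using N by (simp add: inv_def cell_map_def)
    have "continuous_on (cell_map N q ` unit_square) (\<lambda>y. \<phi> q (inv y))"
      by (rule continuous_on_compose2[OF c[OF q]]) (use inv in \<open>auto simp: inv_def[abs_def] intro!: continuous_intros\<close>)
    then show "continuous_on (cell_map N q ` unit_square) f"
      by (rule continuous_on_eq) (use f[OF q] inv in auto)
  qed
  moreover have "(\<Union>q\<in>cells N. cell_map N q ` unit_square) = unit_square"
  proof
    show "(\<Union>q\<in>cells N. cell_map N q ` unit_square) \<subseteq> unit_square"
      using cell_map_in_square by blast
    show "unit_square \<subseteq> (\<Union>q\<in>cells N. cell_map N q ` unit_square)"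
    proof
      fix y assume "y \<in> unit_square"
      then obtain q z where "q \<in> cells N" "z \<in> unit_square" "y = cell_map N q z"
        by (rule cell_cover[OF _ N])
      then show "y \<in> (\<Union>q\<in>cells N. cell_map N q ` unit_square)" by blast
    qed
  qed
  ultimately show thesis by (intro that[of f] f) simp_all
qed

section \<open>Separating a square from a grid\<close>

lemma linepath_segment_param:
  fixes s :: "'e::real_inner \<times> 'e"
  defines "\<rho> \<equiv> \<lambda>z. ((z - fst s) \<bullet> (snd s - fst s)) / ((snd s - fst s) \<bullet> (snd s - fst s))"
  assumes "fst s \<noteq> snd s"
  shows "continuous_on S \<rho>" "z \<in> segment_of s \<Longrightarrow> \<rho> z \<in> unit_interval \<and> linepath (fst s) (snd s) (\<rho> z) = z"
proof -
  show "continuous_on S \<rho>" unfolding \<rho>_def by (intro continuous_intros) (use assms(2) in auto)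
  show "\<rho> z \<in> unit_interval \<and> linepath (fst s) (snd s) (\<rho> z) = z" if h: "z \<in> segment_of s"
  proof -
    obtain t where t: "0 \<le> t" "t \<le> 1" "z = linepath (fst s) (snd s) t"
      using h unfolding closed_segment_def linepath_def by auto
    have "z - fst s = t *\<^sub>R (snd s - fst s)" by (simp add: t(3) linepath_def algebra_simps)
    then have "\<rho> z = t" using assms(2) by (simp add: \<rho>_def)
    then show ?thesis using t by simp
  qed
qed

text \<open>
  One path runs through all lines of the grid, and the cylinder over a line is read off from the part of the
  path that covers it. Two lines meet only in vertices, and over vertices the cylinder is vertical by the choice
  of the exceptional set \<open>W\<close>, so the pieces agree.
\<close>

lemma separate_square_from_grid:
  fixes g v :: "real \<times> real \<Rightarrow> 'a::metric_space"
  assumes lb: "locally_blending X lam" and dcp: "disjoint_path_concordances_property X"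
    and g: "map_into unit_square X g" and v: "map_into unit_square X v"
    and lines: "v ` grid_lines N \<inter> g ` square_boundary = {}"
    and verts: "v ` grid_vertices N \<inter> g ` unit_square = {}" and e: "\<epsilon> > 0" and \<rho>: "\<rho> > 0"
  obtains G :: "real \<times> real \<Rightarrow> 'a \<times> real" and U :: "(real \<times> real) \<times> real \<Rightarrow> 'a \<times> real"
  where "map_into unit_square (X \<times> {c - \<rho>..c + \<rho>}) G"
    "map_into (grid_lines N \<times> {c - \<rho>..c + \<rho>}) (X \<times> {c - \<rho>..c + \<rho>}) U"
    "\<And>z. z \<in> square_boundary \<Longrightarrow> G z = (g z, c)"
    "\<And>y t. y \<in> grid_lines N \<Longrightarrow> t = c - \<rho> \<or> t = c + \<rho> \<Longrightarrow> U (y, t) = (v y, t)"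
    "\<And>z. z \<in> unit_square \<Longrightarrow> dist (g z) (fst (G z)) < \<epsilon>"
    "\<And>y t. y \<in> grid_lines N \<Longrightarrow> t \<in> {c - \<rho>..c + \<rho>} \<Longrightarrow> dist (v y) (fst (U (y, t))) < \<epsilon>"
    "G ` unit_square \<inter> U ` (grid_lines N \<times> {c - \<rho>..c + \<rho>}) = {}"
proof -
  obtain ps where ps: "set ps = grid_segments N" using finite_list[OF finite_grid_segments] by blast
  have sqc: "convex unit_square" "unit_square \<noteq> {}" by (auto intro!: convex_Times)
  have "segment_of s \<subseteq> unit_square" if "s \<in> set ps" for s
    using that ps grid_segments_subset grid_lines_subset by blast
  then obtain w j where w: "path w" "path_image w \<subseteq> unit_square"
    and j: "\<And>s. s \<in> set ps \<Longrightarrow> continuous_on unit_interval (j s)"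
    "\<And>s t. s \<in> set ps \<Longrightarrow> t \<in> unit_interval \<Longrightarrow> j s t \<in> unit_interval \<and> w (j s t) = linepath (fst s) (snd s) t"
    using join_segments[OF sqc] by metis
  have wc: "continuous_on unit_interval w" using w(1) by (simp add: path_def)
  have wsq: "w x \<in> unit_square" if "x \<in> unit_interval" for x using w(2) that by (auto simp: path_image_def)
  define D where "D = unit_interval \<inter> w -` grid_lines N"
  define W where "W = unit_interval \<inter> w -` grid_vertices N"
  have cl: "compact (unit_interval \<inter> w -` S)" if "closed S" for S
  proof -
    have "closed (unit_interval \<inter> w -` S)" by (rule continuous_closed_preimage[OF wc closed_atLeastAtMost that])
    then have "compact (unit_interval \<inter> (unit_interval \<inter> w -` S))" by (rule compact_Int_closed[OF compact_Icc])
    then show ?thesis by simp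
  qed
  define pick where "pick y = (SOME s. s \<in> grid_segments N \<and> y \<in> segment_of s)" for y
  define par where "par s z = ((z - fst s) \<bullet> (snd s - fst s)) / ((snd s - fst s) \<bullet> (snd s - fst s))" for s :: "(real \<times> real) \<times> real \<times> real" and z
  have par: "continuous_on S (par s)" "z \<in> segment_of s \<Longrightarrow> par s z \<in> unit_interval \<and> linepath (fst s) (snd s) (par s z) = z"
    if "s \<in> grid_segments N" for s z S
    using linepath_segment_param[OF grid_segments_nondegenerate[OF that]] unfolding par_def by blast+
  have lift: "j s (par s y) \<in> D \<and> w (j s (par s y)) = y" if "s \<in> grid_segments N" "y \<in> segment_of s" for s y
    using j(2)[of s "par s y"] par(2)[OF that] that ps grid_segments_subset[OF that(1)] by (auto simp: D_def)
  have pick: "pick y \<in> grid_segments N" "y \<in> segment_of (pick y)" if "y \<in> grid_lines N" for y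
  proof -
    have "\<exists>s. s \<in> grid_segments N \<and> y \<in> segment_of s" using that unfolding grid_lines_eq by blast
    from someI_ex[OF this] show "pick y \<in> grid_segments N" "y \<in> segment_of (pick y)" by (simp_all add: pick_def)
  qed
  define u where "u = v \<circ> w"
  have u: "map_into unit_interval X u"
    unfolding map_into_def u_def o_def
    by (intro conjI Pi_I continuous_on_compose2[OF map_intoD(1)[OF v] wc] map_intoD(2)[OF v]) (use wsq in blast)+
  have Dc: "compact D" "D \<subseteq> unit_interval" and Wc: "compact W" "W \<subseteq> D"
    unfolding D_def W_def using cl[OF compact_imp_closed[OF compact_grid_lines]]
      cl[OF finite_imp_closed[OF finite_grid_vertices]] grid_vertices_subset[of N] by blast+
  have "(0, 0) \<in> grid_lines N" by (auto simp: grid_lines_def intro: exI[of _ 0])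
  then have Dne: "D \<noteq> {}" using lift pick by blast
  have uD: "u ` D \<inter> g ` square_boundary = {}" and uW: "u ` W \<inter> g ` unit_square = {}"
    using lines verts unfolding u_def D_def W_def by auto
  obtain G0 U0 :: "real \<times> real \<Rightarrow> 'a \<times> real" where G0: "map_into unit_square (X \<times> {-1..2}) G0" and U0: "map_into (D \<times> {-1..2}) (X \<times> {-1..2}) U0"
    and G0b: "\<And>z. z \<in> square_boundary \<Longrightarrow> G0 z = (g z, 1 / 2)"
    and U0b: "\<And>x s. x \<in> D \<Longrightarrow> s \<in> {-1..2} \<Longrightarrow> s = -1 \<or> s = 2 \<or> x \<in> W \<Longrightarrow> U0 (x, s) = (u x, s)"
    and G0n: "\<And>z. z \<in> unit_square \<Longrightarrow> dist (g z) (fst (G0 z)) < \<epsilon>"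
    and U0n: "\<And>x s. x \<in> D \<Longrightarrow> s \<in> {-1..2} \<Longrightarrow> dist (u x) (fst (U0 (x, s))) < \<epsilon>"
    and dis: "G0 ` unit_square \<inter> U0 ` (D \<times> {-1..2}) = {}"
  proof (rule separate_square_from_path[OF lb dcp g u Dc Dne uD Wc uW e], goal_cases)
    case (1 G U)
    show ?case by (rule 1(1)[OF 1(2-8)])
  qed
  \<comment> \<open>\<open>\<sigma>\<close> carries the interval of heights of \<open>G0\<close> and \<open>U0\<close> to the slab, and \<open>1 / 2\<close> to its centre \<open>c\<close>.\<close>
  define \<sigma> where "\<sigma> s = c + \<rho> * (2 * s - 1) / 3" for s
  define \<tau> where "\<tau> t = (3 * (t - c) / \<rho> + 1) / 2" for t
  have \<sigma>\<tau>: "\<sigma> (\<tau> t) = t" "\<tau> (\<sigma> s) = s" for s t using \<rho> by (simp_all add: \<sigma>_def \<tau>_def field_simps)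
  have \<sigma>s: "\<sigma> s \<in> {c - \<rho>..c + \<rho>}" if "s \<in> {-1..2}" for s
  proof -
    have "\<rho> * (2 * s - 1) \<le> \<rho> * 3" "\<rho> * (-3) \<le> \<rho> * (2 * s - 1)" 
      using that \<rho> mult_left_mono[of "2 * s - 1" 3 \<rho>] mult_left_mono[of "-3" "2 * s - 1" \<rho>] by auto
    then show ?thesis by (simp add: \<sigma>_def)
  qed
  have \<tau>s: "\<tau> t \<in> {-1..2}" if "t \<in> {c - \<rho>..c + \<rho>}" for t
  proof -
    define a where "a = (t - c) / \<rho>"
    have "a \<le> 1" "-1 \<le> a" using that \<rho> by (auto simp: a_def divide_le_eq le_divide_eq)
    moreover have "\<tau> t = (3 * a + 1) / 2" by (simp add: \<tau>_def a_def)
    ultimately show ?thesis by simp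
  qed
  have \<tau>e: "\<tau> (c - \<rho>) = -1" "\<tau> (c + \<rho>) = 2" using \<rho> by (simp_all add: \<tau>_def)
  define x where "x y = j (pick y) (par (pick y) y)" for y
  have xD: "x y \<in> D" "w (x y) = y" if "y \<in> grid_lines N" for y
    using lift[OF pick[OF that]] by (simp_all add: x_def)
  define G where "G z = (fst (G0 z), \<sigma> (snd (G0 z)))" for z
  define U where "U p = (fst (U0 (x (fst p), \<tau> (snd p))), \<sigma> (snd (U0 (x (fst p), \<tau> (snd p)))))" for p
  have \<tau>c: "continuous_on S (\<lambda>p. \<tau> (f p))" if "continuous_on S f" for S and f :: "(real \<times> real) \<times> real \<Rightarrow> real"
    unfolding \<tau>_def using \<rho> by (intro continuous_intros that) auto
  have \<sigma>c: "continuous_on S (\<lambda>p. \<sigma> (f p))" if "continuous_on S f" for S and f :: "'z::topological_space \<Rightarrow> real"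
    unfolding \<sigma>_def by (intro continuous_intros that) auto
  let ?I = "{c - \<rho>..c + \<rho>}"
  show thesis
  proof (rule that[of G U])
    show "map_into unit_square (X \<times> ?I) G"
      unfolding map_into_def
    proof (intro conjI Pi_I)
      show "continuous_on unit_square G"
        unfolding G_def by (intro continuous_intros \<sigma>c map_intoD(1)[OF G0])
      show "G z \<in> X \<times> ?I" if "z \<in> unit_square" for z
        using map_intoD(2)[OF G0 that] \<sigma>s by (auto simp: G_def mem_Times_iff)
    qed
    show "map_into (grid_lines N \<times> ?I) (X \<times> ?I) U"
      unfolding map_into_def
    proof (intro conjI Pi_I)
      have "continuous_on (\<Union>s\<in>grid_segments N. segment_of s \<times> ?I) U"
      proof (rule continuous_on_closed_Union[OF finite_grid_segments])
        fix s assume s: "s \<in> grid_segments N"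
        show "closed (segment_of s \<times> ?I)" by (intro closed_Times closed_segment closed_atLeastAtMost)
        have "continuous_on (segment_of s \<times> ?I) (\<lambda>p. j s (par s (fst p)))"
        proof (rule continuous_on_compose2[OF j(1)])
          show "s \<in> set ps" using s ps by simp
          show "continuous_on (segment_of s \<times> ?I) (\<lambda>p. par s (fst p))"
            by (rule continuous_on_compose2[OF par(1)[OF s, of UNIV]]) (auto intro: continuous_intros)
        qed (use par(2)[OF s] in auto)
        then have U0c: "continuous_on (segment_of s \<times> ?I) (\<lambda>p. U0 (j s (par s (fst p)), \<tau> (snd p)))"
          by (intro continuous_on_compose2[OF map_intoD(1)[OF U0]] continuous_on_Pair \<tau>c continuous_intros)
            (use lift[OF s] \<tau>s in auto)
        show "continuous_on (segment_of s \<times> ?I) U"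
        proof (rule continuous_on_eq)
          show "continuous_on (segment_of s \<times> ?I) (\<lambda>p. (fst (U0 (j s (par s (fst p)), \<tau> (snd p))), \<sigma> (snd (U0 (j s (par s (fst p)), \<tau> (snd p))))))"
            by (intro continuous_intros \<sigma>c U0c)
          fix p assume p: "p \<in> segment_of s \<times> ?I"
          let ?y = "fst p"
          have y: "?y \<in> segment_of s" "?y \<in> grid_lines N" "snd p \<in> ?I"
            using p grid_segments_subset[OF s] by (auto simp: mem_Times_iff)
          have "U0 (j s (par s ?y), \<tau> (snd p)) = U0 (x ?y, \<tau> (snd p))"
          proof (cases "pick ?y = s")
            case False
            then have "?y \<in> grid_vertices N"
              using grid_segments_meet[OF s pick(1)[OF y(2)] _ y(1) pick(2)[OF y(2)]] by blast
            then have "x ?y \<in> W" "j s (par s ?y) \<in> W"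
              using xD[OF y(2)] lift[OF s y(1)] by (auto simp: W_def D_def)
            then show ?thesis
              using U0b[OF xD(1)[OF y(2)] \<tau>s[OF y(3)]] U0b[OF _ \<tau>s[OF y(3)], of "j s (par s ?y)"]
                lift[OF s y(1)] xD(2)[OF y(2)] by (simp add: u_def)
          qed (simp add: x_def)
          then show "(fst (U0 (j s (par s ?y), \<tau> (snd p))), \<sigma> (snd (U0 (j s (par s ?y), \<tau> (snd p))))) = U p"
            by (simp add: U_def)
        qed
      qed
      moreover have "grid_lines N \<times> ?I = (\<Union>s\<in>grid_segments N. segment_of s \<times> ?I)"
        unfolding grid_lines_eq by blast
      ultimately show "continuous_on (grid_lines N \<times> ?I) U" by (simp only:)
      show "U p \<in> X \<times> ?I" if "p \<in> grid_lines N \<times> ?I" for p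
        using map_intoD(2)[OF U0, of "(x (fst p), \<tau> (snd p))"] xD(1)[of "fst p"] \<tau>s[of "snd p"] \<sigma>s that
        by (auto simp: U_def mem_Times_iff)
    qed
    show "G z = (g z, c)" if "z \<in> square_boundary" for z
      using G0b[OF that] by (simp add: G_def \<sigma>_def)
    show "U (y, t) = (v y, t)" if y: "y \<in> grid_lines N" "t = c - \<rho> \<or> t = c + \<rho>" for y t
    proof -
      have "t \<in> ?I" using y(2) \<rho> by auto
      moreover have "\<tau> t = -1 \<or> \<tau> t = 2" using y(2) \<tau>e by auto
      ultimately have "U0 (x y, \<tau> t) = (u (x y), \<tau> t)" using U0b[OF xD(1)[OF y(1)] \<tau>s] by blast
      then show ?thesis using xD(2)[OF y(1)] by (simp add: U_def \<sigma>\<tau> u_def)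
    qed
    show "dist (g z) (fst (G z)) < \<epsilon>" if "z \<in> unit_square" for z using G0n[OF that] by (simp add: G_def)
    show "dist (v y) (fst (U (y, t))) < \<epsilon>" if "y \<in> grid_lines N" "t \<in> ?I" for y t
      using U0n[OF xD(1)[OF that(1)] \<tau>s[OF that(2)]] xD(2)[OF that(1)] by (simp add: U_def u_def)
    have False if z: "z \<in> unit_square" and p: "p \<in> grid_lines N \<times> ?I" and eq: "G z = U p" for z p
    proof -
      have "fst p \<in> grid_lines N" "snd p \<in> ?I" using p by (auto simp: mem_Times_iff)
      then have in0: "(x (fst p), \<tau> (snd p)) \<in> D \<times> {-1..2}" using xD(1) \<tau>s by blast
      have "\<sigma> (snd (G0 z)) = \<sigma> (snd (U0 (x (fst p), \<tau> (snd p))))" using eq by (simp add: G_def U_def)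
      then have "snd (G0 z) = snd (U0 (x (fst p), \<tau> (snd p)))" by (metis \<sigma>\<tau>(2))
      then have "G0 z = U0 (x (fst p), \<tau> (snd p))" using eq by (simp add: G_def U_def prod_eq_iff)
      then show False using dis z in0 by blast
    qed
    then show "G ` unit_square \<inter> U ` (grid_lines N \<times> ?I) = {}" by blast
  qed
qed

section \<open>Whiskers at the vertices of a grid\<close>

text \<open>
  Applied to two equal constant maps, the Disjoint Arcs Property shows that \<open>X\<close> has no isolated points;
  compactness of \<open>P\<close> makes the distance to a nearby second point uniform. This second point will be the
  tip of a whisker.
\<close>

lemma uniform_escape:
  fixes X :: "'a::metric_space set"
  assumes dap: "disjoint_arcs_property X" and P: "compact P" "P \<subseteq> X" and d: "\<delta> > 0"
  obtains \<eta> where "\<eta> > 0" "\<And>p. p \<in> P \<Longrightarrow> \<exists>q\<in>X. \<eta> \<le> dist p q \<and> dist p q < \<delta>"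
proof -
  have "\<exists>q\<in>X. q \<noteq> p \<and> dist p q < \<delta> / 2" if p: "p \<in> P" for p
  proof -
    have c: "map_into unit_interval X (\<lambda>_. p)" using p P(2) by (auto simp: map_into_def)
    have "\<delta> / 2 > 0" using d by simp
    then obtain g1 g2 where g: "map_into unit_interval X g1" "map_into unit_interval X g2"
      "unif_dist unit_interval (\<lambda>_. p) g1 < \<delta> / 2" "unif_dist unit_interval (\<lambda>_. p) g2 < \<delta> / 2"
      "g1 ` unit_interval \<inter> g2 ` unit_interval = {}"
      using dap c unfolding disjoint_arcs_property_def by metis
    have "dist p (g1 0) < \<delta> / 2" "dist p (g2 0) < \<delta> / 2"
      using unif_dist_lessD[OF g(3) compact_Icc map_intoD(1)[OF c] map_intoD(1)[OF g(1)], of 0]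
        unif_dist_lessD[OF g(4) compact_Icc map_intoD(1)[OF c] map_intoD(1)[OF g(2)], of 0] by auto
    moreover have "g1 0 \<in> X" "g2 0 \<in> X" using map_intoD(2)[OF g(1), of 0] map_intoD(2)[OF g(2), of 0] by auto
    moreover have "g1 0 \<noteq> g2 0" using g(5) by (metis IntI atLeastAtMost_iff emptyE imageI order_refl zero_le_one)
    ultimately show ?thesis by metis
  qed
  then obtain q where q: "\<And>p. p \<in> P \<Longrightarrow> q p \<in> X \<and> q p \<noteq> p \<and> dist p (q p) < \<delta> / 2" by metis
  let ?r = "\<lambda>p. dist p (q p) / 2"
  have "P \<subseteq> (\<Union>p\<in>P. ball p (?r p))" using q by fastforce
  then obtain C where C: "C \<subseteq> P" "finite C" "P \<subseteq> (\<Union>p\<in>C. ball p (?r p))"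
    using compactE_image[OF P(1), of P "\<lambda>p. ball p (?r p)"] by auto
  define \<eta> where "\<eta> = Min (insert 1 (?r ` C))"
  show thesis
  proof (rule that[of \<eta>])
    have "?r p > 0" if "p \<in> C" for p using q[of p] C(1) that by auto
    then show "\<eta> > 0" using C(2) by (simp add: \<eta>_def)
    fix p' assume "p' \<in> P"
    then obtain p where p: "p \<in> C" "dist p p' < ?r p" using C(3) by (auto simp: subset_iff)
    have "\<eta> \<le> ?r p" unfolding \<eta>_def using C(2) p(1) by (intro Min_le) auto
    then have "\<eta> \<le> dist p' (q p)" using p(2) dist_triangle[of p "q p" p'] by linarith
    moreover have "dist p' (q p) < \<delta>"
      using p q[OF subsetD[OF C(1) p(1)]] dist_triangle3[of p' "q p" p] zero_le_dist[of p p'] by linarith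
    ultimately show "\<exists>q\<in>X. \<eta> \<le> dist p' q \<and> dist p' q < \<delta>" using q p(1) C(1) by blast
  qed
qed

text \<open>
  The whisker at a grid vertex is a segment in a third coordinate. A map on this set is a map of the square
  together with an arc in the target that starts at the image of each vertex.
\<close>

definition whiskered_square :: "nat \<Rightarrow> ((real \<times> real) \<times> real) set"
  where "whiskered_square N = unit_square \<times> {0} \<union> grid_vertices N \<times> unit_interval"

definition whiskered_grid :: "nat \<Rightarrow> ((real \<times> real) \<times> real) set"
  where "whiskered_grid N = grid_lines N \<times> {0} \<union> grid_vertices N \<times> unit_interval"

lemma whiskered_grid_subset: "whiskered_grid N \<subseteq> whiskered_square N"
  using grid_lines_subset unfolding whiskered_grid_def whiskered_square_def by blast

lemma compact_whiskered_square: "compact (whiskered_square N)"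
  unfolding whiskered_square_def
  by (intro compact_Un compact_Times compact_Icc finite_imp_compact finite_grid_vertices) auto

lemma grid_vertices_apart:
  assumes "v \<in> grid_vertices N" "v' \<in> grid_vertices N" "v \<noteq> v'" "N > 0"
  shows "1 / real N \<le> \<bar>fst v - fst v'\<bar> \<or> 1 / real N \<le> \<bar>snd v - snd v'\<bar>"
proof -
  obtain k l k' l' where v: "v = (real k / real N, real l / real N)" "v' = (real k' / real N, real l' / real N)"
    using assms(1,2) unfolding grid_vertices_def by auto
  have *: "1 / real N \<le> \<bar>real m / real N - real m' / real N\<bar>" if "m \<noteq> m'" for m m'
  proof -
    have "1 \<le> \<bar>real m - real m'\<bar>" using that by linarith
    then have "1 / real N \<le> \<bar>real m - real m'\<bar> / real N" by (intro divide_right_mono) auto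
    also have "\<dots> = \<bar>real m / real N - real m' / real N\<bar>" by (simp add: abs_divide flip: diff_divide_distrib)
    finally show ?thesis .
  qed
  have "k \<noteq> k' \<or> l \<noteq> l'" using assms(3) v by auto
  then show ?thesis using * v by auto
qed

text \<open>
  The map \<open>\<zeta>\<close> describes, with the height \<open>s\<close> as time, a motion of the square that slides each vertex
  \<open>v\<close> along its whisker so that it is at the position \<open>tt i v\<close> while the height is near \<open>l i\<close>, pulling a
  small neighbourhood of \<open>v\<close> behind it. That neighbourhood is collapsed to \<open>v\<close>, so its points pass
  through points of the whisker only.
\<close>

lemma whisker_motion:
  fixes A :: "(real \<times> real) \<times> real \<Rightarrow> 'a::metric_space" and l :: "'i \<Rightarrow> real" and tt :: "'i \<Rightarrow> real \<times> real \<Rightarrow> real"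
  assumes N: "N > 0" and A: "map_into (whiskered_square N) X A" and I: "finite I" and \<rho>: "\<rho> > 0"
    and sep: "\<And>i j. i \<in> I \<Longrightarrow> j \<in> I \<Longrightarrow> i \<noteq> j \<Longrightarrow> 4 * \<rho> \<le> \<bar>l i - l j\<bar>"
    and tt: "\<And>i v. tt i v \<in> unit_interval"
  obtains \<zeta> where "continuous_on (unit_square \<times> UNIV) \<zeta>"
    "\<And>y s. y \<in> unit_square \<Longrightarrow> \<exists>p\<in>whiskered_square N. fst p = collapse2 N y \<and> \<zeta> (y, s) = A p"
    "\<And>y s. y \<in> grid_lines N \<Longrightarrow> \<exists>p\<in>whiskered_grid N. \<zeta> (y, s) = A p"
    "\<And>i y s. i \<in> I \<Longrightarrow> \<bar>s - l i\<bar> \<le> \<rho> \<Longrightarrow> \<zeta> (y, s) = \<zeta> (y, l i)"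
    "\<And>i v. i \<in> I \<Longrightarrow> v \<in> grid_vertices N \<Longrightarrow> \<zeta> (v, l i) = A (v, tt i v)"
    "\<And>i y. i \<in> I \<Longrightarrow> (\<And>v. tt i v = 0) \<Longrightarrow> \<zeta> (y, l i) = A (collapse2 N y, 0)"
proof -
  \<comment> \<open>The trapezoidal functions are \<open>1\<close> within \<open>\<rho>\<close> of \<open>l i\<close> and \<open>0\<close> beyond \<open>2 * \<rho>\<close>; the separation
    by \<open>4 * \<rho>\<close> prevents them from interfering. The supports of the bumps are the squares that collapse to a vertex.\<close>
  define \<tau> where "\<tau> v s = (\<Sum>i\<in>I. tt i v * max 0 (min 1 (2 - \<bar>s - l i\<bar> / \<rho>)))" for v s
  define bump where "bump v y = max 0 (1 - 4 * real N * \<bar>fst y - fst v\<bar>) * max 0 (1 - 4 * real N * \<bar>snd y - snd v\<bar>)"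
    for v y :: "real \<times> real"
  define h where "h y s = min 1 (\<Sum>v\<in>grid_vertices N. \<tau> v s * bump v y)" for y s
  define \<zeta> where "\<zeta> p = A (collapse2 N (fst p), h (fst p) (snd p))" for p
  have \<tau>0: "0 \<le> \<tau> v s" for v s unfolding \<tau>_def using tt by (intro sum_nonneg mult_nonneg_nonneg) auto
  have bump0: "0 \<le> bump v y" for v y by (simp add: bump_def)
  have "0 \<le> (\<Sum>v\<in>grid_vertices N. \<tau> v s * bump v y)" for y s
    by (intro sum_nonneg mult_nonneg_nonneg \<tau>0 bump0)
  then have h01: "0 \<le> h y s" "h y s \<le> 1" for y s
    by (simp_all add: h_def)
  have \<tau>l: "\<tau> v s = tt i v" if i: "i \<in> I" "\<bar>s - l i\<bar> \<le> \<rho>" for i v s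
  proof -
    have "\<bar>s - l i\<bar> / \<rho> \<le> 1" using i(2) \<rho> by simp
    then have 1: "max 0 (min 1 (2 - \<bar>s - l i\<bar> / \<rho>)) = 1" by simp
    have "max 0 (min 1 (2 - \<bar>s - l j\<bar> / \<rho>)) = 0" if "j \<in> I - {i}" for j
    proof -
      have "2 * \<rho> \<le> \<bar>s - l j\<bar>" using sep[OF i(1), of j] that i(2) by auto
      then have "2 \<le> \<bar>s - l j\<bar> / \<rho>" using \<rho> by (simp add: le_divide_eq)
      then show ?thesis by simp
    qed
    then have "(\<Sum>j\<in>I - {i}. tt j v * max 0 (min 1 (2 - \<bar>s - l j\<bar> / \<rho>))) = 0"
      by (intro sum.neutral) simp
    then show ?thesis unfolding \<tau>_def sum.remove[OF I i(1)] 1 by simp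
  qed
  have hl: "h y s = min 1 (\<Sum>v\<in>grid_vertices N. tt i v * bump v y)" if "i \<in> I" "\<bar>s - l i\<bar> \<le> \<rho>" for i y s
    unfolding h_def \<tau>l[OF that] ..
  have whisker: "collapse2 N y \<in> grid_vertices N" if y: "y \<in> unit_square" and h: "h y s \<noteq> 0" for y s
  proof -
    have "(\<Sum>v\<in>grid_vertices N. \<tau> v s * bump v y) \<noteq> 0" using h by (auto simp: h_def)
    then obtain v where v: "v \<in> grid_vertices N" "\<tau> v s * bump v y \<noteq> 0" by (meson sum.neutral)
    have "4 * real N * \<bar>fst y - fst v\<bar> < 1" "4 * real N * \<bar>snd y - snd v\<bar> < 1"
      using v(2) by (auto simp: bump_def max_def split: if_splits)
    then have "\<bar>fst y - fst v\<bar> < 1 / (4 * real N)" "\<bar>snd y - snd v\<bar> < 1 / (4 * real N)"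
      using N by (simp_all add: less_divide_eq mult.commute)
    then have "collapse2 N y = v" by (rule collapse2_near_vertex[OF v(1) y N])
    then show ?thesis using v(1) by simp
  qed
  have inK: "(collapse2 N y, h y s) \<in> whiskered_square N" if y: "y \<in> unit_square" for y s
    using whisker[OF y] collapse2_in_square[OF y N] h01[of y s]
    by (cases "h y s = 0") (auto simp: whiskered_square_def)
  have inT: "(collapse2 N y, h y s) \<in> whiskered_grid N" if y: "y \<in> grid_lines N" for y s
    using whisker[of y s] collapse2_grid_lines[OF y N] h01[of y s] y grid_lines_subset
    by (cases "h y s = 0") (auto simp: whiskered_grid_def)
  show thesis
  proof (rule that[of \<zeta>])
    have "continuous_on (unit_square \<times> UNIV) (\<lambda>p. h (fst p) (snd p))"
      unfolding h_def \<tau>_def bump_def by (intro continuous_intros) (use \<rho> in auto)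
    then show "continuous_on (unit_square \<times> UNIV) \<zeta>"
      unfolding \<zeta>_def
      by (intro continuous_on_compose2[OF map_intoD(1)[OF A]] continuous_on_Pair continuous_intros)
        (use inK in auto)
    show "\<exists>p\<in>whiskered_square N. fst p = collapse2 N y \<and> \<zeta> (y, s) = A p" if "y \<in> unit_square" for y s
      using inK[OF that] by (intro bexI[of _ "(collapse2 N y, h y s)"]) (auto simp: \<zeta>_def)
    show "\<exists>p\<in>whiskered_grid N. \<zeta> (y, s) = A p" if "y \<in> grid_lines N" for y s
      using inT[OF that] by (intro bexI[of _ "(collapse2 N y, h y s)"]) (auto simp: \<zeta>_def)
    have ll: "\<bar>l i - l i\<bar> \<le> \<rho>" for i using \<rho> by simp
    show "\<zeta> (y, s) = \<zeta> (y, l i)" if "i \<in> I" "\<bar>s - l i\<bar> \<le> \<rho>" for i y s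
      using hl[OF that] hl[OF that(1) ll] by (simp add: \<zeta>_def)
    show "\<zeta> (v, l i) = A (v, tt i v)" if i: "i \<in> I" and v: "v \<in> grid_vertices N" for i v
    proof -
      have "bump v' v = 0" if "v' \<in> grid_vertices N - {v}" for v'
      proof -
        have "1 / real N \<le> \<bar>fst v - fst v'\<bar> \<or> 1 / real N \<le> \<bar>snd v - snd v'\<bar>"
          using grid_vertices_apart[OF v, of v'] that N by auto
        then have "1 \<le> real N * \<bar>fst v - fst v'\<bar> \<or> 1 \<le> real N * \<bar>snd v - snd v'\<bar>"
          using N by (auto simp: divide_le_eq mult.commute)
        then have "1 \<le> 4 * real N * \<bar>fst v - fst v'\<bar> \<or> 1 \<le> 4 * real N * \<bar>snd v - snd v'\<bar>"
          unfolding mult.assoc by linarith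
        then show ?thesis by (auto simp: bump_def)
      qed
      then have "(\<Sum>v'\<in>grid_vertices N - {v}. tt i v' * bump v' v) = 0" by (intro sum.neutral) simp
      moreover have "bump v v = 1" by (simp add: bump_def)
      ultimately have "(\<Sum>v'\<in>grid_vertices N. tt i v' * bump v' v) = tt i v"
        using sum.remove[OF finite_grid_vertices v, of "\<lambda>v'. tt i v' * bump v' v"] by simp
      then have "h v (l i) = tt i v" using hl[OF i ll] tt[of i v] by simp
      moreover have "v \<in> unit_square" using v grid_vertices_subset grid_lines_subset by blast
      then have "collapse2 N v = v" using collapse2_near_vertex[OF v _ N, of v] N by simp
      ultimately show ?thesis by (simp add: \<zeta>_def)
    qed
    show "\<zeta> (y, l i) = A (collapse2 N y, 0)" if "i \<in> I" "\<And>v. tt i v = 0" for i y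
      using hl[OF that(1) ll] that(2) by (simp add: \<zeta>_def)
  qed
qed

lemma fine_grid:
  fixes f :: "real \<times> real \<Rightarrow> 'b::metric_space"
  assumes "continuous_on unit_square f" "e > 0"
  obtains n where "\<And>N q z z'. n \<le> N \<Longrightarrow> q \<in> cells N \<Longrightarrow> z \<in> unit_square \<Longrightarrow> z' \<in> unit_square \<Longrightarrow>
    dist (f (cell_map N q z)) (f (cell_map N q z')) < e"
proof -
  have "uniformly_continuous_on unit_square f"
    by (intro compact_uniformly_continuous assms compact_Times compact_Icc)
  then obtain d where d: "d > 0" "\<forall>x\<in>unit_square. \<forall>x'\<in>unit_square. dist x' x < d \<longrightarrow> dist (f x') (f x) < e"
    unfolding uniformly_continuous_on_def using assms(2) by blast
  obtain n where n: "2 / d < real n" using reals_Archimedean2 by blast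
  show thesis
  proof (rule that[of n])
    fix N q z z' assume a: "n \<le> N" "q \<in> cells N" "z \<in> unit_square" "z' \<in> unit_square"
    have N: "N > 0" using a(2) by (auto simp: cells_def)
    have "2 / d < real N" using n a(1) by linarith
    then have "2 / real N < d" using d(1) N by (simp add: divide_less_eq mult.commute)
    then have "dist (cell_map N q z) (cell_map N q z') < d"
      using dist_cell_map[OF a(3,4) N, of q] by simp
    then show "dist (f (cell_map N q z)) (f (cell_map N q z')) < e"
      using d(2) cell_map_in_square[OF a(2)] a(3,4) by blast
  qed
qed

text \<open>
  The length \<open>\<eta>\<close> of the whiskers depends only on the images of the given maps, so the grid can be chosen
  afterwards, with cells whose images are small compared with \<open>\<eta>\<close>; this is why the image of a
  cell never contains both ends of a whisker. The Disjoint Arcs Property then separates the whiskered grids of the two maps, by a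
  perturbation too small to affect this.
\<close>

lemma whiskers_in_general_position:
  fixes a :: "bool \<Rightarrow> real \<times> real \<Rightarrow> 'a::metric_space" and b :: "bool \<Rightarrow> real \<times> real \<Rightarrow> real"
  assumes dap: "disjoint_arcs_property X" and lb: "locally_blending X lam"
    and a: "\<And>i. map_into unit_square X (a i)" and b: "\<And>i. continuous_on unit_square (b i)" and e: "e > 0"
  obtains N A m where "N > 0" "m > 0" "\<And>i. map_into (whiskered_square N) X (A i)"
    "\<And>x y. x \<in> whiskered_grid N \<Longrightarrow> y \<in> whiskered_grid N \<Longrightarrow> m \<le> dist (A True x) (A False y)"
    "\<And>i j v q. v \<in> grid_vertices N \<Longrightarrow> q \<in> cells N \<Longrightarrow>
       \<exists>t\<in>{0, 1}. A j (v, t) \<notin> (\<lambda>z. A i (cell_map N q z, 0)) ` unit_square"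
    "\<And>i p. p \<in> whiskered_square N \<Longrightarrow> dist (a i (fst p)) (A i p) < 2 * e"
    "\<And>i q z z'. q \<in> cells N \<Longrightarrow> z \<in> unit_square \<Longrightarrow> z' \<in> unit_square \<Longrightarrow>
       dist (a i (cell_map N q z)) (a i (cell_map N q z')) < e \<and> dist (b i (cell_map N q z)) (b i (cell_map N q z')) < e"
proof -
  have sq: "compact unit_square" by (intro compact_Times compact_Icc)
  let ?P = "a True ` unit_square \<union> a False ` unit_square"
  have P: "compact ?P" "?P \<subseteq> X"
    using map_into_compact_image[OF a sq] map_intoD(3)[OF a] by (simp_all add: compact_Un)
  have aP: "a i z \<in> ?P" if "z \<in> unit_square" for i z using that by (cases i) auto
  obtain d where d: "d > 0" "d \<le> e" "blends_within X lam ?P e d"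
    using locally_blendingE[OF lb P e] .
  note B = blends_withinD[OF d(3)]
  obtain \<eta> where \<eta>: "\<eta> > 0" "\<And>p. p \<in> ?P \<Longrightarrow> \<exists>q\<in>X. \<eta> \<le> dist p q \<and> dist p q < d"
    using uniform_escape[OF dap P d(1)] by metis
  then obtain tip where tip: "\<And>p. p \<in> ?P \<Longrightarrow> tip p \<in> X \<and> \<eta> \<le> dist p (tip p) \<and> dist p (tip p) < d" by metis
  define e1 where "e1 = min e (\<eta> / 4)"
  have e1: "e1 > 0" "e1 \<le> e" "e1 \<le> \<eta> / 4" using e \<eta>(1) by (auto simp: e1_def)
  have "\<exists>n. \<forall>N q z z'. n \<le> N \<longrightarrow> q \<in> cells N \<longrightarrow> z \<in> unit_square \<longrightarrow> z' \<in> unit_square \<longrightarrow>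
    dist (a i (cell_map N q z)) (a i (cell_map N q z')) < e1" for i
    by (rule fine_grid[OF map_intoD(1)[OF a[of i]] e1(1)]) blast
  then obtain na where na: "\<And>i N q z z'. na i \<le> N \<Longrightarrow> q \<in> cells N \<Longrightarrow> z \<in> unit_square \<Longrightarrow> z' \<in> unit_square \<Longrightarrow>
    dist (a i (cell_map N q z)) (a i (cell_map N q z')) < e1" by metis
  have "\<exists>n. \<forall>N q z z'. n \<le> N \<longrightarrow> q \<in> cells N \<longrightarrow> z \<in> unit_square \<longrightarrow> z' \<in> unit_square \<longrightarrow>
    dist (b i (cell_map N q z)) (b i (cell_map N q z')) < e" for i
    by (rule fine_grid[OF b[of i] e]) blast
  then obtain nb where nb: "\<And>i N q z z'. nb i \<le> N \<Longrightarrow> q \<in> cells N \<Longrightarrow> z \<in> unit_square \<Longrightarrow> z' \<in> unit_square \<Longrightarrow>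
    dist (b i (cell_map N q z)) (b i (cell_map N q z')) < e" by metis
  define N where "N = 1 + na True + na False + nb True + nb False"
  have N: "N > 0" "na i \<le> N" "nb i \<le> N" for i by (cases i; simp add: N_def)+
  let ?V = "grid_vertices N" and ?K = "whiskered_square N"
  have V: "v \<in> unit_square" if "v \<in> ?V" for v using that grid_vertices_subset grid_lines_subset by blast
  define A0 where "A0 i p = (if fst p \<in> ?V then lam (a i (fst p)) (tip (a i (fst p))) (snd p) else a i (fst p))" for i p
  have near: "a i z \<in> ?P" "tip (a i z) \<in> X" "dist (a i z) (tip (a i z)) < d" if "z \<in> unit_square" for i z
    using aP[OF that] tip by blast+
  have A00: "A0 i (z, 0) = a i z" if "z \<in> unit_square" for i z
    using B(1)[OF near[OF that]] by (simp add: A0_def)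
  have A01: "A0 i (v, 1) = tip (a i v)" if "v \<in> ?V" for i v
    using B(2)[OF near[OF V[OF that]]] that by (simp add: A0_def)
  have A0w: "A0 i p \<in> X \<and> dist (a i (fst p)) (A0 i p) < e" if "p \<in> ?K" for i p
  proof (cases "fst p \<in> ?V")
    case True
    then have "0 \<le> snd p" "snd p \<le> 1" using \<open>p \<in> ?K\<close> by (auto simp: whiskered_square_def)
    then show ?thesis using B(3,4)[OF near[OF V[OF True]]] True by (simp add: A0_def dist_commute)
  next
    case False
    then have "fst p \<in> unit_square" using \<open>p \<in> ?K\<close> by (auto simp: whiskered_square_def)
    then show ?thesis using False e map_intoD(2)[OF a] by (simp add: A0_def)
  qed
  have A0m: "map_into ?K X (A0 i)" for i
    unfolding map_into_def
  proof (intro conjI Pi_I)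
    have 1: "continuous_on (unit_square \<times> {0}) (A0 i)"
    proof (rule continuous_on_eq)
      show "continuous_on (unit_square \<times> {0::real}) (\<lambda>p. a i (fst p))"
        by (rule continuous_on_compose2[OF map_intoD(1)[OF a]]) (auto intro: continuous_intros)
      show "a i (fst p) = A0 i p" if "p \<in> unit_square \<times> {0}" for p
        using that A00[of "fst p" i] by (cases p) auto
    qed
    have 2: "continuous_on (\<Union>v\<in>?V. {v} \<times> unit_interval) (A0 i)"
    proof (rule continuous_on_closed_Union[OF finite_grid_vertices])
      fix v assume v: "v \<in> ?V"
      show "closed ({v} \<times> unit_interval)" by (intro closed_Times) auto
      show "continuous_on ({v} \<times> unit_interval) (A0 i)"
      proof (rule continuous_on_eq)
        show "continuous_on ({v} \<times> unit_interval) (\<lambda>p. lam (a i v) (tip (a i v)) (snd p))"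
          by (rule blends_within_continuous[OF d(3)]) (use near[OF V[OF v]] in \<open>auto intro: continuous_intros\<close>)
      qed (use v in \<open>auto simp: A0_def\<close>)
    qed
    have "?K = unit_square \<times> {0} \<union> (\<Union>v\<in>?V. {v} \<times> unit_interval)"
      by (auto simp: whiskered_square_def)
    moreover have "closed (\<Union>v\<in>?V. {v} \<times> unit_interval)"
      by (intro closed_UN finite_grid_vertices ballI closed_Times) auto
    moreover have "closed (unit_square \<times> {0::real})" by (intro closed_Times) auto
    ultimately show "continuous_on ?K (A0 i)" using continuous_on_closed_Un[OF _ _ 1 2] by simp
    show "A0 i p \<in> X" if "p \<in> ?K" for p using A0w[OF that] by blast
  qed
  define segs where "segs = (\<lambda>s. ((fst s, 0::real), (snd s, 0::real))) ` grid_segments N \<union> (\<lambda>v. ((v, 0), (v, 1))) ` ?V"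
  have seg1: "closed_segment (p, 0::real) (q, 0) = closed_segment p q \<times> {0}" for p q :: "real \<times> real"
    by (auto simp: closed_segment_def scaleR_prod_def prod_eq_iff)
  have seg2: "closed_segment (v, 0::real) (v, 1) = {v} \<times> unit_interval" for v :: "real \<times> real"
    by (auto simp: closed_segment_def scaleR_prod_def prod_eq_iff algebra_simps)
  have segs_Un: "(\<Union>s\<in>segs. segment_of s) = whiskered_grid N"
    unfolding segs_def whiskered_grid_def grid_lines_eq by (auto simp: seg1 seg2)
  have segs: "fst s \<noteq> snd s \<and> segment_of s \<subseteq> ?K" if "s \<in> segs" for s
  proof
    show "segment_of s \<subseteq> ?K" using segs_Un that whiskered_grid_subset by blast
    show "fst s \<noteq> snd s"
      using that unfolding segs_def
      by (elim UnE imageE) (simp_all add: grid_segments_nondegenerate del: split_paired_All)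
  qed
  have fin: "finite (segs \<times> segs)" by (simp add: segs_def finite_grid_segments finite_grid_vertices)
  have "\<eta> / 8 > 0" using \<eta>(1) by simp
  then have pos: "min e (\<eta> / 8) > 0" using e by simp
  have segs2: "fst s \<noteq> snd s \<and> fst t \<noteq> snd t \<and> segment_of s \<subseteq> ?K \<and> segment_of t \<subseteq> ?K"
    if "(s, t) \<in> segs \<times> segs" for s t
    using that segs by blast
  obtain a' b' m where A': "map_into ?K X a'" "map_into ?K X b'" "m > 0"
    "\<And>x. x \<in> ?K \<Longrightarrow> dist (A0 True x) (a' x) < min e (\<eta> / 8)" "\<And>x. x \<in> ?K \<Longrightarrow> dist (A0 False x) (b' x) < min e (\<eta> / 8)"
    and gap: "\<And>s t x y. (s, t) \<in> segs \<times> segs \<Longrightarrow> x \<in> segment_of s \<Longrightarrow> y \<in> segment_of t \<Longrightarrow> m \<le> dist (a' x) (b' y)"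
  proof (rule disjoint_on_segments[OF dap lb compact_whiskered_square fin _ A0m[of True] A0m[of False] pos], goal_cases)
    case (1 s t)
    show ?case by (rule segs2[OF 1(2)])
  next
    case (2 a' b' m)
    show ?case by (rule 2(1)[OF 2(2-7)])
  qed
  define A where "A i = (if i then a' else b')" for i
  have An: "dist (A0 i x) (A i x) < min e (\<eta> / 8)" if "x \<in> ?K" for i x
    using A'(4,5)[OF that] by (simp add: A_def)
  show thesis
  proof (rule that[of N m A])
    show "N > 0" "m > 0" using N(1) A'(3) by auto
    show "map_into ?K X (A i)" for i using A'(1,2) by (simp add: A_def)
    show "m \<le> dist (A True x) (A False y)" if xy: "x \<in> whiskered_grid N" "y \<in> whiskered_grid N" for x y
    proof -
      obtain s t where "s \<in> segs" "x \<in> segment_of s" "t \<in> segs" "y \<in> segment_of t"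
        using xy unfolding segs_Un[symmetric] by blast
      then show ?thesis using gap[of s t x y] by (simp add: A_def)
    qed
    show "dist (a i (fst p)) (A i p) < 2 * e" if "p \<in> ?K" for i p
      using A0w[OF that, of i] An[OF that, of i] dist_triangle[of "a i (fst p)" "A i p" "A0 i p"] by simp
    show "dist (a i (cell_map N q z)) (a i (cell_map N q z')) < e \<and> dist (b i (cell_map N q z)) (b i (cell_map N q z')) < e"
      if "q \<in> cells N" "z \<in> unit_square" "z' \<in> unit_square" for i q z z'
      using na[OF N(2) that, of i] nb[OF N(3) that, of i] e1(2) by simp
    show "\<exists>t\<in>{0, 1}. A j (v, t) \<notin> (\<lambda>z. A i (cell_map N q z, 0)) ` unit_square"
      if v: "v \<in> ?V" and q: "q \<in> cells N" for i j v q
    proof (rule ccontr)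
      assume "\<not> ?thesis"
      then obtain z0 z1 where z: "z0 \<in> unit_square" "A j (v, 0) = A i (cell_map N q z0, 0)"
        "z1 \<in> unit_square" "A j (v, 1) = A i (cell_map N q z1, 0)" by auto
      have c: "cell_map N q z0 \<in> unit_square" "cell_map N q z1 \<in> unit_square"
        using cell_map_in_square[OF q] z by blast+
      have K: "(v, 0) \<in> ?K" "(v, 1) \<in> ?K" "(cell_map N q z0, 0) \<in> ?K" "(cell_map N q z1, 0) \<in> ?K"
        using v c by (auto simp: whiskered_square_def)
      have "\<eta> \<le> dist (A0 j (v, 0)) (A0 j (v, 1))"
        using A00[OF V[OF v]] A01[OF v] tip[OF aP[OF V[OF v]]] by simp
      moreover have "dist (A0 i (cell_map N q z0, 0)) (A0 i (cell_map N q z1, 0)) < \<eta> / 4"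
        using na[OF N(2) q z(1,3), of i] A00 c e1(3) by simp
      moreover have "dist (A0 j (v, 0)) (A0 j (v, 1)) \<le> dist (A0 j (v, 0)) (A j (v, 0)) +
          dist (A0 i (cell_map N q z0, 0)) (A i (cell_map N q z0, 0)) +
          dist (A0 i (cell_map N q z0, 0)) (A0 i (cell_map N q z1, 0)) +
          dist (A0 i (cell_map N q z1, 0)) (A i (cell_map N q z1, 0)) + dist (A0 j (v, 1)) (A j (v, 1))"
        using dist_triangle[of "A0 j (v, 0)" "A0 j (v, 1)" "A j (v, 0)"]
          dist_triangle[of "A j (v, 0)" "A0 j (v, 1)" "A0 i (cell_map N q z0, 0)"]
          dist_triangle[of "A0 i (cell_map N q z0, 0)" "A0 j (v, 1)" "A0 i (cell_map N q z1, 0)"]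
          dist_triangle[of "A0 i (cell_map N q z1, 0)" "A0 j (v, 1)" "A j (v, 1)"]
        unfolding z(2,4) by (simp add: dist_commute)
      ultimately show False using An[OF K(1), of j] An[OF K(2), of j] An[OF K(3), of i] An[OF K(4), of i] \<eta>(1) by simp
    qed
  qed
qed

section \<open>From disjoint path concordances to disjoint disks\<close>

lemma separated_perturbation:
  fixes r :: "'i \<Rightarrow> real"
  assumes "finite I" "e > 0"
  obtains l \<rho> where "0 < \<rho>" "\<rho> \<le> e" "\<And>i. i \<in> I \<Longrightarrow> \<bar>l i - r i\<bar> < e"
    "\<And>i j. i \<in> I \<Longrightarrow> j \<in> I \<Longrightarrow> i \<noteq> j \<Longrightarrow> 4 * \<rho> \<le> \<bar>l i - l j\<bar>"
proof -
  have "\<exists>l \<rho>. 0 < \<rho> \<and> \<rho> \<le> e \<and> (\<forall>i\<in>I. \<bar>l i - r i\<bar> < e) \<and> (\<forall>i\<in>I. \<forall>j\<in>I. i \<noteq> j \<longrightarrow> 4 * \<rho> \<le> \<bar>l i - l j\<bar>)"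
    using assms(1)
  proof induction
    case empty
    then show ?case using assms(2) by auto
  next
    case (insert x I)
    from insert.IH obtain l \<rho> where l': "0 < \<rho> \<and> \<rho> \<le> e \<and> (\<forall>i\<in>I. \<bar>l i - r i\<bar> < e) \<and>
      (\<forall>i\<in>I. \<forall>j\<in>I. i \<noteq> j \<longrightarrow> 4 * \<rho> \<le> \<bar>l i - l j\<bar>)"
      by (elim exE)
    then have l: "0 < \<rho>" "\<rho> \<le> e" "\<And>i. i \<in> I \<Longrightarrow> \<bar>l i - r i\<bar> < e"
      "\<And>i j. i \<in> I \<Longrightarrow> j \<in> I \<Longrightarrow> i \<noteq> j \<Longrightarrow> 4 * \<rho> \<le> \<bar>l i - l j\<bar>"
      by simp_all
    have "infinite {r x <..< r x + e}" using assms(2) by simp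
    then obtain y where y: "y \<in> {r x <..< r x + e}" "y \<notin> l ` I"
      using insert.hyps(1) by (meson finite_imageI finite_subset subsetI)
    obtain d where d: "d > 0" "\<And>z. z \<in> l ` I \<Longrightarrow> d \<le> dist y z"
      using finite_set_avoid[of "l ` I" y] insert.hyps(1) y(2) by (metis finite_imageI)
    define \<rho>' where "\<rho>' = min \<rho> (d / 4)"
    have "4 * \<rho>' \<le> \<bar>(l(x := y)) i - (l(x := y)) j\<bar>" if "i \<in> insert x I" "j \<in> insert x I" "i \<noteq> j" for i j
    proof -
      consider "i = x" "j \<in> I" "j \<noteq> x" | "j = x" "i \<in> I" "i \<noteq> x" | "i \<in> I" "j \<in> I" "i \<noteq> x" "j \<noteq> x"
        using \<open>i \<in> insert x I\<close> \<open>j \<in> insert x I\<close> \<open>i \<noteq> j\<close> by blast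
      then show ?thesis
      proof cases
        case 1
        then show ?thesis using d(2)[of "l j"] by (auto simp: \<rho>'_def dist_real_def)
      next
        case 2
        then show ?thesis using d(2)[of "l i"] by (auto simp: \<rho>'_def dist_real_def abs_minus_commute)
      next
        case 3
        then show ?thesis using l(4)[of i j] that(3) by (auto simp: \<rho>'_def)
      qed
    qed
    moreover have "\<bar>(l(x := y)) i - r i\<bar> < e" if "i \<in> insert x I" for i
      using that y(1) l(3) by auto
    moreover have "0 < \<rho>'" "\<rho>' \<le> e" using l(1,2) d(1) by (auto simp: \<rho>'_def)
    ultimately show ?case by blast
  qed
  then obtain l \<rho> where "0 < \<rho> \<and> \<rho> \<le> e \<and> (\<forall>i\<in>I. \<bar>l i - r i\<bar> < e) \<and>
      (\<forall>i\<in>I. \<forall>j\<in>I. i \<noteq> j \<longrightarrow> 4 * \<rho> \<le> \<bar>l i - l j\<bar>)"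
    by (elim exE)
  then show thesis by (intro that[of \<rho> l]) simp_all
qed

text \<open>
  The two maps are indexed by truth values, so that \<open>\<not> i\<close> is the other map. Over the cell \<open>q\<close> of the map
  \<open>i\<close>, the film \<open>G i q\<close> lies in the slab of heights around \<open>l (i, q)\<close>, where it is disjoint from the
  modified cylinder \<open>U i q\<close> of the other map. Outside all slabs of the other map, the cylinder \<open>\<Psi> i\<close> over the
  grid is vertical up to the sliding of the vertices. In its own slabs the vertices are at rest, so
  that it matches the boundary of its own films.
\<close>

lemma disjoint_path_concordances_imp_disjoint_disks:
  fixes X :: "'a::metric_space set"
  assumes lb: "locally_blending X lam" and dap: "disjoint_arcs_property X"
    and dcp: "disjoint_path_concordances_property X"
  shows "disjoint_disks_property (X \<times> (UNIV :: real set))"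
  unfolding disjoint_disks_property_def
proof (intro allI impI, elim conjE)
  fix f1 f2 :: "real \<times> real \<Rightarrow> 'a \<times> real" and \<epsilon> :: real
  assume f12: "map_into unit_square (X \<times> UNIV) f1" "map_into unit_square (X \<times> UNIV) f2" and "\<epsilon> > 0"
  define f where "f i = (if i then f1 else f2)" for i
  define a where "a i z = fst (f i z)" for i z
  define b where "b i z = snd (f i z)" for i z
  \<comment> \<open>The errors below add up to at most \<open>4 * e\<close> in \<open>X\<close> and \<open>4 * e\<close> in height.\<close>
  define e where "e = \<epsilon> / 16"
  have e: "e > 0" using \<open>\<epsilon> > 0\<close> by (simp add: e_def)
  have f: "map_into unit_square (X \<times> UNIV) (f i)" for i using f12 by (simp add: f_def)
  have a: "map_into unit_square X (a i)" for i
    unfolding map_into_def a_def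
    by (intro conjI Pi_I continuous_intros map_intoD(1)[OF f]) (use map_intoD(2)[OF f] in \<open>auto simp: mem_Times_iff\<close>)
  have b: "continuous_on unit_square (b i)" for i
    unfolding b_def by (intro continuous_intros map_intoD(1)[OF f])
  obtain N A m where N: "N > 0" and m: "m > 0" and A: "\<And>i. map_into (whiskered_square N) X (A i)"
    and gap: "\<And>x y. x \<in> whiskered_grid N \<Longrightarrow> y \<in> whiskered_grid N \<Longrightarrow> m \<le> dist (A True x) (A False y)"
    and esc: "\<And>i j v q. v \<in> grid_vertices N \<Longrightarrow> q \<in> cells N \<Longrightarrow>
       \<exists>t\<in>{0, 1}. A j (v, t) \<notin> (\<lambda>z. A i (cell_map N q z, 0)) ` unit_square"
    and Aa: "\<And>i p. p \<in> whiskered_square N \<Longrightarrow> dist (a i (fst p)) (A i p) < 2 * e"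
    and osc: "\<And>i q z z'. q \<in> cells N \<Longrightarrow> z \<in> unit_square \<Longrightarrow> z' \<in> unit_square \<Longrightarrow>
       dist (a i (cell_map N q z)) (a i (cell_map N q z')) < e \<and> dist (b i (cell_map N q z)) (b i (cell_map N q z')) < e"
  proof (rule whiskers_in_general_position[where a = a and b = b, OF dap lb a b e], goal_cases)
    case (1 N m A)
    show ?case by (rule 1(1)[OF 1(2-8)])
  qed
  have gap': "m \<le> dist (A i x) (A (\<not> i) y)" if "x \<in> whiskered_grid N" "y \<in> whiskered_grid N" for i x y
    using gap[OF that] gap[OF that(2,1)] by (cases i) (auto simp: dist_commute)
  define I where "I = (UNIV :: bool set) \<times> cells N"
  have I: "finite I" by (simp add: I_def finite_cells)
  have inI: "(i, q) \<in> I" if "q \<in> cells N" for i q using that by (simp add: I_def)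
  obtain l \<rho> where \<rho>: "0 < \<rho>" "\<rho> \<le> e" and l: "\<And>k. k \<in> I \<Longrightarrow> \<bar>l k - b (fst k) (cell_map N (snd k) (0, 0))\<bar> < e"
    and sep: "\<And>k k'. k \<in> I \<Longrightarrow> k' \<in> I \<Longrightarrow> k \<noteq> k' \<Longrightarrow> 4 * \<rho> \<le> \<bar>l k - l k'\<bar>"
    using separated_perturbation[OF I e, of "\<lambda>k. b (fst k) (cell_map N (snd k) (0, 0))"] by metis
  define slab where "slab k = {l k - \<rho>..l k + \<rho>}" for k
  have slab_iff: "s \<in> slab k \<longleftrightarrow> \<bar>s - l k\<bar> \<le> \<rho>" for s k by (auto simp: slab_def abs_le_iff)
  have slab_unique: "k = k'" if "k \<in> I" "k' \<in> I" "s \<in> slab k" "s \<in> slab k'" for k k' s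
    using sep[OF that(1,2)] that(3,4) \<rho>(1) unfolding slab_iff by force
  have esc': "\<exists>t. t \<in> {0, 1} \<and> (v \<in> grid_vertices N \<longrightarrow> q \<in> cells N \<longrightarrow> A j (v, t) \<notin> (\<lambda>z. A i (cell_map N q z, 0)) ` unit_square)" for i j v q
    using esc[of v q j i] by blast
  define tt where "tt i j v q = (SOME t. t \<in> {0, 1} \<and> (v \<in> grid_vertices N \<longrightarrow> q \<in> cells N \<longrightarrow>
    A j (v, t) \<notin> (\<lambda>z. A i (cell_map N q z, 0)) ` unit_square))" for i j v q
  have tt: "tt i j v q \<in> {0, 1}"
    "v \<in> grid_vertices N \<Longrightarrow> q \<in> cells N \<Longrightarrow> A j (v, tt i j v q) \<notin> (\<lambda>z. A i (cell_map N q z, 0)) ` unit_square"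
    for i j v q
    using someI_ex[OF esc'[of v q j i]] unfolding tt_def by blast+
  \<comment> \<open>In the slabs of the map \<open>j\<close> itself its vertices stay at the foot of their whiskers; in a slab of the
    other map they go to the end that avoids the cell in question.\<close>
  define T where "T j k v = (if fst k = j then 0 else tt (fst k) j v (snd k))" for j k v
  have T: "T j k v \<in> unit_interval" for j k v using tt(1)[of "fst k" j v "snd k"] by (auto simp: T_def)
  define motion where "motion j \<zeta> \<longleftrightarrow> continuous_on (unit_square \<times> UNIV) \<zeta> \<and>
    (\<forall>y s. y \<in> unit_square \<longrightarrow> (\<exists>p\<in>whiskered_square N. fst p = collapse2 N y \<and> \<zeta> (y, s) = A j p)) \<and>
    (\<forall>y s. y \<in> grid_lines N \<longrightarrow> (\<exists>p\<in>whiskered_grid N. \<zeta> (y, s) = A j p)) \<and>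
    (\<forall>k y s. k \<in> I \<longrightarrow> \<bar>s - l k\<bar> \<le> \<rho> \<longrightarrow> \<zeta> (y, s) = \<zeta> (y, l k)) \<and>
    (\<forall>k v. k \<in> I \<longrightarrow> v \<in> grid_vertices N \<longrightarrow> \<zeta> (v, l k) = A j (v, T j k v)) \<and>
    (\<forall>k y. k \<in> I \<longrightarrow> (\<forall>v. T j k v = 0) \<longrightarrow> \<zeta> (y, l k) = A j (collapse2 N y, 0))"
    for j \<zeta>
  have "\<exists>\<zeta>. motion j \<zeta>" for j
  proof (rule whisker_motion[where l = l and tt = "T j", OF N A[of j] I \<rho>(1) _ T], goal_cases)
    case (1 k k')
    then show ?case by (rule sep)
  next
    case (2 \<zeta>)
    have "motion j \<zeta>"
      unfolding motion_def using 2(1) by (intro conjI allI impI 2(2-6)) blast+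
    then show ?case by (rule exI[of "motion j"])
  qed
  then obtain \<zeta> where motion: "motion j (\<zeta> j)" for j by metis
  have \<zeta>c: "\<And>j. continuous_on (unit_square \<times> UNIV) (\<zeta> j)"
    and \<zeta>K: "\<And>j y s. y \<in> unit_square \<Longrightarrow> \<exists>p\<in>whiskered_square N. fst p = collapse2 N y \<and> \<zeta> j (y, s) = A j p"
    and \<zeta>T: "\<And>j y s. y \<in> grid_lines N \<Longrightarrow> \<exists>p\<in>whiskered_grid N. \<zeta> j (y, s) = A j p"
    and \<zeta>slab: "\<And>j k y s. k \<in> I \<Longrightarrow> \<bar>s - l k\<bar> \<le> \<rho> \<Longrightarrow> \<zeta> j (y, s) = \<zeta> j (y, l k)"
    and \<zeta>v: "\<And>j k v. k \<in> I \<Longrightarrow> v \<in> grid_vertices N \<Longrightarrow> \<zeta> j (v, l k) = A j (v, T j k v)"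
    and \<zeta>0: "\<And>j k y. k \<in> I \<Longrightarrow> (\<And>v. T j k v = 0) \<Longrightarrow> \<zeta> j (y, l k) = A j (collapse2 N y, 0)"
    using motion unfolding motion_def by blast+
  have \<zeta>X: "\<zeta> j (y, s) \<in> X" if "y \<in> unit_square" for j y s
    using \<zeta>K[OF that, of j s] map_intoD(2)[OF A] by metis
  have \<zeta>near: "dist (a j (collapse2 N y)) (\<zeta> j (y, s)) < 2 * e" if "y \<in> unit_square" for j y s
    using \<zeta>K[OF that, of j s] Aa by metis
  have \<zeta>gap: "m \<le> dist (\<zeta> i (y, s)) (\<zeta> (\<not> i) (y', s'))" if "y \<in> grid_lines N" "y' \<in> grid_lines N" for i y y' s s'
    using \<zeta>T[OF that(1), of i s] \<zeta>T[OF that(2), of "\<not> i" s'] gap' by metis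
  have \<zeta>own: "\<zeta> i (y, l (i, q)) = A i (collapse2 N y, 0)" if "q \<in> cells N" for i y q
    using \<zeta>0[OF inI[OF that], of i] by (simp add: T_def)
  define g where "g i q z = A i (collapse2 N (cell_map N q z), 0)" for i q z
  have g: "map_into unit_square X (g i q)" if q: "q \<in> cells N" for i q
    unfolding map_into_def g_def
  proof (intro conjI Pi_I)
    have K: "(collapse2 N (cell_map N q z), 0) \<in> whiskered_square N" if "z \<in> unit_square" for z
      using collapse2_in_square[OF cell_map_in_square[OF q that] N] by (simp add: whiskered_square_def)
    then show "continuous_on unit_square (\<lambda>z. A i (collapse2 N (cell_map N q z), 0))"
      by (intro continuous_on_compose2[OF map_intoD(1)[OF A]] continuous_on_Pair continuous_intros) blast
    show "A i (collapse2 N (cell_map N q z), 0) \<in> X" if "z \<in> unit_square" for z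
      using map_intoD(2)[OF A K[OF that]] .
  qed
  have gnear: "dist (a i (collapse2 N (cell_map N q z))) (g i q z) < 2 * e" if "q \<in> cells N" "z \<in> unit_square" for i q z
    using Aa[of "(collapse2 N (cell_map N q z), 0)" i] collapse2_in_square[OF cell_map_in_square[OF that] N]
    by (simp add: g_def whiskered_square_def)
  \<comment> \<open>Both cylinders stay within \<open>m / 3\<close> of the images of the whiskered grids, which are \<open>m\<close> apart.\<close>
  define e' where "e' = min e (m / 3)"
  have e': "e' > 0" "e' \<le> e" "e' \<le> m / 3" using e m by (auto simp: e'_def)
  define film where "film i q G U \<longleftrightarrow> map_into unit_square (X \<times> slab (i, q)) G \<and>
    map_into (grid_lines N \<times> slab (i, q)) (X \<times> slab (i, q)) U \<and>
    (\<forall>z\<in>square_boundary. G z = (g i q z, l (i, q))) \<and>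
    (\<forall>y t. y \<in> grid_lines N \<longrightarrow> t = l (i, q) - \<rho> \<or> t = l (i, q) + \<rho> \<longrightarrow> U (y, t) = (\<zeta> (\<not> i) (y, l (i, q)), t)) \<and>
    (\<forall>z\<in>unit_square. dist (g i q z) (fst (G z)) < e') \<and>
    (\<forall>y t. y \<in> grid_lines N \<longrightarrow> t \<in> slab (i, q) \<longrightarrow> dist (\<zeta> (\<not> i) (y, l (i, q))) (fst (U (y, t))) < e') \<and>
    G ` unit_square \<inter> U ` (grid_lines N \<times> slab (i, q)) = {}"
    for i q and G :: "real \<times> real \<Rightarrow> 'a \<times> real" and U :: "(real \<times> real) \<times> real \<Rightarrow> 'a \<times> real"
  have "\<exists>G U. q \<in> cells N \<longrightarrow> film i q G U" for i q
  proof (cases "q \<in> cells N")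
    case q: True
    let ?v = "\<lambda>y. \<zeta> (\<not> i) (y, l (i, q))"
    have v: "map_into unit_square X ?v"
      unfolding map_into_def
      by (intro conjI Pi_I \<zeta>X continuous_on_compose2[OF \<zeta>c] continuous_intros) auto
    have lines: "?v ` grid_lines N \<inter> g i q ` square_boundary = {}"
    proof -
      have "m \<le> dist (?v y) (g i q z)" if "y \<in> grid_lines N" "z \<in> square_boundary" for y z
        using \<zeta>gap[OF cell_map_boundary[OF q that(2)] that(1), of i "l (i, q)" "l (i, q)"] \<zeta>own[OF q]
        by (simp add: g_def dist_commute)
      then show ?thesis using m by fastforce
    qed
    have verts: "?v ` grid_vertices N \<inter> g i q ` unit_square = {}"
    proof -
      have "?v v \<noteq> g i q z" if v: "v \<in> grid_vertices N" and z: "z \<in> unit_square" for v z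
      proof -
        obtain z' where "z' \<in> unit_square" "collapse2 N (cell_map N q z) = cell_map N q z'"
          by (rule collapse2_cell[OF q z])
        then have "g i q z \<in> (\<lambda>z. A i (cell_map N q z, 0)) ` unit_square" by (auto simp: g_def)
        then show ?thesis using tt(2)[OF v q, of "\<not> i" i] \<zeta>v[OF inI[OF q] v, of "\<not> i" i] by (auto simp: T_def)
      qed
      then show ?thesis by blast
    qed
    show ?thesis
    proof (rule separate_square_from_grid[OF lb dcp g[OF q] v lines verts e'(1) \<rho>(1), of "l (i, q)"], goal_cases)
      case (1 G U)
      then show ?case unfolding film_def slab_def by blast
    qed
  qed blast
  then have ex_film: "\<exists>p. q \<in> cells N \<longrightarrow> film i q (fst p) (snd p)" for i q by simp
  define G where "G i q = fst (SOME p. q \<in> cells N \<longrightarrow> film i q (fst p) (snd p))" for i q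
  define U where "U i q = snd (SOME p. q \<in> cells N \<longrightarrow> film i q (fst p) (snd p))" for i q
  have film: "film i q (G i q) (U i q)" if "q \<in> cells N" for i q
    using someI_ex[OF ex_film[of q i]] that unfolding G_def U_def by blast
  have Gm: "map_into unit_square (X \<times> slab (i, q)) (G i q)" if "q \<in> cells N" for i q
    using film[OF that] unfolding film_def by blast
  have Um: "map_into (grid_lines N \<times> slab (i, q)) (X \<times> slab (i, q)) (U i q)" if "q \<in> cells N" for i q
    using film[OF that] unfolding film_def by blast
  have Gbd: "G i q z = (g i q z, l (i, q))" if "q \<in> cells N" "z \<in> square_boundary" for i q z
    using film[OF that(1)] that(2) unfolding film_def by blast
  have Uend: "U i q (y, t) = (\<zeta> (\<not> i) (y, l (i, q)), t)"
    if "q \<in> cells N" "y \<in> grid_lines N" "\<bar>t - l (i, q)\<bar> = \<rho>" for i q y t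
  proof -
    have "t = l (i, q) - \<rho> \<or> t = l (i, q) + \<rho>" using that(3) by (auto simp: abs_if split: if_splits)
    then show ?thesis using film[OF that(1), of i] that(2) unfolding film_def by blast
  qed
  have Gn: "dist (g i q z) (fst (G i q z)) < e'" if "q \<in> cells N" "z \<in> unit_square" for i q z
    using film[OF that(1)] that(2) unfolding film_def by blast
  have Un: "dist (\<zeta> (\<not> i) (y, l (i, q))) (fst (U i q (y, t))) < e'"
    if "q \<in> cells N" "y \<in> grid_lines N" "t \<in> slab (i, q)" for i q y t
    using film[OF that(1), of i] that(2,3) unfolding film_def by blast
  have GU: "G i q z \<noteq> U i q (y, t)" if "q \<in> cells N" "z \<in> unit_square" "y \<in> grid_lines N" "t \<in> slab (i, q)" for i q z y t
  proof -
    have "G i q ` unit_square \<inter> U i q ` (grid_lines N \<times> slab (i, q)) = {}"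
      using film[OF that(1), of i] unfolding film_def by blast
    then show ?thesis using that(2-4) by blast
  qed
  define cell where "cell i s = (SOME q. q \<in> cells N \<and> s \<in> slab (i, q))" for i s
  define \<Psi> where "\<Psi> i p = (if \<exists>q\<in>cells N. snd p \<in> slab (\<not> i, q) then U (\<not> i) (cell (\<not> i) (snd p)) p else (\<zeta> i p, snd p))" for i p
  have \<Psi>in: "\<Psi> i (y, s) = U (\<not> i) q (y, s)" if "q \<in> cells N" "s \<in> slab (\<not> i, q)" for i q y s
  proof -
    have "cell (\<not> i) s \<in> cells N \<and> s \<in> slab (\<not> i, cell (\<not> i) s)"
      unfolding cell_def by (rule someI[of _ q]) (use that in simp)
    then have "(\<not> i, cell (\<not> i) s) = (\<not> i, q)" using slab_unique[OF inI inI] that by blast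
    then show ?thesis using that by (auto simp: \<Psi>_def)
  qed
  have \<Psi>out: "\<Psi> i (y, s) = (\<zeta> i (y, s), s)"
    if y: "y \<in> grid_lines N" and s: "\<And>q. q \<in> cells N \<Longrightarrow> \<rho> \<le> \<bar>s - l (\<not> i, q)\<bar>" for i y s
  proof (cases "\<exists>q\<in>cells N. s \<in> slab (\<not> i, q)")
    case True
    then obtain q where q: "q \<in> cells N" "s \<in> slab (\<not> i, q)" by blast
    then have "\<bar>s - l (\<not> i, q)\<bar> = \<rho>" using s[OF q(1)] by (simp add: slab_iff)
    then have "\<Psi> i (y, s) = (\<zeta> i (y, l (\<not> i, q)), s)" using \<Psi>in[OF q] Uend[OF q(1) y, of s "\<not> i"] by simp
    moreover have "\<zeta> i (y, s) = \<zeta> i (y, l (\<not> i, q))" using \<zeta>slab[OF inI[OF q(1)]] q(2) by (simp add: slab_iff)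
    ultimately show ?thesis by simp
  qed (simp add: \<Psi>_def)
  have \<Psi>c: "continuous_on (grid_lines N \<times> UNIV) (\<Psi> i)" for i
  proof -
    let ?S = "{s. \<forall>q\<in>cells N. \<rho> \<le> \<bar>s - l (\<not> i, q)\<bar>}"
    have "?S = (\<Inter>q\<in>cells N. {s. \<rho> \<le> \<bar>s - l (\<not> i, q)\<bar>})" by auto
    moreover have "closed {s. \<rho> \<le> \<bar>s - l (\<not> i, q)\<bar>}" for q by (intro closed_Collect_le continuous_intros)
    ultimately have "closed ?S" by auto
    then have cl1: "closed (grid_lines N \<times> ?S)"
      by (rule closed_Times[OF compact_imp_closed[OF compact_grid_lines]])
    have slabc: "closed (grid_lines N \<times> slab (\<not> i, q))" for q
      unfolding slab_def by (intro closed_Times compact_imp_closed compact_grid_lines compact_Icc)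
    have 1: "continuous_on (grid_lines N \<times> ?S) (\<Psi> i)"
    proof (rule continuous_on_eq)
      have "continuous_on (grid_lines N \<times> ?S) (\<zeta> i)"
        by (rule continuous_on_subset[OF \<zeta>c]) (use grid_lines_subset in blast)
      then show "continuous_on (grid_lines N \<times> ?S) (\<lambda>p. (\<zeta> i p, snd p))" by (intro continuous_intros)
      fix p assume p: "p \<in> grid_lines N \<times> ?S"
      then have "\<Psi> i (fst p, snd p) = (\<zeta> i (fst p, snd p), snd p)" by (intro \<Psi>out) auto
      then show "(\<zeta> i p, snd p) = \<Psi> i p" by simp
    qed
    have 2: "continuous_on (\<Union>q\<in>cells N. grid_lines N \<times> slab (\<not> i, q)) (\<Psi> i)"
    proof (rule continuous_on_closed_Union[OF finite_cells slabc])
      fix q assume q: "q \<in> cells N"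
      show "continuous_on (grid_lines N \<times> slab (\<not> i, q)) (\<Psi> i)"
      proof (rule continuous_on_eq[OF map_intoD(1)[OF Um[OF q]]])
        fix p assume "p \<in> grid_lines N \<times> slab (\<not> i, q)"
        then show "U (\<not> i) q p = \<Psi> i p" using \<Psi>in[OF q, of "snd p" i "fst p"] by (auto simp: mem_Times_iff)
      qed
    qed
    have "grid_lines N \<times> UNIV = (\<Union>q\<in>cells N. grid_lines N \<times> slab (\<not> i, q)) \<union> grid_lines N \<times> ?S"
    proof -
      have "s \<in> ?S \<or> (\<exists>q\<in>cells N. s \<in> slab (\<not> i, q))" for s
        unfolding slab_iff mem_Collect_eq using linear by blast
      then show ?thesis by blast
    qed
    moreover have "closed (\<Union>q\<in>cells N. grid_lines N \<times> slab (\<not> i, q))"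
      by (intro closed_UN finite_cells ballI slabc)
    ultimately show ?thesis using continuous_on_closed_Un[OF _ cl1 2 1] by simp
  qed
  have \<Psi>near: "\<exists>s'. dist (\<zeta> i (y, s')) (fst (\<Psi> i (y, s))) < e'" if y: "y \<in> grid_lines N" for i y s
  proof (cases "\<exists>q\<in>cells N. s \<in> slab (\<not> i, q)")
    case True
    then obtain q where q: "q \<in> cells N" "s \<in> slab (\<not> i, q)" by blast
    show ?thesis using Un[OF q(1) y q(2)] \<Psi>in[OF q] by auto
  next
    case False
    then show ?thesis using e'(1) by (intro exI[of _ s]) (simp add: \<Psi>_def)
  qed
  have \<Psi>slab: "fst (\<Psi> i (y, s)) \<in> X \<and> (snd (\<Psi> i (y, s)) = s \<or> (\<exists>q\<in>cells N. s \<in> slab (\<not> i, q) \<and> snd (\<Psi> i (y, s)) \<in> slab (\<not> i, q)))"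
    if y: "y \<in> grid_lines N" for i y s
  proof (cases "\<exists>q\<in>cells N. s \<in> slab (\<not> i, q)")
    case True
    then obtain q where q: "q \<in> cells N" "s \<in> slab (\<not> i, q)" by blast
    have "U (\<not> i) q (y, s) \<in> X \<times> slab (\<not> i, q)" by (rule map_intoD(2)[OF Um[OF q(1)]]) (use y q(2) in simp)
    then show ?thesis using q \<Psi>in[OF q, of y] by (metis mem_Times_iff)
  next
    case False
    then show ?thesis using \<zeta>X[OF subsetD[OF grid_lines_subset y]] by (simp add: \<Psi>_def)
  qed
  have G\<Psi>: "G i q z \<noteq> \<Psi> (\<not> i) (y, s)" if q: "q \<in> cells N" and z: "z \<in> unit_square" and y: "y \<in> grid_lines N" for i q z y s
  proof
    assume eq: "G i q z = \<Psi> (\<not> i) (y, s)"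
    have lev: "snd (\<Psi> (\<not> i) (y, s)) \<in> slab (i, q)" using map_intoD(2)[OF Gm[OF q] z, of i] eq by (simp add: mem_Times_iff)
    have s: "s \<in> slab (i, q)"
    proof (cases "snd (\<Psi> (\<not> i) (y, s)) = s")
      case True
      then show ?thesis using lev by simp
    next
      case False
      then obtain q' where q': "q' \<in> cells N" "s \<in> slab (i, q')" "snd (\<Psi> (\<not> i) (y, s)) \<in> slab (i, q')"
        using \<Psi>slab[OF y, of "\<not> i" s] by auto
      then show ?thesis using slab_unique[OF inI[OF q'(1)] inI[OF q] q'(3) lev] by simp
    qed
    then have "\<Psi> (\<not> i) (y, s) = U i q (y, s)" using \<Psi>in[OF q, of s "\<not> i" y] by simp
    then show False using GU[OF q z y s] eq by simp
  qed
  have \<Psi>\<Psi>: "\<Psi> True (y, s) \<noteq> \<Psi> False (y', s')" if yy: "y \<in> grid_lines N" "y' \<in> grid_lines N" for y y' s s'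
  proof
    assume eq: "\<Psi> True (y, s) = \<Psi> False (y', s')"
    obtain t t' where "dist (\<zeta> True (y, t)) (fst (\<Psi> True (y, s))) < e'" "dist (\<zeta> False (y', t')) (fst (\<Psi> False (y', s'))) < e'"
      using \<Psi>near[OF yy(1)] \<Psi>near[OF yy(2)] by metis
    moreover have "m \<le> dist (\<zeta> True (y, t)) (\<zeta> False (y', t'))" using \<zeta>gap[OF yy, of True t t'] by simp
    ultimately show False
      using eq e'(3) m dist_triangle2[of "\<zeta> True (y, t)" "\<zeta> False (y', t')" "fst (\<Psi> True (y, s))"] by simp
  qed
  have GG: "G True q z \<noteq> G False q' z'" if "q \<in> cells N" "q' \<in> cells N" "z \<in> unit_square" "z' \<in> unit_square" for q q' z z'
  proof
    assume "G True q z = G False q' z'"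
    then have "snd (G True q z) \<in> slab (True, q)" "snd (G True q z) \<in> slab (False, q')"
      using map_intoD(2)[OF Gm[OF that(1)] that(3), of True] map_intoD(2)[OF Gm[OF that(2)] that(4), of False]
      by (auto simp: mem_Times_iff)
    then show False using slab_unique[OF inI[OF that(1)] inI[OF that(2)]] by blast
  qed
  have "\<exists>F. continuous_on unit_square F \<and> (\<forall>q z. q \<in> cells N \<longrightarrow> z \<in> unit_square \<longrightarrow>
      (\<exists>z'\<in>unit_square. F (cell_map N q z) = G i q z') \<or>
      (\<exists>z'\<in>square_boundary. \<exists>s\<in>closed_segment (l (i, q)) (b i (cell_map N q z')). F (cell_map N q z) = \<Psi> i (cell_map N q z', s)))" for i
  proof -
    have "\<exists>\<phi>. q \<in> cells N \<longrightarrow> continuous_on unit_square \<phi> \<and>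
      (\<forall>z\<in>square_boundary. \<phi> z = \<Psi> i (cell_map N q z, b i (cell_map N q z))) \<and>
      (\<forall>z\<in>unit_square. (\<exists>z'\<in>unit_square. \<phi> z = G i q z') \<or>
      (\<exists>z'\<in>square_boundary. \<exists>s\<in>closed_segment (l (i, q)) (b i (cell_map N q z')). \<phi> z = \<Psi> i (cell_map N q z', s)))" for q
    proof (cases "q \<in> cells N")
      case q: True
      have G1: "continuous_on unit_square (G i q)" by (rule map_intoD(1)[OF Gm[OF q]])
      have P1: "continuous_on (square_boundary \<times> UNIV) (\<lambda>p. \<Psi> i (cell_map N q (fst p), snd p))"
        by (intro continuous_on_compose2[OF \<Psi>c] continuous_on_Pair continuous_intros) (use cell_map_boundary[OF q] in auto)
      have b1: "continuous_on square_boundary (\<lambda>z. b i (cell_map N q z))"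
        by (intro continuous_on_compose2[OF b] continuous_intros) (use cell_map_in_square[OF q] square_boundary_subset in blast)
      have eq1: "G i q z = \<Psi> i (cell_map N q (fst (z, l (i, q))), snd (z, l (i, q)))" if z: "z \<in> square_boundary" for z
      proof -
        have "\<rho> \<le> \<bar>l (i, q) - l (\<not> i, q')\<bar>" if "q' \<in> cells N" for q'
          using sep[OF inI[OF q] inI[OF that], of i "\<not> i"] \<rho>(1) by auto
        then have "\<Psi> i (cell_map N q z, l (i, q)) = (\<zeta> i (cell_map N q z, l (i, q)), l (i, q))"
          by (intro \<Psi>out cell_map_boundary[OF q z])
        then show ?thesis using Gbd[OF q z] \<zeta>own[OF q] by (simp add: g_def)
      qed
      show ?thesis
      proof (rule fill_square[OF G1 P1 b1 eq1], goal_cases)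
        case (2 \<phi>)
        then show ?case by (intro exI[of _ \<phi>]) simp
      qed simp
    qed blast
    then obtain \<phi> where \<phi>: "\<And>q. q \<in> cells N \<Longrightarrow> continuous_on unit_square (\<phi> q)"
      "\<And>q z. q \<in> cells N \<Longrightarrow> z \<in> square_boundary \<Longrightarrow> \<phi> q z = \<Psi> i (cell_map N q z, b i (cell_map N q z))"
      "\<And>q z. q \<in> cells N \<Longrightarrow> z \<in> unit_square \<Longrightarrow> (\<exists>z'\<in>unit_square. \<phi> q z = G i q z') \<or>
      (\<exists>z'\<in>square_boundary. \<exists>s\<in>closed_segment (l (i, q)) (b i (cell_map N q z')). \<phi> q z = \<Psi> i (cell_map N q z', s))"
      by metis
    obtain F where "continuous_on unit_square F" "\<And>q z. q \<in> cells N \<Longrightarrow> z \<in> unit_square \<Longrightarrow> F (cell_map N q z) = \<phi> q z"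
    proof (rule paste_cells[where \<phi> = \<phi> and \<psi> = "\<lambda>y. \<Psi> i (y, b i y)", OF N], goal_cases)
      case (1 q)
      show ?case by (rule \<phi>(1)[OF 1(2)])
    next
      case (2 q z)
      show ?case by (rule \<phi>(2)[OF 2(2,3)])
    next
      case (3 F)
      show ?case by (rule 3(1)[OF 3(2,3)])
    qed
    then show ?thesis using \<phi>(3) by (intro exI[of _ F]) simp
  qed
  then obtain F where Fc: "\<And>i. continuous_on unit_square (F i)"
    and F: "\<And>i q z. q \<in> cells N \<Longrightarrow> z \<in> unit_square \<Longrightarrow>
      (\<exists>z'\<in>unit_square. F i (cell_map N q z) = G i q z') \<or>
      (\<exists>z'\<in>square_boundary. \<exists>s\<in>closed_segment (l (i, q)) (b i (cell_map N q z')). F i (cell_map N q z) = \<Psi> i (cell_map N q z', s))"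
    by metis
  have Fcell: "fst (F i (cell_map N q z)) \<in> X \<and> dist (f i (cell_map N q z)) (F i (cell_map N q z)) \<le> 8 * e"
    if q: "q \<in> cells N" and z: "z \<in> unit_square" for i q z
  proof -
    let ?y = "cell_map N q z"
    have 00: "(0, 0) \<in> unit_square" by simp
    have lb': "\<bar>l (i, q) - b i ?y\<bar> \<le> 2 * e"
      using l[OF inI[OF q], of i] osc[OF q 00 z, of i] by (auto simp: dist_real_def)
    have col: "dist (a i ?y) (a i (collapse2 N (cell_map N q z'))) < e" if z': "z' \<in> unit_square" for z'
    proof -
      obtain z'' where "z'' \<in> unit_square" "collapse2 N (cell_map N q z') = cell_map N q z''"
        by (rule collapse2_cell[OF q z'])
      then show ?thesis using osc[OF q z, of z'' i] by simp
    qed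
    have fin: ?thesis if "x \<in> X" "F i ?y = (x, s)" "dist (a i ?y) x \<le> 4 * e" "\<bar>b i ?y - s\<bar> \<le> 4 * e" for x s
    proof -
      have "f i ?y = (a i ?y, b i ?y)" by (simp add: a_def b_def)
      then have "dist (f i ?y) (F i ?y) \<le> dist (a i ?y) x + dist (b i ?y) s"
        using that(2) dist_Pair_le by simp
      then show ?thesis using that by (simp add: dist_real_def)
    qed
    from F[OF q z, of i] show ?thesis
    proof (elim disjE bexE)
      fix z' assume z': "z' \<in> unit_square" and eq: "F i ?y = G i q z'"
      have Gin: "G i q z' \<in> X \<times> slab (i, q)" by (rule map_intoD(2)[OF Gm[OF q] z'])
      show ?thesis
      proof (rule fin)
        show "F i ?y = (fst (G i q z'), snd (G i q z'))" using eq by simp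
        show "fst (G i q z') \<in> X" using Gin by (simp add: mem_Times_iff)
        show "dist (a i ?y) (fst (G i q z')) \<le> 4 * e"
          using col[OF z'] gnear[OF q z', of i] Gn[OF q z', of i] e'(2)
            dist_triangle[of "a i ?y" "fst (G i q z')" "g i q z'"]
            dist_triangle[of "a i ?y" "g i q z'" "a i (collapse2 N (cell_map N q z'))"] by linarith
        have "\<bar>snd (G i q z') - l (i, q)\<bar> \<le> \<rho>" using Gin by (simp add: mem_Times_iff slab_iff)
        then show "\<bar>b i ?y - snd (G i q z')\<bar> \<le> 4 * e" using lb' \<rho>(2) e by linarith
      qed
    next
      fix z' s assume z': "z' \<in> square_boundary" and s: "s \<in> closed_segment (l (i, q)) (b i (cell_map N q z'))"
        and eq: "F i ?y = \<Psi> i (cell_map N q z', s)"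
      have zs: "z' \<in> unit_square" using z' square_boundary_subset by blast
      have yl: "cell_map N q z' \<in> grid_lines N" by (rule cell_map_boundary[OF q z'])
      let ?w = "\<Psi> i (cell_map N q z', s)"
      show ?thesis
      proof (rule fin)
        show "F i ?y = (fst ?w, snd ?w)" using eq by simp
        show "fst ?w \<in> X" using \<Psi>slab[OF yl] by blast
        obtain s' where "dist (\<zeta> i (cell_map N q z', s')) (fst ?w) < e'" using \<Psi>near[OF yl] by blast
        then show "dist (a i ?y) (fst ?w) \<le> 4 * e"
          using col[OF zs] \<zeta>near[OF cell_map_in_square[OF q zs], of i s'] e'(2)
            dist_triangle[of "a i ?y" "fst ?w" "\<zeta> i (cell_map N q z', s')"]
            dist_triangle[of "a i ?y" "\<zeta> i (cell_map N q z', s')" "a i (collapse2 N (cell_map N q z'))"] by linarith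
        have "\<bar>b i (cell_map N q z') - b i ?y\<bar> \<le> 2 * e" using osc[OF q zs z, of i] e by (simp add: dist_real_def)
        then have "\<bar>s - b i ?y\<bar> \<le> 2 * e"
          using s lb' by (auto simp: closed_segment_eq_real_ivl abs_le_iff split: if_splits)
        moreover have "\<bar>snd ?w - s\<bar> \<le> 2 * \<rho>"
          using \<Psi>slab[OF yl, of i s] \<rho>(1) by (auto simp: slab_iff)
        ultimately show "\<bar>b i ?y - snd ?w\<bar> \<le> 4 * e" using \<rho>(2) by linarith
      qed
    qed
  qed
  have Fsq: "fst (F i y) \<in> X \<and> dist (f i y) (F i y) \<le> 8 * e" if "y \<in> unit_square" for i y
  proof (rule cell_cover[OF that N])
    fix q z assume "q \<in> cells N" "z \<in> unit_square" "y = cell_map N q z"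
    then show ?thesis using Fcell by simp
  qed
  have Fm: "map_into unit_square (X \<times> UNIV) (F i)" for i
    unfolding map_into_def using Fc Fsq by (auto simp: mem_Times_iff)
  have Fd: "unif_dist unit_square (f i) (F i) < \<epsilon>" for i
  proof (rule unif_dist_lessI)
    show "8 * e < \<epsilon>" using \<open>\<epsilon> > 0\<close> by (simp add: e_def)
  qed (use Fsq in auto)
  have "F True y \<noteq> F False y'" if y: "y \<in> unit_square" and y': "y' \<in> unit_square" for y y'
  proof -
    obtain q z where q: "q \<in> cells N" "z \<in> unit_square" "y = cell_map N q z" by (rule cell_cover[OF y N])
    obtain q' z' where q': "q' \<in> cells N" "z' \<in> unit_square" "y' = cell_map N q' z'" by (rule cell_cover[OF y' N])
    have bd: "cell_map N q z \<in> grid_lines N" if "q \<in> cells N" "z \<in> square_boundary" for q z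
      using cell_map_boundary that by blast
    show ?thesis
      using F[OF q(1,2), of True] F[OF q'(1,2), of False] unfolding q(3)[symmetric] q'(3)[symmetric]
    proof (elim disjE bexE)
      fix w w' assume "w \<in> unit_square" "F True y = G True q w" "w' \<in> unit_square" "F False y' = G False q' w'"
      then show ?thesis using GG[OF q(1) q'(1)] by simp
    next
      fix w w' s assume "w \<in> unit_square" "F True y = G True q w" "w' \<in> square_boundary"
        "F False y' = \<Psi> False (cell_map N q' w', s)"
      then show ?thesis using G\<Psi>[OF q(1) _ bd[OF q'(1)], of w w' True s] by simp
    next
      fix w w' s assume "w \<in> square_boundary" "F True y = \<Psi> True (cell_map N q w, s)" "w' \<in> unit_square"
        "F False y' = G False q' w'"
      then show ?thesis using G\<Psi>[OF q'(1) _ bd[OF q(1)], of w' w False s] by simp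
    next
      fix w w' s s' assume "w \<in> square_boundary" "F True y = \<Psi> True (cell_map N q w, s)"
        "w' \<in> square_boundary" "F False y' = \<Psi> False (cell_map N q' w', s')"
      then show ?thesis using \<Psi>\<Psi>[OF bd[OF q(1)] bd[OF q'(1)], of w w' s s'] by simp
    qed
  qed
  then have "F True ` unit_square \<inter> F False ` unit_square = {}" by blast
  then show "\<exists>g1 g2. map_into unit_square (X \<times> UNIV) g1 \<and> map_into unit_square (X \<times> UNIV) g2 \<and>
         unif_dist unit_square f1 g1 < \<epsilon> \<and> unif_dist unit_square f2 g2 < \<epsilon> \<and>
         g1 ` unit_square \<inter> g2 ` unit_square = {}"
    using Fm[of True] Fm[of False] Fd[of True] Fd[of False] unfolding f_def by auto
qed

theorem theorem3p4:
  fixes X :: "'a::metric_space set"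
  assumes "locally compact X"
    and "metric_ANR X"
    and "disjoint_arcs_property X"
  shows "disjoint_path_concordances_property X \<longleftrightarrow>
    disjoint_disks_property (X \<times> (UNIV :: real set))"
proof -
  obtain lam where lam: "locally_blending X lam"
    using metric_ANR_locally_blending[OF assms(2)] by blast
  show ?thesis
    using disjoint_path_concordances_imp_disjoint_disks[OF lam assms(3)]
      disjoint_disks_imp_disjoint_path_concordances[OF lam assms(3)] by blast
qed

end
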